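(* Let $m,k,n$ be integers with $m\ge 0$, $m\le k\le 2m$ and $k<n$, let $\langle z,z\rangle=\sum_{j=1}^m|z_j|^2-\sum_{j=m+1}^k|z_j|^2$ be the corresponding degenerate Hermitian form on $\mathbb{C}^n$, and let $\overline{Q}_{\langle\cdot,\cdot\rangle}\subset\mathbb{CP}^{n+1}$ be the closure of the associated hyperquadric $\{\operatorname{Im} w=\langle z,z\rangle\}\subset\mathbb{C}^{n+1}$. Then every CR-automorphism of $\overline{Q}_{\langle\cdot,\cdot\rangle}$ extends to a holomorphic automorphism of $\mathbb{CP}^{n+1}$.
   Context: Write $z=(z_1,\dots,z_n)\in\mathbb{C}^n$, and let $\langle z,z\rangle=\sum_{j=1}^m|z_j|^2-\sum_{j=m+1}^k|z_j|^2$ with $m\ge 0$, $m\le k\le 2m$, $k<n$ (empty sums are zero). The associated quadric is $$Q_{\langle\cdot,\cdot\rangle}:=\{(z,w)\in\mathbb{C}^{n+1}:\operatorname{Im} w=\langle z,z\rangle\}.$$ Let $(\zeta:\mathbf{z}:\mathbf{w})$, with $\mathbf{z}=(\mathbf{z}_1,\dots,\mathbf{z}_n)$, be homogeneous coordinates in $\mathbb{CP}^{n+1}$, with $\mathbb{C}^{n+1}$ given in $\mathbb{CP}^{n+1}$ by $\zeta\ne 0$ via $z=\mathbf{z}/\zeta$, $w=\mathbf{w}/\zeta$. The closure of $Q_{\langle\cdot,\cdot\rangle}$ in $\mathbb{CP}^{n+1}$ is $$\overline{Q}_{\langle\cdot,\cdot\rangle}=\left\{(\zeta:\mathbf{z}:\mathbf{w})\in\mathbb{CP}^{n+1}:\tfrac{1}{2i}\left(\mathbf{w}\overline{\zeta}-\zeta\overline{\mathbf{w}}\right)=\langle\mathbf{z},\mathbf{z}\rangle\right\}.$$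 Its singular set is $$S_{\langle\cdot,\cdot\rangle}=\{(0:\mathbf{z}:0)\in\mathbb{CP}^{n+1}:\mathbf{z}_1=\dots=\mathbf{z}_k=0\},$$ and its regular part is $\tilde Q_{\langle\cdot,\cdot\rangle}:=\overline{Q}_{\langle\cdot,\cdot\rangle}\setminus S_{\langle\cdot,\cdot\rangle}$, a real hypersurface that is everywhere Levi degenerate. A $C^1$-smooth CR-automorphism of $\tilde Q_{\langle\cdot,\cdot\rangle}$ is meant in the usual sense: a $C^1$-diffeomorphism of $\tilde Q_{\langle\cdot,\cdot\rangle}$ onto itself whose differential at every point maps the complex tangent space complex-linearly onto the complex tangent space at the image point. Definition. A map $f:\overline{Q}_{\langle\cdot,\cdot\rangle}\to\overline{Q}_{\langle\cdot,\cdot\rangle}$ is called a CR-automorphism of $\overline{Q}_{\langle\cdot,\cdot\rangle}$ if $f$ is bijective and satisfies the conditions: (a) $f$ preserves $\tilde Q_{\langle\cdot,\cdot\rangle}$, and the restriction of $f$ to $\tilde Q_{\langle\cdot,\cdot\rangle}$ is a $C^1$-smooth CR-automorphism of $\tilde Q_{\langle\cdot,\cdot\rangle}$; (b) if $k=m$, then $f$ holomorphically extends to a neighborhood of $S_{\langle\cdot,\cdot\rangle}$.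
   Formalization: For m<k and n>k+1 the definition puts only bijectivity on f along the singular set S, so the claim fails (identity off S, a permutation on S). There the extension agrees with f on the regular part, and on the whole closed quadric if f is continuous, which is also necessary. *)

theory Defs
  imports "HOL-Analysis.Analysis"
begin

section \<open>Complex projective space\<close>

text \<open>
  With \<open>n = CARD('n)\<close>, the vector \<open>(\<zeta>, z, w)\<close> of homogeneous coordinates ranges over
  \<open>\<complex> \<times> \<complex>\<^sup>n \<times> \<complex>\<close>; \<open>'n cproj\<close> is its projectivisation, a model of the complex projective space
  of dimension \<open>n + 1\<close>.
\<close>

type_synonym 'n homog = "complex \<times> (complex ^ 'n) \<times> complex"
type_synonym 'n affine = "(complex ^ 'n) \<times> complex"

definition hscale :: "complex \<Rightarrow> 'n::finite homog \<Rightarrow> 'n homog" where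
  "hscale c v = (case v of (\<zeta>, z, w) \<Rightarrow> (c * \<zeta>, c *s z, c * w))"

definition proj_rel :: "'n::finite homog \<Rightarrow> 'n homog \<Rightarrow> bool" where
  "proj_rel u v \<longleftrightarrow> u \<noteq> 0 \<and> v \<noteq> 0 \<and> (\<exists>c. c \<noteq> 0 \<and> v = hscale c u)"

lemma hscale_hscale: "hscale a (hscale b v) = hscale (a * b) v"
  by (cases v) (simp add: hscale_def mult.assoc vector_smult_assoc)

lemma hscale_1 [simp]: "hscale 1 v = v"
  by (cases v) (simp add: hscale_def)

lemma hscale_eq_0_iff: "c \<noteq> 0 \<Longrightarrow> hscale c v = 0 \<longleftrightarrow> v = 0"
  by (cases v) (simp add: hscale_def zero_prod_def)

lemma part_equivp_proj_rel: "part_equivp (proj_rel :: 'n::finite homog \<Rightarrow> _)"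
proof (rule part_equivpI)
  have "proj_rel (1, 0, 0 :: complex) (1, 0 :: complex ^ 'n, 0)"
    unfolding proj_rel_def by (auto simp: zero_prod_def intro!: exI[of _ 1])
  then show "\<exists>x :: 'n homog. proj_rel x x" by blast
  show "symp (proj_rel :: 'n homog \<Rightarrow> _)"
  proof (rule sympI)
    fix u v :: "'n homog" assume "proj_rel u v"
    then obtain c where c: "c \<noteq> 0" "v = hscale c u" "u \<noteq> 0" "v \<noteq> 0"
      by (auto simp: proj_rel_def)
    then have "u = hscale (inverse c) v" by (simp add: hscale_hscale)
    with c show "proj_rel v u" by (metis proj_rel_def inverse_nonzero_iff_nonzero)
  qed
  show "transp (proj_rel :: 'n homog \<Rightarrow> _)"
  proof (rule transpI)
    fix u v x :: "'n homog" assume "proj_rel u v" "proj_rel v x"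
    then obtain c d where "c \<noteq> 0" "v = hscale c u" "u \<noteq> 0" "x \<noteq> 0" "d \<noteq> 0" "x = hscale d v"
      by (auto simp: proj_rel_def)
    then show "proj_rel u x"
      unfolding proj_rel_def by (metis hscale_hscale mult_eq_0_iff)
  qed
qed

quotient_type (overloaded) 'n cproj = "'n::finite homog" / partial: proj_rel
  by (rule part_equivp_proj_rel)

text \<open>\<open>proj (\<zeta>, z, w)\<close> is the point \<open>(\<zeta> : z : w)\<close>; it is meaningful for nonzero arguments only.\<close>

abbreviation proj :: "'n::finite homog \<Rightarrow> 'n cproj" where
  "proj \<equiv> abs_cproj"

lemma proj_eq_iff: "u \<noteq> 0 \<Longrightarrow> v \<noteq> 0 \<Longrightarrow> proj u = proj v \<longleftrightarrow> (\<exists>c. c \<noteq> 0 \<and> v = hscale c u)"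
proof -
  assume nz: "u \<noteq> 0" "v \<noteq> 0"
  have refl: "proj_rel x x" if "x \<noteq> 0" for x :: "'a homog"
    using that unfolding proj_rel_def by (metis hscale_1 zero_neq_one)
  have "proj_rel u v \<longleftrightarrow> proj_rel u u \<and> proj_rel v v \<and> proj u = proj v"
    by (rule Quotient_rel[OF Quotient_cproj, symmetric])
  then show ?thesis using nz refl[of u] refl[of v] by (auto simp: proj_rel_def)
qed

lemma cproj_cases: obtains v where "v \<noteq> 0" "p = proj v"
proof -
  have "proj_rel (rep_cproj p) (rep_cproj p)"
    by (rule Quotient_rep_reflp[OF Quotient_cproj])
  then have "rep_cproj p \<noteq> 0" by (simp add: proj_rel_def)
  moreover have "p = proj (rep_cproj p)"
    by (rule Quotient_abs_rep[OF Quotient_cproj, symmetric])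
  ultimately show ?thesis using that by blast
qed

text \<open>The quotient topology.\<close>

instantiation cproj :: (finite) topological_space
begin

definition open_cproj :: "'a cproj set \<Rightarrow> bool" where
  "open_cproj U \<longleftrightarrow> open {v. v \<noteq> 0 \<and> proj v \<in> U}"

instance
proof
  have "{v :: 'a homog. v \<noteq> 0 \<and> proj v \<in> UNIV} = - {0}" by auto
  then show "open (UNIV :: 'a cproj set)"
    unfolding open_cproj_def by (simp add: open_Compl)
next
  fix S T :: "'a cproj set" assume "open S" "open T"
  moreover have "{v. v \<noteq> 0 \<and> proj v \<in> S \<inter> T}
    = {v. v \<noteq> 0 \<and> proj v \<in> S} \<inter> {v. v \<noteq> 0 \<and> proj v \<in> T}" by auto
  ultimately show "open (S \<inter> T)"
    unfolding open_cproj_def by (simp only: open_Int)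
next
  fix K :: "'a cproj set set" assume "\<forall>S\<in>K. open S"
  moreover have "{v. v \<noteq> 0 \<and> proj v \<in> \<Union>K} = (\<Union>S\<in>K. {v. v \<noteq> 0 \<and> proj v \<in> S})" by auto
  ultimately show "open (\<Union>K)"
    unfolding open_cproj_def by (metis (no_types, lifting) open_UN)
qed

end

text \<open>
  The standard affine charts, one for each homogeneous coordinate \<open>\<zeta>\<close>, \<open>z_j\<close>, \<open>w\<close>. The chart of a
  coordinate divides the other coordinates by it. In the charts of \<open>z_j\<close> and \<open>w\<close> the quotient
  \<open>\<zeta>/z_j\<close>, resp. \<open>\<zeta>/w\<close>, takes the place left free by the coordinate that has become 1.
\<close>

datatype 'n hindex = IZeta | IZ 'n | IW

fun hcoord :: "'n::finite hindex \<Rightarrow> 'n homog \<Rightarrow> complex" where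
  "hcoord IZeta (\<zeta>, z, w) = \<zeta>"
| "hcoord (IZ j) (\<zeta>, z, w) = z $ j"
| "hcoord IW (\<zeta>, z, w) = w"

fun affine_coords :: "'n::finite hindex \<Rightarrow> 'n homog \<Rightarrow> 'n affine" where
  "affine_coords IZeta (\<zeta>, z, w) = ((\<chi> l. z $ l / \<zeta>), w / \<zeta>)"
| "affine_coords (IZ j) (\<zeta>, z, w) = ((\<chi> l. (if l = j then \<zeta> else z $ l) / z $ j), w / z $ j)"
| "affine_coords IW (\<zeta>, z, w) = ((\<chi> l. z $ l / w), \<zeta> / w)"

lemma hcoord_hscale: "hcoord i (hscale c v) = c * hcoord i v"
  by (cases v; cases i) (auto simp: hscale_def)

lemma affine_coords_hscale: "c \<noteq> 0 \<Longrightarrow> affine_coords i (hscale c v) = affine_coords i v"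
  by (cases v; cases i) (auto simp: hscale_def vec_eq_iff)

definition chart_dom :: "'n::finite hindex \<Rightarrow> 'n cproj set" where
  "chart_dom i = {proj v | v. hcoord i v \<noteq> 0}"

lift_definition chart :: "'n::finite hindex \<Rightarrow> 'n cproj \<Rightarrow> 'n affine" is affine_coords
  by (auto simp: proj_rel_def affine_coords_hscale)

lemma chart_proj: "v \<noteq> 0 \<Longrightarrow> chart i (proj v) = affine_coords i v"
proof -
  assume "v \<noteq> 0"
  then have "proj_rel v v" unfolding proj_rel_def by (metis hscale_1 zero_neq_one)
  then show ?thesis by (rule chart.abs_eq)
qed

lemma bij_betw_chart: "bij_betw (chart i) (chart_dom i) UNIV"
proof (rule bij_betw_imageI)
  have nz: "v \<noteq> 0" if "hcoord i v \<noteq> 0" for v :: "'a homog"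
    using that by (cases i) (auto simp: zero_prod_def)
  show "inj_on (chart i) (chart_dom i)"
  proof (rule inj_onI)
    fix p q assume "p \<in> chart_dom i" "q \<in> chart_dom i" and eq: "chart i p = chart i q"
    then obtain u v where uv: "p = proj u" "q = proj v" "hcoord i u \<noteq> 0" "hcoord i v \<noteq> 0"
      by (auto simp: chart_dom_def)
    obtain a x b c y d where [simp]: "u = (a, x, b)" "v = (c, y, d)" by (metis prod_cases3)
    have "affine_coords i u = affine_coords i v" using eq uv nz by (simp add: chart_proj)
    then have "v = hscale (hcoord i v / hcoord i u) u"
      using uv by (cases i) (auto simp: hscale_def vec_eq_iff field_simps split: if_splits, metis)
    then show "p = q"
      using uv nz by (metis divide_eq_0_iff proj_eq_iff)
  qed
  have "x \<in> chart i ` chart_dom i" for x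
  proof -
    obtain z w where x: "x = (z, w)" by force
    have "\<exists>v. hcoord i v \<noteq> 0 \<and> affine_coords i v = x"
    proof (cases i)
      case IZeta
      then show ?thesis using x by (intro exI[of _ "(1, z, w)"]) (auto simp: vec_eq_iff)
    next
      case (IZ j)
      then show ?thesis using x
        by (intro exI[of _ "(z $ j, (\<chi> l. if l = j then 1 else z $ l), w)"]) (auto simp: vec_eq_iff)
    next
      case IW
      then show ?thesis using x by (intro exI[of _ "(w, z, 1)"]) (auto simp: vec_eq_iff)
    qed
    then show ?thesis using nz by (force simp: chart_dom_def chart_proj image_iff)
  qed
  then show "chart i ` chart_dom i = UNIV" by auto
qed

section \<open>Holomorphic maps\<close>

definition cscale :: "complex \<Rightarrow> 'n::finite affine \<Rightarrow> 'n affine" where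
  "cscale c v = (c *s fst v, c * snd v)"

definition holomorphic_affine :: "('n::finite affine \<Rightarrow> 'n affine) \<Rightarrow> 'n affine set \<Rightarrow> bool" where
  "holomorphic_affine g W \<longleftrightarrow>
     (\<forall>x\<in>W. \<exists>A. (g has_derivative A) (at x) \<and> (\<forall>c v. A (cscale c v) = cscale c (A v)))"

text \<open>
  Holomorphy on an open set \<open>U\<close>: near every point and for all charts around it and around its image,
  the map is represented by a holomorphic map of affine space.
\<close>

definition holomorphic_proj :: "('n::finite cproj \<Rightarrow> 'n cproj) \<Rightarrow> 'n cproj set \<Rightarrow> bool" where
  "holomorphic_proj F U \<longleftrightarrow>
     (\<forall>p\<in>U. \<forall>i j. p \<in> chart_dom i \<and> F p \<in> chart_dom j \<longrightarrow>
        (\<exists>W g. open W \<and> chart i p \<in> W \<and> holomorphic_affine g W \<and>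
           (\<forall>q\<in>chart_dom i. chart i q \<in> W \<longrightarrow>
              q \<in> U \<and> F q \<in> chart_dom j \<and> chart j (F q) = g (chart i q))))"

definition holomorphic_automorphism :: "('n::finite cproj \<Rightarrow> 'n cproj) \<Rightarrow> bool" where
  "holomorphic_automorphism F \<longleftrightarrow>
     bij F \<and> holomorphic_proj F UNIV \<and> holomorphic_proj (inv F) UNIV"

section \<open>CR-automorphisms of embedded submanifolds\<close>

text \<open>Below, \<open>M\<close> stands for an embedded real submanifold of projective space.\<close>

text \<open>
  The open set \<open>W\<close> and the \<open>C\<^sup>1\<close> map \<open>g\<close> with derivative \<open>g'\<close> extend, near \<open>p\<close>, the representation
  of \<open>f : M \<rightarrow> M\<close> in the charts \<open>i\<close> and \<open>j\<close>.
\<close>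

definition C1_local_ext ::
  "'n::finite cproj set \<Rightarrow> ('n cproj \<Rightarrow> 'n cproj) \<Rightarrow> 'n hindex \<Rightarrow> 'n hindex \<Rightarrow> 'n cproj \<Rightarrow>
   'n affine set \<Rightarrow> ('n affine \<Rightarrow> 'n affine) \<Rightarrow> ('n affine \<Rightarrow> 'n affine \<Rightarrow>\<^sub>L 'n affine) \<Rightarrow> bool" where
  "C1_local_ext M f i j p W g g' \<longleftrightarrow>
     open W \<and> chart i p \<in> W \<and>
     (\<forall>x\<in>W. (g has_derivative blinfun_apply (g' x)) (at x)) \<and> continuous_on W g' \<and>
     (\<forall>q\<in>M \<inter> chart_dom i. chart i q \<in> W \<longrightarrow> f q \<in> chart_dom j \<and> chart j (f q) = g (chart i q))"

definition C1_smooth_on :: "'n::finite cproj set \<Rightarrow> ('n cproj \<Rightarrow> 'n cproj) \<Rightarrow> bool" where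
  "C1_smooth_on M f \<longleftrightarrow>
     (\<forall>p\<in>M. \<forall>i j. p \<in> chart_dom i \<and> f p \<in> chart_dom j \<longrightarrow>
        (\<exists>W g g'. C1_local_ext M f i j p W g g'))"

definition C1_diffeomorphism :: "'n::finite cproj set \<Rightarrow> ('n cproj \<Rightarrow> 'n cproj) \<Rightarrow> bool" where
  "C1_diffeomorphism M f \<longleftrightarrow>
     bij_betw f M M \<and> C1_smooth_on M f \<and> C1_smooth_on M (inv_into M f)"

text \<open>The tangent space of \<open>M\<close> at \<open>p\<close>, seen in the chart \<open>i\<close>: velocities of \<open>C\<^sup>1\<close> curves in \<open>M\<close>.\<close>

definition tangent_space :: "'n::finite cproj set \<Rightarrow> 'n hindex \<Rightarrow> 'n cproj \<Rightarrow> 'n affine set" where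
  "tangent_space M i p =
     {v. \<exists>(\<gamma> :: real \<Rightarrow> 'n affine) e. e > 0 \<and> \<gamma> C1_differentiable_on {-e<..<e} \<and>
           \<gamma> ` {-e<..<e} \<subseteq> chart i ` (M \<inter> chart_dom i) \<and>
           \<gamma> 0 = chart i p \<and> (\<gamma> has_vector_derivative v) (at 0)}"

definition complex_tangent_space :: "'n::finite cproj set \<Rightarrow> 'n hindex \<Rightarrow> 'n cproj \<Rightarrow> 'n affine set" where
  "complex_tangent_space M i p =
     {v. v \<in> tangent_space M i p \<and> cscale \<i> v \<in> tangent_space M i p}"

text \<open>
  The differential of \<open>f\<close> at \<open>p\<close> is the restriction of \<open>g' (chart i p)\<close> to the tangent space, which
  does not depend on the local extension \<open>g\<close>.
\<close>

definition C1_CR_automorphism :: "'n::finite cproj set \<Rightarrow> ('n cproj \<Rightarrow> 'n cproj) \<Rightarrow> bool" where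
  "C1_CR_automorphism M f \<longleftrightarrow>
     C1_diffeomorphism M f \<and>
     (\<forall>p\<in>M. \<forall>i j. p \<in> chart_dom i \<and> f p \<in> chart_dom j \<longrightarrow>
        (\<forall>W g g'. C1_local_ext M f i j p W g g' \<longrightarrow>
           blinfun_apply (g' (chart i p)) ` complex_tangent_space M i p
             = complex_tangent_space M j (f p) \<and>
           (\<forall>v\<in>complex_tangent_space M i p.
              blinfun_apply (g' (chart i p)) (cscale \<i> v)
                = cscale \<i> (blinfun_apply (g' (chart i p)) v))))"

section \<open>The quadric\<close>

text \<open>
  The coordinates of \<open>\<complex>\<^sup>n\<close> are indexed by the type \<open>'n\<close>; \<open>idx\<close>, a bijection from \<open>{1..n}\<close> onto
  \<open>'n\<close>, numbers them, so that \<open>z $ idx j\<close> is the coordinate \<open>z_j\<close>.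
\<close>

definition hform :: "(nat \<Rightarrow> 'n::finite) \<Rightarrow> nat \<Rightarrow> nat \<Rightarrow> complex ^ 'n \<Rightarrow> real" where
  "hform idx m k z =
     (\<Sum>j=1..m. (cmod (z $ idx j))\<^sup>2) - (\<Sum>j=m+1..k. (cmod (z $ idx j))\<^sup>2)"

definition quadric :: "(nat \<Rightarrow> 'n::finite) \<Rightarrow> nat \<Rightarrow> nat \<Rightarrow> 'n affine set" where
  "quadric idx m k = {(z, w). Im w = hform idx m k z}"

definition closed_quadric :: "(nat \<Rightarrow> 'n::finite) \<Rightarrow> nat \<Rightarrow> nat \<Rightarrow> 'n cproj set" where
  "closed_quadric idx m k = closure ((\<lambda>(z, w). proj (1, z, w)) ` quadric idx m k)"

definition singular_set :: "(nat \<Rightarrow> 'n::finite) \<Rightarrow> nat \<Rightarrow> 'n cproj set" where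
  "singular_set idx k = {proj (0, z, 0) | z. z \<noteq> 0 \<and> (\<forall>j\<in>{1..k}. z $ idx j = 0)}"

definition regular_quadric :: "(nat \<Rightarrow> 'n::finite) \<Rightarrow> nat \<Rightarrow> nat \<Rightarrow> 'n cproj set" where
  "regular_quadric idx m k = closed_quadric idx m k - singular_set idx k"

lemma hform_scale: "hform idx m k (c *s z) = (cmod c)\<^sup>2 * hform idx m k z"
  by (simp add: hform_def norm_mult power_mult_distrib sum_distrib_left right_diff_distrib)

lemma continuous_on_hform: "continuous_on UNIV (hform idx m k)"
  unfolding hform_def by (intro continuous_intros)

lemma quadric_eq_aux:
  "(w * cnj \<zeta> - \<zeta> * cnj w) / (2 * \<i>) = complex_of_real r \<longleftrightarrow> Im (w * cnj \<zeta>) = r"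
proof -
  have "\<zeta> * cnj w = cnj (w * cnj \<zeta>)" by simp
  then have "(w * cnj \<zeta> - \<zeta> * cnj w) / (2 * \<i>) = complex_of_real (Im (w * cnj \<zeta>))"
    by (simp only: complex_diff_cnj) (simp add: field_simps)
  then show ?thesis by (simp only: of_real_eq_iff)
qed

text \<open>The equation of the closure in homogeneous coordinates.\<close>

lemma closed_quadric_eq:
  "closed_quadric idx m k =
     {proj (\<zeta>, z, w) | \<zeta> z w. (\<zeta>, z, w) \<noteq> 0 \<and>
        (w * cnj \<zeta> - \<zeta> * cnj w) / (2 * \<i>) = complex_of_real (hform idx m k z)}"
  (is "_ = ?R")
proof
  let ?Q = "(\<lambda>(z, w). proj (1, z, w)) ` quadric idx m k"
  define \<rho> :: "'a homog \<Rightarrow> real" where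
    "\<rho> = (\<lambda>v. Im (snd (snd v) * cnj (fst v)) - hform idx m k (fst (snd v)))"
  have \<rho>: "\<rho> (\<zeta>, z, w) = Im (w * cnj \<zeta>) - hform idx m k z" for \<zeta> z w
    by (simp add: \<rho>_def)
  have cont: "continuous_on UNIV \<rho>"
    unfolding \<rho>_def
    by (intro continuous_intros continuous_on_compose2[OF continuous_on_hform]) auto
  have R: "?R = {proj v | v. v \<noteq> 0 \<and> \<rho> v = 0}"
    unfolding quadric_eq_aux by (force simp: \<rho>)
  have scale: "\<rho> (hscale c v) = (cmod c)\<^sup>2 * \<rho> v" for c v
  proof (cases v)
    case (fields \<zeta> z w)
    have "c * w * cnj (c * \<zeta>) = (c * cnj c) * (w * cnj \<zeta>)" by simp
    also have "\<dots> = complex_of_real ((cmod c)\<^sup>2) * (w * cnj \<zeta>)"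
      by (simp only: complex_norm_square)
    finally have "Im (c * w * cnj (c * \<zeta>)) = (cmod c)\<^sup>2 * Im (w * cnj \<zeta>)"
      by (simp only: Im_complex_of_real Re_complex_of_real times_complex.simps)
    then show ?thesis
      using fields by (simp only: hscale_def \<rho> hform_scale prod.case right_diff_distrib)
  qed
  have iff: "proj v \<in> ?R \<longleftrightarrow> \<rho> v = 0" if vnz: "v \<noteq> 0" for v
  proof
    assume "proj v \<in> ?R"
    then obtain u where u: "u \<noteq> 0" "\<rho> u = 0" "proj v = proj u" unfolding R by auto
    then obtain c where "u = hscale c v" "c \<noteq> 0" using vnz proj_eq_iff[of v u] u by blast
    then show "\<rho> v = 0" using u scale[of c v] by simp
  next
    assume "\<rho> v = 0"
    with vnz show "proj v \<in> ?R" unfolding R by blast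
  qed
  show "closed_quadric idx m k \<subseteq> ?R"
    unfolding closed_quadric_def
  proof (rule closure_minimal)
    show "?Q \<subseteq> ?R"
      unfolding R by (force simp: quadric_def \<rho> zero_prod_def)
    have "{v. v \<noteq> 0 \<and> proj v \<in> - ?R} = {v. v \<noteq> 0 \<and> \<rho> v \<noteq> 0}"
      by (intro Collect_cong conj_cong refl) (simp only: Compl_iff iff simp_thms)
    also have "\<dots> = {v. \<rho> v \<noteq> 0} - {0}" by blast
    finally have "{v. v \<noteq> 0 \<and> proj v \<in> - ?R} = {v. \<rho> v \<noteq> 0} - {0}" .
    moreover have "open {v. \<rho> v \<noteq> 0}"
      by (rule open_Collect_neq[OF cont]) simp
    ultimately show "closed ?R"
      unfolding closed_def open_cproj_def by (simp only: open_Diff closed_singleton)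
  qed
  have finite_part: "proj (\<zeta>, z, w) \<in> ?Q" if "\<rho> (\<zeta>, z, w) = 0" "\<zeta> \<noteq> 0" for \<zeta> z w
  proof -
    let ?v = "hscale (inverse \<zeta>) (\<zeta>, z, w)"
    have v: "?v = (1, inverse \<zeta> *s z, inverse \<zeta> * w)" using that by (simp add: hscale_def)
    have "\<rho> ?v = 0" using that by (simp add: scale)
    then have "(inverse \<zeta> *s z, inverse \<zeta> * w) \<in> quadric idx m k"
      unfolding v \<rho> by (simp add: quadric_def)
    moreover have "proj (\<zeta>, z, w) = proj ?v"
      using that by (subst proj_eq_iff)
        (auto simp: v zero_prod_def intro!: exI[of _ "inverse \<zeta>"])
    ultimately show ?thesis unfolding v by force
  qed
  show "?R \<subseteq> closed_quadric idx m k"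
  proof
    fix p assume "p \<in> ?R"
    then obtain \<zeta> z w where v: "(\<zeta>, z, w) \<noteq> 0" "\<rho> (\<zeta>, z, w) = 0" "p = proj (\<zeta>, z, w)"
      unfolding R by auto
    show "p \<in> closed_quadric idx m k"
    proof (cases "\<zeta> = 0")
      case False
      then show ?thesis
        using finite_part v closure_subset unfolding closed_quadric_def by blast
    next
      case True
      define a where "a = (if w = 0 then 1 else w)"
      have a: "a \<noteq> 0" "Im (w * cnj a) = 0" by (auto simp: a_def)
      have zero: "\<rho> (complex_of_real t * a, z, w) = 0" for t
      proof -
        have "w * cnj (complex_of_real t * a) = complex_of_real t * (w * cnj a)" by simp
        then have "Im (w * cnj (complex_of_real t * a)) = t * Im (w * cnj a)"
          by (metis Im_complex_of_real Re_complex_of_real add_0_right mult_zero_left times_complex.simps(2))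
        then show ?thesis using v(2) True a(2) by (simp only: \<rho>) simp
      qed
      show ?thesis
        unfolding closed_quadric_def closure_iff_nhds_not_empty
      proof (intro allI impI)
        fix A V :: "'a cproj set" assume V: "V \<subseteq> A" "open V" "p \<in> V"
        let ?h = "\<lambda>t. (complex_of_real t * a, z, w)"
        let ?O = "{v. v \<noteq> 0 \<and> proj v \<in> V}"
        have "open (?h -` ?O)"
          using V(2) unfolding open_cproj_def
          by (rule open_vimage) (auto intro!: continuous_intros)
        moreover have "0 \<in> ?h -` ?O" using v V True by auto
        ultimately obtain e where e: "e > 0" "ball 0 e \<subseteq> ?h -` ?O"
          using open_contains_ball by blast
        then have "e / 2 \<in> ball 0 e" by simp
        with e have "?h (e / 2) \<in> ?O" by blast
        moreover have "proj (?h (e / 2)) \<in> ?Q"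
          using finite_part[OF zero[of "e / 2"]] a e by simp
        ultimately show "?Q \<inter> A \<noteq> {}" using V by blast
      qed
    qed
  qed
qed

text \<open>
  For \<open>m < k\<close> the only condition on \<open>f\<close> along the singular set is bijectivity: the identity on the
  regular part together with any permutation of the singular set qualifies, although it is not
  continuous (hence has no holomorphic extension that agrees with it on the singular set) unless the
  permutation is trivial. So for \<open>m < k\<close> and a singular set of more than one point, i.e.
  \<open>n > k + 1\<close>, the extension of an automorphism \<open>f\<close> is that of its restriction to the regular
  part; it agrees with \<open>f\<close> on the whole closed quadric precisely if \<open>f\<close> is continuous.
\<close>

definition CR_automorphism_closed_quadric ::
  "(nat \<Rightarrow> 'n::finite) \<Rightarrow> nat \<Rightarrow> nat \<Rightarrow> ('n cproj \<Rightarrow> 'n cproj) \<Rightarrow> bool" where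
  "CR_automorphism_closed_quadric idx m k f \<longleftrightarrow>
     bij_betw f (closed_quadric idx m k) (closed_quadric idx m k) \<and>
     f ` regular_quadric idx m k = regular_quadric idx m k \<and>
     C1_CR_automorphism (regular_quadric idx m k) f \<and>
     (k = m \<longrightarrow> (\<exists>U F. open U \<and> singular_set idx k \<subseteq> U \<and> holomorphic_proj F U \<and>
        (\<forall>p\<in>U \<inter> closed_quadric idx m k. F p = f p)))"

end

theory Submission
  imports Defs "HOL-Complex_Analysis.Conformal_Mappings"
begin

text \<open>A holomorphic curve in the quadric lifts locally to \<open>\<complex>\<^bsup>n+2\<^esup>\<close>, where by polarisation it spans an
  isotropic subspace. As a CR-automorphism maps the complex lines in the quadric to holomorphic
  curves, it preserves orthogonality of points with respect to the Hermitian form of the quadric.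

  If the form takes both signs, there are null lines outside the radical. In an affine chart the
  map is affine along these, and it is affine along the lines \<open>z = const\<close> because a rotation turns
  two points of such a line into sums of orthogonal null vectors. Hence it is linear.

  If the form is semidefinite, orthogonality only says that leaves (lines plus the radical) are
  mapped to leaves. By the extension near the singular set, the Schwarz lemma and the Liouville
  theorem, the map is affine on each leaf. The derivative \<open>A\<close> of a lift of the extension at one
  singular point then gives the image of \<open>x\<close> as \<open>A x + a x s\<close> with a fixed \<open>s\<close> in the radical, and
  the scalar function \<open>a\<close> is linear because it is additive on pairs \<open>u\<close>, \<open>v\<close> with \<open>Re (H u v) = 0\<close>.\<close>

text \<open>A \<open>C1\<close> map of a hypersurface has no holomorphic extension to start from.
  But a complex line inside the quadric has complex tangent directions, so along it the CR condition
  turns \<open>C1\<close> into holomorphic. Everything is therefore deduced from \<open>f\<close>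
  and its inverse on such lines, and how far this reaches depends on the form. If both signs occur,
  null lines leave every point in enough directions to connect the whole quadric. The obstacle is
  the radical: orthogonality determines images only modulo it, so the radical coordinates have to be
  controlled by growth estimates along the null lines and by additive identities for null vectors.
  If the form is semidefinite, an isotropic subspace has dimension at most one modulo the radical.
  The lines then stay inside single leaves, and orthogonality relates no two different leaves. What
  links them is the singular set, at every point of which all leaves accumulate. It is nonempty
  since \<open>k < n\<close>, and the assumed extension near it makes the images of the different
  leaves comparable.\<close>

declare split_paired_All [simp del] split_paired_Ex [simp del]

section \<open>Homogeneous coordinates\<close>

lemma fst_hscale [simp]: "fst (hscale c v) = c * fst v"
  and fst_snd_hscale [simp]: "fst (snd (hscale c v)) = c *s fst (snd v)"
  and snd_snd_hscale [simp]: "snd (snd (hscale c v)) = c * snd (snd v)"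
  by (simp_all add: hscale_def split: prod.splits)

lemma homog_eqI:
  assumes "fst u = fst v" "\<And>j. fst (snd u) $ j = fst (snd v) $ j" "snd (snd u) = snd (snd v)"
  shows "u = (v :: 'n::finite homog)"
  using assms by (auto simp: prod_eq_iff vec_eq_iff)

lemma hscale_add_right: "hscale c (u + v) = hscale c u + hscale c v"
  and hscale_add_left: "hscale (c + d) u = hscale c u + hscale d u"
  by (rule homog_eqI; simp add: algebra_simps)+

lemma hscale_of_real: "hscale (of_real r) v = r *\<^sub>R v"
  by (rule homog_eqI) (simp_all add: scaleR_conv_of_real[where 'a=complex])

lemma bounded_bilinear_hscale: "bounded_bilinear (hscale :: complex \<Rightarrow> 'n::finite homog \<Rightarrow> _)"
proof -
  have "hscale c (r *\<^sub>R v) = r *\<^sub>R hscale c v" "hscale (r *\<^sub>R c) v = r *\<^sub>R hscale c v"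
    for c r and v :: "'n homog"
    by (metis hscale_of_real hscale_hscale mult.commute, metis hscale_of_real hscale_hscale scaleR_conv_of_real)
  then have "bilinear (hscale :: complex \<Rightarrow> 'n homog \<Rightarrow> _)"
    unfolding bilinear_def by (intro conjI allI linearI) (simp_all add: hscale_add_left hscale_add_right)
  then show ?thesis by (simp add: bilinear_conv_bounded_bilinear)
qed

interpretation hscale: bounded_bilinear hscale
  by (rule bounded_bilinear_hscale)

declare hscale.zero_left [simp] hscale.zero_right [simp]

lemma norm_hscale: "norm (hscale c v) = cmod c * norm v"
proof -
  have "norm (c *s x) = cmod c * norm x" for x :: "complex ^ 'a"
    by (simp add: norm_vec_def L2_set_def norm_mult power_mult_distrib real_sqrt_mult flip: sum_distrib_left)
  then have "(norm (hscale c v))\<^sup>2 = (cmod c * norm v)\<^sup>2"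
    by (cases v) (simp add: hscale_def norm_Pair norm_mult power_mult_distrib algebra_simps)
  then show ?thesis by (metis norm_ge_zero power2_eq_iff_nonneg mult_nonneg_nonneg)
qed

lemma hcoord_simps:
  "hcoord IZeta v = fst v" "hcoord (IZ j) v = fst (snd v) $ j" "hcoord IW v = snd (snd v)"
  by (cases v; simp)+

lemma hcoord_add: "hcoord i (u + v) = hcoord i u + hcoord i v"
  by (cases i) (simp_all add: hcoord_simps)

lemma hcoord_eqI: "(\<And>i. hcoord i u = hcoord i v) \<Longrightarrow> u = v"
  by (rule homog_eqI) (metis hcoord_simps)+

lemma hcoord_0 [simp]: "hcoord i 0 = 0"
  by (cases i) (simp_all add: hcoord_simps)

lemma hcoord_nonzero: "v \<noteq> 0 \<Longrightarrow> \<exists>i. hcoord i v \<noteq> 0"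
  using hcoord_eqI[of v 0] by force

lemma bounded_linear_hcoord: "bounded_linear (hcoord i)"
proof -
  have "hcoord i (r *\<^sub>R v) = r *\<^sub>R hcoord i v" for r and v :: "'a homog"
    by (metis hcoord_hscale hscale_of_real scaleR_conv_of_real)
  then have "linear (hcoord i :: 'a homog \<Rightarrow> _)" by (intro linearI) (simp_all add: hcoord_add)
  then show ?thesis by (simp add: linear_conv_bounded_linear)
qed

lemmas hcoord_has_derivative = bounded_linear.has_derivative[OF bounded_linear_hcoord]
  and hcoord_diff = linear_simps(2)[OF bounded_linear_hcoord]
  and hcoord_tendsto = bounded_linear.tendsto[OF bounded_linear_hcoord]
  and hcoord_continuous_on = bounded_linear.continuous_on[OF bounded_linear_hcoord]

lemma hcoord_expand:
  fixes v :: "'n::finite homog"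
  shows "v = hscale (fst v) (1, 0, 0) + (0, fst (snd v), 0) + hscale (snd (snd v)) (0, 0, 1)"
  by (rule homog_eqI) simp_all

definition clin :: "('n::finite homog \<Rightarrow> 'n homog) \<Rightarrow> bool" where
  "clin T \<longleftrightarrow> (\<forall>u v. T (u + v) = T u + T v) \<and> (\<forall>c v. T (hscale c v) = hscale c (T v))"

lemma clin_add: "clin T \<Longrightarrow> T (u + v) = T u + T v"
  and clin_hscale: "clin T \<Longrightarrow> T (hscale c v) = hscale c (T v)"
  by (simp_all add: clin_def)

lemma clin_bounded_linear: "clin T \<Longrightarrow> bounded_linear T"
  by (auto simp: clin_def linear_conv_bounded_linear[symmetric] intro!: linearI
      simp flip: hscale_of_real)

lemma clin_0: "clin T \<Longrightarrow> T 0 = 0"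
  by (metis clin_bounded_linear linear_simps(3))

lemma clin_inv:
  assumes "clin T" "bij T"
  shows "clin (inv T)"
proof -
  have *: "T (inv T v) = v" for v using assms(2) by (simp add: bij_is_surj surj_f_inv_f)
  have **: "inv T (T v) = v" for v using assms(2) by (simp add: bij_is_inj)
  show ?thesis unfolding clin_def
  proof safe
    fix u v
    have "inv T (T (inv T u + inv T v)) = inv T u + inv T v" by (rule **)
    then show "inv T (u + v) = inv T u + inv T v" by (simp only: clin_add[OF assms(1)] *)
  next
    fix c v
    have "inv T (T (hscale c (inv T v))) = hscale c (inv T v)" by (rule **)
    then show "inv T (hscale c v) = hscale c (inv T v)" by (simp only: clin_hscale[OF assms(1)] *)
  qed
qed

lemma clin_surj_bij:
  assumes "clin T" "surj T" shows "bij T"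
  using assms clin_bounded_linear[OF assms(1)] linear_surjective_imp_injective
    bounded_linear.linear bij_betw_def by blast

lemma clin_comp: "clin S \<Longrightarrow> clin T \<Longrightarrow> clin (S \<circ> T)"
  by (simp add: clin_def)

lemma proj_hscale: "c \<noteq> 0 \<Longrightarrow> v \<noteq> 0 \<Longrightarrow> proj (hscale c v) = proj v"
  by (metis hscale_eq_0_iff proj_eq_iff)

lemma proj_eqD: "u \<noteq> 0 \<Longrightarrow> v \<noteq> 0 \<Longrightarrow> proj u = proj v \<Longrightarrow> \<exists>c. c \<noteq> 0 \<and> v = hscale c u"
  using proj_eq_iff by blast

lemma proj_eqI_minors:
  assumes "u \<noteq> 0" "v \<noteq> 0" and minors: "\<And>i j. hcoord i u * hcoord j v = hcoord j u * hcoord i v"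
  shows "proj u = proj v"
proof -
  obtain i where i: "hcoord i u \<noteq> 0" using hcoord_nonzero assms(1) by blast
  have eq: "hscale (hcoord i u) v = hscale (hcoord i v) u"
  proof (rule hcoord_eqI)
    fix l
    show "hcoord l (hscale (hcoord i u) v) = hcoord l (hscale (hcoord i v) u)"
      unfolding hcoord_hscale using minors[of i l] by (simp only: mult.commute)
  qed
  have "hcoord i v \<noteq> 0"
  proof
    assume "hcoord i v = 0"
    then have "hscale (hcoord i u) v = 0" using eq by simp
    then show False using i assms(2) hscale_eq_0_iff by blast
  qed
  then show ?thesis using eq i by (metis assms(1,2) proj_hscale)
qed

lemma chart_dom_proj: "v \<noteq> 0 \<Longrightarrow> proj v \<in> chart_dom i \<longleftrightarrow> hcoord i v \<noteq> 0"
proof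
  assume v: "v \<noteq> 0" and "proj v \<in> chart_dom i"
  then obtain u where u: "proj v = proj u" "hcoord i u \<noteq> 0" by (auto simp: chart_dom_def)
  moreover have "u \<noteq> 0" using u by auto
  ultimately obtain c where "c \<noteq> 0" "u = hscale c v" using v proj_eqD by blast
  then show "hcoord i v \<noteq> 0" using u by (simp add: hcoord_hscale)
next
  assume "hcoord i v \<noteq> 0"
  then show "proj v \<in> chart_dom i" unfolding chart_dom_def by blast
qed

lemma chart_dom_cover: obtains i where "p \<in> chart_dom i"
proof -
  obtain v where "v \<noteq> 0" "p = proj v" by (rule cproj_cases)
  then show thesis using that hcoord_nonzero chart_dom_proj by metis
qed

text \<open>Total for every \<open>T\<close>; it is the induced projective map once \<open>T\<close>
  is linear and injective, for then the choice of representative does not matter.\<close>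

definition pmap :: "('n::finite homog \<Rightarrow> 'n homog) \<Rightarrow> 'n cproj \<Rightarrow> 'n cproj" where
  "pmap T p = proj (T (rep_cproj p))"

lemma rep_cproj_nonzero: "rep_cproj p \<noteq> 0" and proj_rep_cproj: "proj (rep_cproj p) = p"
proof -
  have "proj_rel (rep_cproj p) (rep_cproj p)"
    by (rule Quotient_rep_reflp[OF Quotient_cproj])
  then show "rep_cproj p \<noteq> 0" by (simp add: proj_rel_def)
  show "proj (rep_cproj p) = p"
    by (rule Quotient_abs_rep[OF Quotient_cproj])
qed

lemma clin_nonzero: "clin T \<Longrightarrow> inj T \<Longrightarrow> v \<noteq> 0 \<Longrightarrow> T v \<noteq> 0"
  by (metis clin_0 injD)

lemma pmap_proj:
  assumes "clin T" "inj T" "v \<noteq> 0"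
  shows "pmap T (proj v) = proj (T v)"
proof -
  obtain c where "c \<noteq> 0" "rep_cproj (proj v) = hscale c v"
    using proj_eqD[OF assms(3) rep_cproj_nonzero] proj_rep_cproj by metis
  then show ?thesis
    unfolding pmap_def by (simp add: clin_hscale[OF assms(1)] proj_hscale clin_nonzero assms)
qed

lemma bij_pmap_aux:
  assumes "clin T" "bij T"
  shows "pmap (inv T) (pmap T p) = p"
proof (cases p rule: cproj_cases)
  case (1 v)
  note T = assms(1) bij_is_inj[OF assms(2)] clin_inv[OF assms] bij_is_inj[OF bij_imp_bij_inv[OF assms(2)]]
  have "T v \<noteq> 0" by (rule clin_nonzero[OF T(1,2) 1(1)])
  then show ?thesis using 1 T by (simp add: pmap_proj)
qed

lemma bij_pmap:
  assumes "clin T" "bij T"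
  shows "bij (pmap T)" and "inv (pmap T) = pmap (inv T)"
proof -
  have 1: "pmap (inv T) (pmap T p) = p" for p using assms by (rule bij_pmap_aux)
  have "pmap (inv (inv T)) (pmap (inv T) p) = p" for p
    using assms by (intro bij_pmap_aux) (auto simp: clin_inv bij_imp_bij_inv)
  then have 2: "pmap T (pmap (inv T) p) = p" for p using assms by (simp add: inv_inv_eq)
  show "bij (pmap T)" by (rule o_bij[of "pmap (inv T)"]) (simp_all add: fun_eq_iff 1 2)
  show "inv (pmap T) = pmap (inv T)" by (rule inv_unique_comp) (simp_all add: fun_eq_iff 1 2)
qed

section \<open>Charts and complex derivatives\<close>

text \<open>\<open>drop_coord i\<close> arranges the coordinates other than \<open>i\<close> as \<open>affine_coords i\<close> does, and
  \<open>lift_coord i c\<close> puts \<open>c\<close> back as coordinate \<open>i\<close>.\<close>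

fun drop_coord :: "'n::finite hindex \<Rightarrow> 'n homog \<Rightarrow> 'n affine" where
  "drop_coord IZeta (\<zeta>, z, w) = (z, w)"
| "drop_coord (IZ j) (\<zeta>, z, w) = ((\<chi> l. if l = j then \<zeta> else z $ l), w)"
| "drop_coord IW (\<zeta>, z, w) = (z, \<zeta>)"

fun lift_coord :: "'n::finite hindex \<Rightarrow> complex \<Rightarrow> 'n affine \<Rightarrow> 'n homog" where
  "lift_coord IZeta c (z, w) = (c, z, w)"
| "lift_coord (IZ j) c (z, w) = (z $ j, (\<chi> l. if l = j then c else z $ l), w)"
| "lift_coord IW c (z, w) = (w, z, c)"

lemma hcoord_lift_coord [simp]: "hcoord i (lift_coord i c x) = c"
  by (cases x; cases i) auto

lemma lift_drop_coord: "lift_coord i (hcoord i v) (drop_coord i v) = v"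
  by (cases v; cases i) (auto simp: vec_eq_iff)

lemma affine_coords_drop: "affine_coords i v = drop_coord i (hscale (inverse (hcoord i v)) v)"
  by (cases v; cases i) (auto simp: hscale_def vec_eq_iff field_simps)

lemma drop_coord_hscale: "drop_coord i (hscale c v) = cscale c (drop_coord i v)"
  by (cases v; cases i) (auto simp: hscale_def cscale_def vec_eq_iff)

lemma lift_coord_cscale: "lift_coord i (c * d) (cscale c x) = hscale c (lift_coord i d x)"
  by (cases x; cases i) (auto simp: hscale_def cscale_def vec_eq_iff)

lemma lift_coord_add: "lift_coord i (c + d) (x + y) = lift_coord i c x + lift_coord i d y"
  by (cases x; cases y; cases i) (auto simp: vec_eq_iff)

lemma drop_coord_add: "drop_coord i (u + v) = drop_coord i u + drop_coord i v"
  by (cases u; cases v; cases i) (auto simp: vec_eq_iff)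

lemma cscale_of_real: "cscale (of_real r) x = r *\<^sub>R x"
  by (simp add: cscale_def prod_eq_iff vec_eq_iff scaleR_conv_of_real[where 'a=complex])

lemma cscale_add_left: "cscale (a + b) x = cscale a x + cscale b x"
  and cscale_cscale: "cscale a (cscale b x) = cscale (a * b) x"
  and cscale_1 [simp]: "cscale 1 x = x"
  by (simp_all add: cscale_def prod_eq_iff vec_eq_iff algebra_simps)

lemma bounded_linear_drop_coord: "bounded_linear (drop_coord i)"
  unfolding linear_conv_bounded_linear[symmetric]
  by (rule linearI) (simp_all add: drop_coord_add drop_coord_hscale flip: hscale_of_real cscale_of_real)

lemma bounded_linear_lift_coord0: "bounded_linear (lift_coord i 0)"
  unfolding linear_conv_bounded_linear[symmetric]
proof (rule linearI)
  fix x y :: "'a affine" and r :: real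
  show "lift_coord i 0 (x + y) = lift_coord i 0 x + lift_coord i 0 y"
    using lift_coord_add[of i 0 0 x y] by simp
  show "lift_coord i 0 (r *\<^sub>R x) = r *\<^sub>R lift_coord i 0 x"
    using lift_coord_cscale[of i "of_real r" 0 x] by (simp add: cscale_of_real hscale_of_real)
qed

lemma lift_coord_split: "lift_coord i c x = lift_coord i c 0 + lift_coord i 0 x"
  using lift_coord_add[of i c 0 0 x] by simp

lemma has_derivative_lift_coord: "(lift_coord i c has_derivative lift_coord i 0) (at x)"
proof -
  have "((\<lambda>x. lift_coord i c 0 + lift_coord i 0 x) has_derivative (\<lambda>h. 0 + lift_coord i 0 h)) (at x)"
    by (intro derivative_intros bounded_linear_imp_has_derivative bounded_linear_lift_coord0)
  then show ?thesis by (simp add: lift_coord_split[of i c, symmetric])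
qed

lemma lift_coord0_cscale: "lift_coord i 0 (cscale c x) = hscale c (lift_coord i 0 x)"
  using lift_coord_cscale[of i c 0 x] by simp

lemma lift_coord_nonzero: "lift_coord i 1 x \<noteq> 0"
  by (metis hcoord_0 hcoord_lift_coord zero_neq_one)

lemma proj_lift_chart: "q \<in> chart_dom i \<Longrightarrow> proj (lift_coord i 1 (chart i q)) = q"
proof (cases q rule: cproj_cases)
  case (1 v)
  assume "q \<in> chart_dom i"
  then have i: "hcoord i v \<noteq> 0" using 1 chart_dom_proj by blast
  have "lift_coord i 1 (chart i q) = hscale (inverse (hcoord i v)) v"
    using lift_drop_coord[of i "hscale (inverse (hcoord i v)) v"] i 1
    by (simp add: chart_proj affine_coords_drop hcoord_hscale)
  then show ?thesis using i 1 by (simp add: proj_hscale)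
qed

lemma has_derivative_affine_coords:
  fixes v :: "'n::finite homog"
  assumes "hcoord i v \<noteq> 0"
  shows "(affine_coords i has_derivative
    (\<lambda>h. drop_coord i (hscale (inverse (hcoord i v)) h
           + hscale (- (inverse (hcoord i v) * hcoord i h * inverse (hcoord i v))) v))) (at v)"
proof -
  have "((\<lambda>v. drop_coord i (hscale (inverse (hcoord i v)) v)) has_derivative
    (\<lambda>h. drop_coord i (hscale (inverse (hcoord i v)) h
           + hscale (- (inverse (hcoord i v) * hcoord i h * inverse (hcoord i v))) v))) (at v)"
    by (rule bounded_linear.has_derivative[OF bounded_linear_drop_coord hscale.FDERIV,
          OF Deriv.has_derivative_inverse[OF assms bounded_linear_imp_has_derivative[OF bounded_linear_hcoord]]
          has_derivative_ident])
  moreover have "affine_coords i = (\<lambda>v. drop_coord i (hscale (inverse (hcoord i v)) v))"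
    by (rule ext) (rule affine_coords_drop)
  ultimately show ?thesis by simp
qed

section \<open>Holomorphic curves in homogeneous coordinates\<close>

definition cderiv_on :: "complex set \<Rightarrow> (complex \<Rightarrow> 'n::finite homog) \<Rightarrow> bool" where
  "cderiv_on D y \<longleftrightarrow> (\<forall>t\<in>D. \<exists>y'. (y has_derivative (\<lambda>s. hscale s y')) (at t))"

lemma cderiv_on_continuous: "cderiv_on D y \<Longrightarrow> t \<in> D \<Longrightarrow> isCont y t"
  by (auto simp: cderiv_on_def dest!: bspec has_derivative_continuous)

lemma cderiv_on_hcoord:
  assumes "cderiv_on D y" "open D"
  shows "(\<lambda>t. hcoord i (y t)) holomorphic_on D"
  unfolding holomorphic_on_open[OF assms(2)]
proof
  fix t assume "t \<in> D"
  then obtain y' where "(y has_derivative (\<lambda>s. hscale s y')) (at t)"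
    using assms by (auto simp: cderiv_on_def)
  then have "((\<lambda>t. hcoord i (y t)) has_derivative (\<lambda>s. hcoord i (hscale s y'))) (at t)"
    by (rule hcoord_has_derivative)
  then show "\<exists>f'. ((\<lambda>t. hcoord i (y t)) has_field_derivative f') (at t)"
    unfolding has_field_derivative_def hcoord_hscale mult_commute_abs by blast
qed

lemma cderiv_on_clin:
  assumes "cderiv_on D y" "clin T"
  shows "cderiv_on D (\<lambda>t. T (y t))"
  unfolding cderiv_on_def
proof
  fix t assume "t \<in> D"
  then obtain y' where "(y has_derivative (\<lambda>s. hscale s y')) (at t)"
    using assms by (auto simp: cderiv_on_def)
  then have "((\<lambda>t. T (y t)) has_derivative (\<lambda>s. T (hscale s y'))) (at t)"
    by (rule bounded_linear.has_derivative[OF clin_bounded_linear[OF assms(2)]])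
  then show "\<exists>y'. ((\<lambda>t. T (y t)) has_derivative (\<lambda>s. hscale s y')) (at t)"
    unfolding clin_hscale[OF assms(2)] by blast
qed

lemma has_derivative_line: "((\<lambda>t. u + hscale t v) has_derivative (\<lambda>s. hscale s v)) (at t)"
proof -
  have "((\<lambda>t. u + hscale t v) has_derivative (\<lambda>s. 0 + (hscale t 0 + hscale s v))) (at t)"
    by (intro has_derivative_add has_derivative_const hscale.FDERIV has_derivative_ident)
  then show ?thesis by simp
qed

lemma continuous_on_line: "continuous_on S (\<lambda>t. u + hscale t v)"
  by (intro continuous_intros hscale.continuous_on)

section \<open>Holomorphic lifts\<close>

lemma holomorphic_affineD:
  assumes "holomorphic_affine g W" "x \<in> W"
  obtains A where "(g has_derivative A) (at x)" "\<And>c v. A (cscale c v) = cscale c (A v)"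
  using assms unfolding holomorphic_affine_def by blast

lemma isCont_affine_coords: "hcoord i v \<noteq> 0 \<Longrightarrow> isCont (affine_coords i) v"
  by (rule has_derivative_continuous[OF has_derivative_affine_coords])

lemma open_hcoord_nonzero: "open {v :: 'n::finite homog. hcoord i v \<noteq> 0}"
  by (intro open_Collect_neq hcoord_continuous_on continuous_on_id continuous_on_const)

lemma open_affine_coords_vimage:
  assumes "open W"
  shows "open {v. hcoord i v \<noteq> 0 \<and> affine_coords i v \<in> W}"
proof -
  have "continuous_on {v. hcoord i v \<noteq> 0} (affine_coords i)"
    by (intro continuous_at_imp_continuous_on ballI isCont_affine_coords) simp
  then have "open ({v. hcoord i v \<noteq> 0} \<inter> affine_coords i -` W)"
    using open_hcoord_nonzero assms by (rule continuous_open_preimage)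
  moreover have "{v. hcoord i v \<noteq> 0} \<inter> affine_coords i -` W = {v. hcoord i v \<noteq> 0 \<and> affine_coords i v \<in> W}"
    by blast
  ultimately show ?thesis by simp
qed

text \<open>A local representation of \<open>F\<close> is followed by the section of chart
  \<open>j\<close> that sets coordinate \<open>j\<close> to 1. The lift lives on an open set of
  homogeneous vectors, so it can be differentiated in every direction, also transversally to the
  quadric.\<close>

lemma holomorphic_proj_lift:
  fixes v\<^sub>0 :: "'n::finite homog"
  assumes F: "holomorphic_proj F U" and v\<^sub>0: "v\<^sub>0 \<noteq> 0" "proj v\<^sub>0 \<in> U" "F (proj v\<^sub>0) \<in> chart_dom j"
  obtains \<delta> Y where "\<delta> > 0"
    "\<And>v. v \<in> ball v\<^sub>0 \<delta> \<Longrightarrow> v \<noteq> 0 \<and> proj v \<in> U \<and> F (proj v) = proj (Y v) \<and> hcoord j (Y v) = 1"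
    "\<And>v. v \<in> ball v\<^sub>0 \<delta> \<Longrightarrow> \<exists>A. clin A \<and> (Y has_derivative A) (at v)"
proof -
  obtain i where i: "hcoord i v\<^sub>0 \<noteq> 0" using hcoord_nonzero v\<^sub>0(1) by blast
  have "proj v\<^sub>0 \<in> chart_dom i" using i v\<^sub>0(1) chart_dom_proj by blast
  then obtain W g where W: "open W" "chart i (proj v\<^sub>0) \<in> W" "holomorphic_affine g W"
    "\<And>q. q \<in> chart_dom i \<Longrightarrow> chart i q \<in> W \<Longrightarrow> q \<in> U \<and> F q \<in> chart_dom j \<and> chart j (F q) = g (chart i q)"
    using mp[OF spec[OF spec[OF bspec[OF F[unfolded holomorphic_proj_def] v\<^sub>0(2)]]], of i j] v\<^sub>0(3)
    by blast
  have "v\<^sub>0 \<in> {v. hcoord i v \<noteq> 0 \<and> affine_coords i v \<in> W}" using i W(2) v\<^sub>0(1) by (simp add: chart_proj)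
  then obtain \<delta> where \<delta>: "\<delta> > 0" "ball v\<^sub>0 \<delta> \<subseteq> {v. hcoord i v \<noteq> 0 \<and> affine_coords i v \<in> W}"
    using openE[OF open_affine_coords_vimage[OF W(1)]] by blast
  define Y where "Y v = lift_coord j 1 (g (affine_coords i v))" for v
  show thesis
  proof (rule that[of \<delta> Y])
    fix v assume "v \<in> ball v\<^sub>0 \<delta>"
    then have v: "hcoord i v \<noteq> 0" "affine_coords i v \<in> W" using \<delta>(2) by auto
    then have nz: "v \<noteq> 0" by auto
    then have "proj v \<in> chart_dom i" "chart i (proj v) \<in> W"
      using v by (simp_all add: chart_dom_proj chart_proj)
    with W(4) have "proj v \<in> U" "F (proj v) \<in> chart_dom j" "chart j (F (proj v)) = g (chart i (proj v))"
      by blast+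
    then show "v \<noteq> 0 \<and> proj v \<in> U \<and> F (proj v) = proj (Y v) \<and> hcoord j (Y v) = 1"
      using nz proj_lift_chart[of "F (proj v)" j] by (simp add: Y_def chart_proj)
    obtain A where A: "(g has_derivative A) (at (affine_coords i v))" "\<And>c v. A (cscale c v) = cscale c (A v)"
      using holomorphic_affineD[OF W(3) v(2)] by blast
    define D where "D h = drop_coord i (hscale (inverse (hcoord i v)) h
           + hscale (- (inverse (hcoord i v) * hcoord i h * inverse (hcoord i v))) v)" for h
    have "(affine_coords i has_derivative D) (at v)"
      using has_derivative_affine_coords[OF v(1)] unfolding D_def .
    then have "(Y has_derivative (\<lambda>h. lift_coord j 0 (A (D h)))) (at v)"
      unfolding Y_def
      by (rule has_derivative_compose[OF has_derivative_compose[of "affine_coords i", OF _ A(1)] has_derivative_lift_coord])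
    moreover have "D (hscale c h) = cscale c (D h)" for c h
      unfolding D_def drop_coord_hscale[symmetric] hscale.add_right hscale_hscale hcoord_hscale
      by (simp add: mult_ac)
    then have "lift_coord j 0 (A (D (hscale c h))) = hscale c (lift_coord j 0 (A (D h)))" for c h
      by (simp add: A(2) lift_coord0_cscale)
    then have "clin (\<lambda>h. lift_coord j 0 (A (D h)))"
      unfolding clin_def using linear_simps(1)[OF has_derivative_bounded_linear[OF calculation]] by blast
    ultimately show "\<exists>A. clin A \<and> (Y has_derivative A) (at v)" by blast
  qed (rule \<delta>(1))
qed

lemma holomorphic_proj_pmap:
  fixes T :: "'n::finite homog \<Rightarrow> 'n homog"
  assumes T: "clin T" "inj T"
  shows "holomorphic_proj (pmap T) UNIV"
  unfolding holomorphic_proj_def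
proof (intro ballI allI impI)
  fix p and i j :: "'n hindex" assume p: "p \<in> chart_dom i \<and> pmap T p \<in> chart_dom j"
  define s where "s x = T (lift_coord i 1 x)" for x
  define W where "W = {x. hcoord j (s x) \<noteq> 0}"
  have ds: "(s has_derivative (\<lambda>h. T (lift_coord i 0 h))) (at x)" for x
    unfolding s_def by (rule bounded_linear.has_derivative[OF clin_bounded_linear[OF T(1)] has_derivative_lift_coord])
  have val: "pmap T q = proj (s (chart i q)) \<and> s (chart i q) \<noteq> 0" if "q \<in> chart_dom i" for q
    using pmap_proj[OF T lift_coord_nonzero, of i "chart i q"] proj_lift_chart[OF that]
      clin_nonzero[OF T lift_coord_nonzero] by (simp add: s_def)
  have "open W" unfolding W_def
    by (intro open_Collect_neq hcoord_continuous_on continuous_on_const)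
      (meson ds continuous_at_imp_continuous_on has_derivative_continuous)
  moreover have "chart i p \<in> W"
    using p val[of p] chart_dom_proj[of "s (chart i p)" j] unfolding W_def by simp
  moreover have "holomorphic_affine (\<lambda>x. affine_coords j (s x)) W"
    unfolding holomorphic_affine_def
  proof
    fix x assume "x \<in> W"
    then have x: "hcoord j (s x) \<noteq> 0" by (simp add: W_def)
    note has_derivative_compose[OF ds has_derivative_affine_coords[OF x]]
    then show "\<exists>A. ((\<lambda>x. affine_coords j (s x)) has_derivative A) (at x) \<and> (\<forall>c v. A (cscale c v) = cscale c (A v))"
      by (intro exI conjI allI)
        (assumption, simp add: lift_coord0_cscale clin_hscale[OF T(1)] hcoord_hscale hscale_hscale
            hscale.add_right mult_ac flip: drop_coord_hscale)
  qed
  moreover have "pmap T q \<in> chart_dom j \<and> chart j (pmap T q) = affine_coords j (s (chart i q))"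
    if "q \<in> chart_dom i" "chart i q \<in> W" for q
    using that val[OF that(1)] chart_dom_proj[of "s (chart i q)" j] by (simp add: W_def chart_proj)
  ultimately show "\<exists>W g. open W \<and> chart i p \<in> W \<and> holomorphic_affine g W \<and>
           (\<forall>q\<in>chart_dom i. chart i q \<in> W \<longrightarrow>
              q \<in> UNIV \<and> pmap T q \<in> chart_dom j \<and> chart j (pmap T q) = g (chart i q))"
    by blast
qed

lemma holomorphic_automorphism_pmap:
  assumes "clin T" "bij T"
  shows "holomorphic_automorphism (pmap T)"
  unfolding holomorphic_automorphism_def
  using bij_pmap[OF assms] assms by (simp add: holomorphic_proj_pmap bij_is_inj clin_inv bij_imp_bij_inv)

subsection \<open>CR maps along complex lines\<close>

text \<open>The complex linearity in the CR condition, isolated so that it can be transferred to the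
  inverse map; there the equality of the complex tangent spaces supplies the vectors to test it
  on.\<close>

definition CR_commuting :: "'n::finite cproj set \<Rightarrow> ('n cproj \<Rightarrow> 'n cproj) \<Rightarrow> bool" where
  "CR_commuting M f \<longleftrightarrow>
     (\<forall>p\<in>M. \<forall>i j. p \<in> chart_dom i \<and> f p \<in> chart_dom j \<longrightarrow>
        (\<forall>W g g'. C1_local_ext M f i j p W g g' \<longrightarrow>
           (\<forall>v\<in>complex_tangent_space M i p.
              blinfun_apply (g' (chart i p)) (cscale \<i> v)
                = cscale \<i> (blinfun_apply (g' (chart i p)) v))))"

lemma C1_CR_automorphism_commuting: "C1_CR_automorphism M f \<Longrightarrow> CR_commuting M f"
  unfolding C1_CR_automorphism_def CR_commuting_def by blast

lemma C1_CR_automorphismD: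
  assumes "C1_CR_automorphism M f" "C1_local_ext M f i j p W g g'"
    "p \<in> M" "p \<in> chart_dom i" "f p \<in> chart_dom j"
  shows "g' (chart i p) ` complex_tangent_space M i p = complex_tangent_space M j (f p)"
    and "v \<in> complex_tangent_space M i p \<Longrightarrow> g' (chart i p) (cscale \<i> v) = cscale \<i> (g' (chart i p) v)"
  using assms unfolding C1_CR_automorphism_def by blast+

text \<open>The extensions \<open>g\<close> and \<open>k\<close> are inverse to each other only on
  \<open>M\<close>. Differentiating \<open>k (g (\<gamma> x)) = \<gamma> x\<close> along a curve in
  \<open>M\<close> with velocity \<open>v\<close> still inverts the differential on tangent
  vectors.\<close>

lemma C1_local_ext_left_inverse:
  assumes g: "C1_local_ext M f i j p W g g'" and k: "C1_local_ext M h j i (f p) W' k k'"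
    and h: "\<And>q. q \<in> M \<Longrightarrow> f q \<in> M \<and> h (f q) = q"
    and p: "p \<in> M" "p \<in> chart_dom i"
    and v: "v \<in> tangent_space M i p"
  shows "k' (chart j (f p)) (g' (chart i p) v) = v"
proof -
  obtain \<gamma> :: "real \<Rightarrow> 'a affine" and e where \<gamma>: "e > 0"
    "\<gamma> ` {-e<..<e} \<subseteq> chart i ` (M \<inter> chart_dom i)" "\<gamma> 0 = chart i p" "(\<gamma> has_vector_derivative v) (at 0)"
    using v unfolding tangent_space_def by blast
  note gD = g[unfolded C1_local_ext_def] and kD = k[unfolded C1_local_ext_def]
  have k4: "chart i (h q) = k (chart j q)" if "q \<in> M" "q \<in> chart_dom j" "chart j q \<in> W'" for q
    using kD that by blast
  have fp: "chart j (f p) = g (chart i p)" using gD p by blast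
  have d0: "(\<gamma> has_derivative (\<lambda>x. x *\<^sub>R v)) (at 0)" using \<gamma>(4) by (simp add: has_vector_derivative_def)
  have d1: "(g has_derivative g' (chart i p)) (at (\<gamma> 0))" using gD \<gamma>(3) by simp
  have d2: "(k has_derivative k' (chart j (f p))) (at (g (\<gamma> 0)))" using kD \<gamma>(3) fp by simp
  have d01: "((\<lambda>x. g (\<gamma> x)) has_derivative (\<lambda>x. g' (chart i p) (x *\<^sub>R v))) (at 0)"
    by (rule has_derivative_compose[OF d0 d1])
  then have comp: "((\<lambda>x. k (g (\<gamma> x))) has_derivative (\<lambda>x. k' (chart j (f p)) (g' (chart i p) (x *\<^sub>R v)))) (at 0)"
    by (rule has_derivative_compose) (rule d2)
  have "eventually (\<lambda>x. \<gamma> x \<in> W) (at 0)"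
    using gD \<gamma>(3) topological_tendstoD[OF has_derivative_continuous[OF d0, unfolded continuous_within], of W]
    by simp
  moreover have "eventually (\<lambda>x. g (\<gamma> x) \<in> W') (at 0)"
    using kD \<gamma>(3) fp topological_tendstoD[OF has_derivative_continuous[OF d01, unfolded continuous_within], of W']
    by simp
  moreover have "eventually (\<lambda>x. x \<in> {-e<..<e}) (at 0)"
    using \<gamma>(1) by (intro eventually_at_in_open') auto
  ultimately have "eventually (\<lambda>x. k (g (\<gamma> x)) = \<gamma> x) (at 0)"
  proof eventually_elim
    case (elim x)
    then obtain q where q: "q \<in> M" "q \<in> chart_dom i" "\<gamma> x = chart i q" using \<gamma>(2) by blast
    then have fq: "f q \<in> chart_dom j" "chart j (f q) = g (\<gamma> x)" using gD elim(1) by simp_all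
    then have "chart i (h (f q)) = k (chart j (f q))" using k4[of "f q"] elim(2) h[OF q(1)] by simp
    then show ?case using fq h[OF q(1)] q(3) by simp
  qed
  moreover have "k (g (\<gamma> 0)) = \<gamma> 0"
  proof -
    have "f p \<in> M \<inter> chart_dom j" using gD p h[OF p(1)] by simp
    then have "chart i (h (f p)) = k (chart j (f p))" using kD by simp
    then show ?thesis using fp h p \<gamma>(3) by simp
  qed
  ultimately have "(\<gamma> has_derivative (\<lambda>x. k' (chart j (f p)) (g' (chart i p) (x *\<^sub>R v)))) (at 0)"
    using has_derivative_transform_eventually[OF comp] by simp
  then have "(\<lambda>x. k' (chart j (f p)) (g' (chart i p) (x *\<^sub>R v))) = (\<lambda>x. x *\<^sub>R v)"
    using d0 by (rule has_derivative_unique)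
  from fun_cong[OF this, of 1] show ?thesis by simp
qed

lemma C1_smooth_onD:
  assumes "C1_smooth_on M f" "p \<in> M" "p \<in> chart_dom i" "f p \<in> chart_dom j"
  obtains W g g' where "C1_local_ext M f i j p W g g'"
  using assms unfolding C1_smooth_on_def by blast

text \<open>A complex tangent vector \<open>w\<close> at \<open>p\<close> is \<open>g'\<close> of a
  complex tangent vector \<open>v\<close> at the preimage. As \<open>k'\<close> undoes
  \<open>g'\<close> on both \<open>v\<close> and \<open>cscale \<i> v\<close>, the complex linearity
  of \<open>g'\<close> at \<open>v\<close> gives that of \<open>k'\<close> at
  \<open>w\<close>.\<close>

lemma CR_commuting_inv:
  assumes "C1_CR_automorphism M f"
  shows "CR_commuting M (inv_into M f)"
proof -
  let ?h = "inv_into M f"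
  have bij: "bij_betw f M M" and smooth: "C1_smooth_on M f"
    using assms unfolding C1_CR_automorphism_def C1_diffeomorphism_def by auto
  have h: "f q \<in> M \<and> ?h (f q) = q" "?h q \<in> M \<and> f (?h q) = q" if "q \<in> M" for q
    using bij that bij_betw_apply[OF bij that] bij_betw_apply[OF bij_betw_inv_into[OF bij] that]
    by (simp_all add: bij_betw_inv_into_left bij_betw_inv_into_right)
  show ?thesis unfolding CR_commuting_def
  proof (intro ballI allI impI)
    fix p i j W k k' w
    assume p: "p \<in> M" and dom: "p \<in> chart_dom i \<and> ?h p \<in> chart_dom j"
      and k: "C1_local_ext M ?h i j p W k k'" and w: "w \<in> complex_tangent_space M i p"
    define p\<^sub>0 where "p\<^sub>0 = ?h p"
    have p\<^sub>0: "p\<^sub>0 \<in> M" "f p\<^sub>0 = p" "p\<^sub>0 \<in> chart_dom j" using h(2) p dom by (auto simp: p\<^sub>0_def)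
    then have fp\<^sub>0: "f p\<^sub>0 \<in> chart_dom i" using dom by simp
    then obtain V g g' where g: "C1_local_ext M f j i p\<^sub>0 V g g'"
      by (rule C1_smooth_onD[OF smooth p\<^sub>0(1,3)])
    note CR = C1_CR_automorphismD[OF assms g p\<^sub>0(1,3) fp\<^sub>0, unfolded p\<^sub>0(2)]
    have k2: "C1_local_ext M ?h i j (f p\<^sub>0) W k k'" using k p\<^sub>0 by simp
    note inv = C1_local_ext_left_inverse[OF g k2 h(1) p\<^sub>0(1,3), unfolded p\<^sub>0(2)]
    obtain v where v: "v \<in> complex_tangent_space M j p\<^sub>0" "w = g' (chart j p\<^sub>0) v"
      using w CR(1) by blast
    then have "k' (chart i p) w = v" "k' (chart i p) (cscale \<i> w) = cscale \<i> v"
      using inv[of v] inv[of "cscale \<i> v"] CR(2)[OF v(1)] v unfolding complex_tangent_space_def by simp_all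
    then show "k' (chart i p) (cscale \<i> w) = cscale \<i> (k' (chart i p) w)" by simp
  qed
qed

text \<open>The derivative of \<open>affine_coords i\<close> at \<open>x\<close>, applied to
  \<open>v\<close>.\<close>

definition velocity :: "'n::finite hindex \<Rightarrow> 'n homog \<Rightarrow> 'n homog \<Rightarrow> 'n affine" where
  "velocity i x v = drop_coord i (hscale (inverse (hcoord i x)) v
    + hscale (- (inverse (hcoord i x) * hcoord i v * inverse (hcoord i x))) x)"

text \<open>A complex line in \<open>M\<close> contains the real lines in all directions
  \<open>\<sigma>\<close> of modulus 1, so \<open>cscale \<sigma> D\<close> is tangent; the choices
  1 and \<open>\<i>\<close> show that \<open>D\<close> is complex tangent.\<close>

lemma line_velocity:
  fixes u v :: "'n::finite homog" and t :: complex and i :: "'n hindex"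
  defines "D \<equiv> \<lambda>t. velocity i (u + hscale t v) v"
  assumes e: "e > 0" and M: "\<And>s. s \<in> ball t e \<Longrightarrow> hcoord i (u + hscale s v) \<noteq> 0 \<and> proj (u + hscale s v) \<in> M"
  shows "((\<lambda>s. affine_coords i (u + hscale s v)) has_derivative (\<lambda>s. cscale s (D t))) (at t)"
    and "D t \<in> complex_tangent_space M i (proj (u + hscale t v))"
proof -
  let ?l = "\<lambda>s. u + hscale s v"
  have deriv: "((\<lambda>s. affine_coords i (?l s)) has_derivative (\<lambda>s. cscale s (D r))) (at r)"
    if "r \<in> ball t e" for r
  proof -
    have "((\<lambda>s. affine_coords i (?l s)) has_derivative (\<lambda>s. drop_coord i (hscale (inverse (hcoord i (?l r))) (hscale s v)
           + hscale (- (inverse (hcoord i (?l r)) * hcoord i (hscale s v) * inverse (hcoord i (?l r)))) (?l r)))) (at r)"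
      using M[OF that] by (intro has_derivative_compose[OF has_derivative_line has_derivative_affine_coords]) auto
    then show ?thesis
      unfolding D_def velocity_def by (simp add: hscale.add_right hscale_hscale hcoord_hscale mult_ac flip: drop_coord_hscale)
  qed
  then show "((\<lambda>s. affine_coords i (?l s)) has_derivative (\<lambda>s. cscale s (D t))) (at t)"
    using e by simp
  have tangent: "cscale \<sigma> (D t) \<in> tangent_space M i (proj (?l t))" if \<sigma>: "cmod \<sigma> = 1" for \<sigma>
  proof -
    define \<gamma> where "\<gamma> \<tau> = affine_coords i (?l (t + of_real \<tau> * \<sigma>))" for \<tau>
    have mem: "t + of_real \<tau> * \<sigma> \<in> ball t e" if "\<tau> \<in> {-e<..<e}" for \<tau>
      using that \<sigma> by (auto simp: dist_norm norm_mult)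
    have d\<gamma>: "(\<gamma> has_vector_derivative cscale \<sigma> (D (t + of_real \<tau> * \<sigma>))) (at \<tau>)" if "\<tau> \<in> {-e<..<e}" for \<tau>
    proof -
      have "((\<lambda>\<tau>. t + of_real \<tau> * \<sigma>) has_derivative (\<lambda>x. of_real x * \<sigma>)) (at \<tau>)"
        by (auto intro!: derivative_eq_intros)
      from has_derivative_compose[OF this deriv[OF mem[OF that]]]
      show ?thesis
        unfolding has_vector_derivative_def \<gamma>_def by (simp add: cscale_cscale[symmetric] cscale_of_real)
    qed
    have nz: "hcoord i (?l (t + of_real \<tau> * \<sigma>)) \<noteq> 0" if "\<tau> \<in> {-e<..<e}" for \<tau>
      using M mem that by blast
    have cl: "continuous_on {-e<..<e} (\<lambda>\<tau>. ?l (t + of_real \<tau> * \<sigma>))"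
      by (intro continuous_intros hscale.continuous_on)
    have ci: "continuous_on {-e<..<e} (\<lambda>\<tau>. inverse (hcoord i (?l (t + of_real \<tau> * \<sigma>))))"
      using nz by (intro continuous_on_inverse hcoord_continuous_on[OF cl]) blast
    have "continuous_on {-e<..<e} (\<lambda>\<tau>. cscale \<sigma> (D (t + of_real \<tau> * \<sigma>)))"
      unfolding D_def velocity_def drop_coord_hscale[symmetric]
      by (intro bounded_linear.continuous_on[OF bounded_linear_drop_coord] hscale.continuous_on
          continuous_on_add continuous_on_mult continuous_on_minus continuous_on_const ci cl)
    then have "\<gamma> C1_differentiable_on {-e<..<e}"
      unfolding C1_differentiable_on_def
      by (intro exI[of _ "\<lambda>\<tau>. cscale \<sigma> (D (t + of_real \<tau> * \<sigma>))"] conjI ballI d\<gamma>)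
    moreover have "\<gamma> ` {-e<..<e} \<subseteq> chart i ` (M \<inter> chart_dom i)"
    proof
      fix x assume "x \<in> \<gamma> ` {-e<..<e}"
      then obtain \<tau> where \<tau>: "\<tau> \<in> {-e<..<e}" "x = \<gamma> \<tau>" by blast
      have nz0: "?l (t + of_real \<tau> * \<sigma>) \<noteq> 0" using nz[OF \<tau>(1)] by auto
      then have "x = chart i (proj (?l (t + of_real \<tau> * \<sigma>)))" by (simp add: \<tau>(2) \<gamma>_def chart_proj)
      moreover have "proj (?l (t + of_real \<tau> * \<sigma>)) \<in> M \<inter> chart_dom i"
        using M[OF mem[OF \<tau>(1)]] nz[OF \<tau>(1)] nz0 by (simp add: chart_dom_proj)
      ultimately show "x \<in> chart i ` (M \<inter> chart_dom i)" by blast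
    qed
    moreover have "\<gamma> 0 = chart i (proj (?l t))"
    proof -
      have "?l t \<noteq> 0" using M[of t] e by auto
      then show ?thesis by (simp add: \<gamma>_def chart_proj)
    qed
    moreover have "(\<gamma> has_vector_derivative cscale \<sigma> (D t)) (at 0)" using d\<gamma>[of 0] e by simp
    ultimately show ?thesis unfolding tangent_space_def using e by blast
  qed
  show "D t \<in> complex_tangent_space M i (proj (?l t))"
    using tangent[of 1] tangent[of \<i>] by (simp add: complex_tangent_space_def)
qed

lemma CR_lift_line:
  fixes u v :: "'n::finite homog"
  assumes smooth: "C1_smooth_on M f" and CR: "CR_commuting M f" and e: "e > 0"
    and M: "\<And>t. t \<in> ball t\<^sub>0 e \<Longrightarrow> u + hscale t v \<noteq> 0 \<and> proj (u + hscale t v) \<in> M"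
  obtains \<delta> y where "\<delta> > 0" "\<delta> \<le> e" "cderiv_on (ball t\<^sub>0 \<delta>) y"
    "\<And>t. t \<in> ball t\<^sub>0 \<delta> \<Longrightarrow> y t \<noteq> 0 \<and> f (proj (u + hscale t v)) = proj (y t)"
proof -
  let ?l = "\<lambda>t. u + hscale t v"
  have t\<^sub>0: "?l t\<^sub>0 \<noteq> 0" "proj (?l t\<^sub>0) \<in> M" using M[of t\<^sub>0] e by auto
  obtain i where i: "hcoord i (?l t\<^sub>0) \<noteq> 0" using hcoord_nonzero t\<^sub>0(1) by blast
  obtain j where j: "f (proj (?l t\<^sub>0)) \<in> chart_dom j" by (rule chart_dom_cover)
  have "proj (?l t\<^sub>0) \<in> chart_dom i" using i t\<^sub>0(1) chart_dom_proj by blast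
  then obtain W g g' where g: "C1_local_ext M f i j (proj (?l t\<^sub>0)) W g g'"
    using C1_smooth_onD[OF smooth t\<^sub>0(2) _ j] by blast
  note gD = g[unfolded C1_local_ext_def]
  have "open {v. hcoord i v \<noteq> 0 \<and> affine_coords i v \<in> W}"
    using gD by (intro open_affine_coords_vimage) blast
  then have "open (?l -` {v. hcoord i v \<noteq> 0 \<and> affine_coords i v \<in> W})"
    by (rule open_vimage) (rule continuous_on_line)
  moreover have "t\<^sub>0 \<in> ?l -` {v. hcoord i v \<noteq> 0 \<and> affine_coords i v \<in> W}"
    using gD i t\<^sub>0(1) by (simp add: chart_proj)
  ultimately obtain \<delta>\<^sub>0 where \<delta>\<^sub>0: "\<delta>\<^sub>0 > 0" "ball t\<^sub>0 \<delta>\<^sub>0 \<subseteq> ?l -` {v. hcoord i v \<noteq> 0 \<and> affine_coords i v \<in> W}"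
    by (rule openE) blast
  define \<delta> where "\<delta> = min \<delta>\<^sub>0 e"
  have \<delta>: "\<delta> > 0" "\<delta> \<le> e" "\<delta> \<le> \<delta>\<^sub>0" using \<delta>\<^sub>0 e by (auto simp: \<delta>_def)
  have in_W: "hcoord i (?l t) \<noteq> 0" "affine_coords i (?l t) \<in> W" "?l t \<noteq> 0" "proj (?l t) \<in> M \<inter> chart_dom i"
    if "t \<in> ball t\<^sub>0 \<delta>" for t
  proof -
    have "t \<in> ball t\<^sub>0 \<delta>\<^sub>0" "t \<in> ball t\<^sub>0 e" using that \<delta> by auto
    then show "hcoord i (?l t) \<noteq> 0" "affine_coords i (?l t) \<in> W" "?l t \<noteq> 0" using \<delta>\<^sub>0(2) M by auto
    then show "proj (?l t) \<in> M \<inter> chart_dom i" using M \<open>t \<in> ball t\<^sub>0 e\<close> chart_dom_proj by blast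
  qed
  define y where "y t = lift_coord j 1 (g (affine_coords i (?l t)))" for t
  have fy: "f (proj (?l t)) \<in> chart_dom j" "f (proj (?l t)) = proj (y t)" if "t \<in> ball t\<^sub>0 \<delta>" for t
  proof -
    have "f (proj (?l t)) \<in> chart_dom j \<and> chart j (f (proj (?l t))) = g (affine_coords i (?l t))"
      using gD in_W[OF that] by (simp add: chart_proj)
    then show "f (proj (?l t)) \<in> chart_dom j" "f (proj (?l t)) = proj (y t)"
      using proj_lift_chart[of "f (proj (?l t))" j] by (auto simp: y_def)
  qed
  show thesis
  proof (rule that[of \<delta> y])
    show "cderiv_on (ball t\<^sub>0 \<delta>) y" unfolding cderiv_on_def
    proof
      fix t assume t: "t \<in> ball t\<^sub>0 \<delta>"
      define p where "p = proj (?l t)"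
      define x where "x = affine_coords i (?l t)"
      have x: "chart i p = x" using in_W[OF t] by (simp add: p_def x_def chart_proj)
      have pM: "p \<in> M" "p \<in> chart_dom i" using in_W[OF t] by (auto simp: p_def)
      obtain e' where e': "e' > 0" "ball t e' \<subseteq> ball t\<^sub>0 \<delta>"
        using openE[OF open_ball t] by blast
      define D where "D = velocity i (?l t) v"
      have D: "((\<lambda>s. affine_coords i (?l s)) has_derivative (\<lambda>s. cscale s D)) (at t)"
        "D \<in> complex_tangent_space M i p"
        unfolding D_def p_def using line_velocity[OF e'(1), of t i u v M] e'(2) in_W by blast+
      have "C1_local_ext M f i j p W g g'"
        using gD in_W[OF t] x unfolding C1_local_ext_def x_def by simp
      then have comm: "g' x (cscale \<i> D) = cscale \<i> (g' x D)"
        using CR pM fy(1)[OF t] D(2) unfolding CR_commuting_def p_def[symmetric] x[symmetric] by blast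
      have dg: "(g has_derivative g' x) (at x)" using gD in_W[OF t] by (simp add: x_def)
      \<comment> \<open>The real linear \<open>g' x\<close> commutes with \<open>cscale \<i>\<close>
        at \<open>D\<close>, hence is complex linear on the complex line spanned by
        \<open>D\<close>.\<close>
      have "g' x (cscale s D) = cscale s (g' x D)" for s
      proof -
        have s: "s = of_real (Re s) + of_real (Im s) * \<i>" by (simp add: complex_eq mult.commute)
        have "cscale s D = Re s *\<^sub>R D + Im s *\<^sub>R cscale \<i> D"
          by (subst s) (simp only: cscale_add_left cscale_cscale[symmetric] cscale_of_real)
        then have "g' x (cscale s D) = Re s *\<^sub>R g' x D + Im s *\<^sub>R cscale \<i> (g' x D)"
          by (simp add: blinfun.add_right blinfun.scaleR_right comm)
        also have "\<dots> = cscale s (g' x D)"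
          by (subst (3) s) (simp only: cscale_add_left cscale_cscale[symmetric] cscale_of_real)
        finally show ?thesis .
      qed
      moreover have "(y has_derivative (\<lambda>s. lift_coord j 0 (g' x (cscale s D)))) (at t)"
        unfolding y_def using has_derivative_compose[OF has_derivative_compose[OF D(1) dg[unfolded x_def]] has_derivative_lift_coord]
        by (simp add: x_def)
      ultimately have "(y has_derivative (\<lambda>s. hscale s (lift_coord j 0 (g' x D)))) (at t)"
        by (simp add: lift_coord0_cscale)
      then show "\<exists>y'. (y has_derivative (\<lambda>s. hscale s y')) (at t)" by blast
    qed
    show "y t \<noteq> 0 \<and> f (proj (?l t)) = proj (y t)" if "t \<in> ball t\<^sub>0 \<delta>" for t
      using fy[OF that] lift_coord_nonzero by (simp add: y_def)
  qed (use \<delta> in auto)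
qed

section \<open>Polarisation\<close>

text \<open>The derivative of the vanishing sum in direction \<open>s\<close> is
  \<open>cnj s * B + s * A\<close>; the directions 1 and \<open>\<i>\<close> separate its
  antiholomorphic part \<open>B\<close> from its holomorphic part \<open>A\<close>.\<close>

lemma sesquilinear_deriv_eq_0:
  fixes a b :: "'k \<Rightarrow> complex \<Rightarrow> complex"
  assumes "finite K" "open D"
    and hol: "\<And>k. k \<in> K \<Longrightarrow> a k holomorphic_on D" "\<And>k. k \<in> K \<Longrightarrow> b k holomorphic_on D"
    and zero: "\<And>t. t \<in> D \<Longrightarrow> (\<Sum>k\<in>K. a k t * cnj (b k t)) = 0"
    and t: "t \<in> D"
  shows "(\<Sum>k\<in>K. a k t * cnj (deriv (b k) t)) = 0"
proof -
  let ?A = "\<Sum>k\<in>K. deriv (a k) t * cnj (b k t)" and ?B = "\<Sum>k\<in>K. a k t * cnj (deriv (b k) t)"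
  have da: "(a k has_derivative (\<lambda>s. deriv (a k) t * s)) (at t)"
    and db: "(b k has_derivative (\<lambda>s. deriv (b k) t * s)) (at t)" if "k \<in> K" for k
    using holomorphic_derivI[OF hol(1)[OF that] assms(2) t]
      holomorphic_derivI[OF hol(2)[OF that] assms(2) t] by (simp_all add: has_field_derivative_def)
  have "((\<lambda>t. \<Sum>k\<in>K. a k t * cnj (b k t)) has_derivative
      (\<lambda>s. \<Sum>k\<in>K. a k t * cnj (deriv (b k) t * s) + deriv (a k) t * s * cnj (b k t))) (at t)"
    by (intro has_derivative_sum has_derivative_mult da bounded_linear.has_derivative[OF bounded_linear_cnj] db)
  moreover have "((\<lambda>t. \<Sum>k\<in>K. a k t * cnj (b k t)) has_derivative (\<lambda>s. 0)) (at t)"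
    by (rule has_derivative_transform_within_open[OF has_derivative_const assms(2) t]) (simp add: zero)
  ultimately have "(\<lambda>s. \<Sum>k\<in>K. a k t * cnj (deriv (b k) t * s) + deriv (a k) t * s * cnj (b k t)) = (\<lambda>s. 0)"
    by (rule has_derivative_unique)
  then have *: "cnj s * ?B + s * ?A = 0" for s
    by (simp add: fun_eq_iff sum.distrib sum_distrib_left mult_ac)
  from *[of 1] *[of \<i>] have "?B + ?A = 0" "\<i> * (?A - ?B) = 0" by (simp_all add: algebra_simps)
  then show ?thesis by simp
qed

lemma higher_deriv_lincomb:
  assumes "finite K" "open D" "\<And>k. k \<in> K \<Longrightarrow> b k holomorphic_on D" "t \<in> D"
  shows "(deriv ^^ n) (\<lambda>s. \<Sum>k\<in>K. c k * b k s) t = (\<Sum>k\<in>K. c k * (deriv ^^ n) (b k) t)"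
  using assms(1,3)
proof (induction K)
  case empty
  have "(deriv ^^ n) (\<lambda>s. 0) = (\<lambda>s. 0 :: complex)" by (induction n) (auto simp: fun_eq_iff)
  then show ?case by simp
next
  case (insert k K)
  have "(deriv ^^ n) (\<lambda>s. c k * b k s + (\<Sum>k\<in>K. c k * b k s)) t
      = (deriv ^^ n) (\<lambda>s. c k * b k s) t + (deriv ^^ n) (\<lambda>s. \<Sum>k\<in>K. c k * b k s) t"
    using insert.prems assms(2,4) by (intro higher_deriv_add[of _ D] holomorphic_intros) auto
  then show ?case
    using insert.hyps insert.IH insert.prems higher_deriv_cmult[OF _ assms(4,2)] by simp
qed

text \<open>Applying the previous fact again and again differentiates only the conjugated factor, so
  all derivatives in \<open>s\<close> vanish at \<open>s = t\<close>. For fixed \<open>t\<close> the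
  conjugate of the sum is holomorphic in \<open>s\<close>, hence identically zero on the connected
  \<open>D\<close>.\<close>

lemma polarisation:
  fixes a b :: "'k \<Rightarrow> complex \<Rightarrow> complex"
  assumes "finite K" "open D" "connected D"
    and hol: "\<And>k. k \<in> K \<Longrightarrow> a k holomorphic_on D" "\<And>k. k \<in> K \<Longrightarrow> b k holomorphic_on D"
    and zero: "\<And>t. t \<in> D \<Longrightarrow> (\<Sum>k\<in>K. a k t * cnj (b k t)) = 0"
    and t: "t \<in> D" "s \<in> D"
  shows "(\<Sum>k\<in>K. a k t * cnj (b k s)) = 0"
proof -
  have derivs: "(\<Sum>k\<in>K. a k t * cnj ((deriv ^^ n) (b k) t)) = 0" if "t \<in> D" for n t
    using hol zero that
  proof (induction n arbitrary: b t)
    case (Suc n b t)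
    have "(\<Sum>k\<in>K. a k t * cnj ((deriv ^^ n) (deriv (b k)) t)) = 0"
    proof (rule Suc.IH)
      show "(\<Sum>k\<in>K. a k t * cnj (deriv (b k) t)) = 0" if "t \<in> D" for t
        using assms(1,2) Suc.prems(1,2,3) that by (rule sesquilinear_deriv_eq_0)
    qed (use Suc.prems assms(2) in \<open>auto intro: holomorphic_deriv\<close>)
    then show ?case by (simp add: funpow_Suc_right del: funpow.simps)
  qed simp
  have "(\<Sum>k\<in>K. cnj (a k t) * b k s) = 0"
  proof (rule holomorphic_fun_eq_0_on_connected[of "\<lambda>s. \<Sum>k\<in>K. cnj (a k t) * b k s" D t])
    show "(\<lambda>s. \<Sum>k\<in>K. cnj (a k t) * b k s) holomorphic_on D"
      using hol(2) by (intro holomorphic_intros) auto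
    fix n
    have "cnj (\<Sum>k\<in>K. cnj (a k t) * (deriv ^^ n) (b k) t) = 0" using derivs[OF t(1)] by simp
    then have "(\<Sum>k\<in>K. cnj (a k t) * (deriv ^^ n) (b k) t) = 0" by (simp only: complex_cnj_zero_iff)
    then show "(deriv ^^ n) (\<lambda>s. \<Sum>k\<in>K. cnj (a k t) * b k s) t = 0"
      using higher_deriv_lincomb[OF assms(1,2) hol(2) t(1), where n = n] by simp
  qed (use assms t in auto)
  then have "cnj (\<Sum>k\<in>K. cnj (a k t) * b k s) = 0" by simp
  then show ?thesis by simp
qed

section \<open>The Hermitian form of the quadric\<close>

locale hermitian_quadric =
  fixes eps :: "'n::finite \<Rightarrow> real"
  assumes eps_values: "eps j = -1 \<or> eps j = 0 \<or> eps j = 1"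
begin

definition herm :: "complex ^ 'n \<Rightarrow> complex ^ 'n \<Rightarrow> complex" where
  "herm z z' = (\<Sum>j\<in>UNIV. of_real (eps j) * z $ j * cnj (z' $ j))"

text \<open>The polarised homogeneous equation of the quadric: \<open>H x x = 0\<close> is the
  equation itself, and \<open>rad\<close> below is the kernel of \<open>H\<close>, whose
  projectivisation is the singular set.\<close>

definition H :: "'n homog \<Rightarrow> 'n homog \<Rightarrow> complex" where
  "H x y = (snd (snd x) * cnj (fst y) - fst x * cnj (snd (snd y))) / (2 * \<i>) - herm (fst (snd x)) (fst (snd y))"

definition rad :: "'n homog set" where
  "rad = {x. fst x = 0 \<and> snd (snd x) = 0 \<and> (\<forall>j. eps j \<noteq> 0 \<longrightarrow> fst (snd x) $ j = 0)}"

definition ncone :: "'n homog set" where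
  "ncone = {x. H x x = 0 \<and> x \<notin> rad}"

definition M :: "'n cproj set" where
  "M = proj ` ncone"

lemma herm_add: "herm (x + y) z = herm x z + herm y z" "herm x (y + z) = herm x y + herm x z"
  by (simp_all add: herm_def algebra_simps sum.distrib)

lemma herm_scale: "herm (c *s x) y = c * herm x y" "herm x (c *s y) = cnj c * herm x y"
  by (simp_all add: herm_def sum_distrib_left mult_ac)

lemma herm_0 [simp]: "herm 0 x = 0" "herm x 0 = 0"
  by (simp_all add: herm_def)

lemma herm_minus: "herm (- x) y = - herm x y" "herm x (- y) = - herm x y"
  by (simp_all add: herm_def sum_negf)

lemma herm_diff: "herm (x - y) z = herm x z - herm y z" "herm x (y - z) = herm x y - herm x z"
  by (simp_all add: herm_def algebra_simps sum_subtractf)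

lemma herm_cnj: "herm y x = cnj (herm x y)"
  by (simp add: herm_def mult_ac)

lemma H_add: "H (x + y) z = H x z + H y z" "H x (y + z) = H x y + H x z"
  by (simp_all add: H_def herm_add field_simps)

lemma H_hscale: "H (hscale c x) y = c * H x y" "H x (hscale c y) = cnj c * H x y"
  by (simp_all add: H_def herm_scale field_simps)

lemma H_diff: "H (x - y) z = H x z - H y z" "H x (y - z) = H x y - H x z"
  by (simp_all add: H_def herm_diff field_simps)

lemma H_cnj: "H y x = cnj (H x y)"
  by (simp add: H_def herm_cnj[of "fst (snd y)"] field_simps)

lemma H_eq_0_commute: "H y x = 0 \<longleftrightarrow> H x y = 0"
  by (metis H_cnj complex_cnj_zero_iff)

lemma H_0 [simp]: "H 0 x = 0" "H x 0 = 0"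
  by (simp_all add: H_def)

lemma rad_H: "r \<in> rad \<Longrightarrow> H r y = 0" "r \<in> rad \<Longrightarrow> H y r = 0"
proof -
  show "H r y = 0" if "r \<in> rad" for r y
    using that unfolding H_def herm_def rad_def by (auto intro!: sum.neutral)
  then show "r \<in> rad \<Longrightarrow> H y r = 0" by (simp add: H_eq_0_commute)
qed

lemma rad_0 [simp]: "0 \<in> rad"
  and rad_add: "x \<in> rad \<Longrightarrow> y \<in> rad \<Longrightarrow> x + y \<in> rad"
  and rad_hscale: "x \<in> rad \<Longrightarrow> hscale c x \<in> rad"
  and rad_diff: "x \<in> rad \<Longrightarrow> y \<in> rad \<Longrightarrow> x - y \<in> rad"
  by (auto simp: rad_def)

lemma rad_hscale_iff: "c \<noteq> 0 \<Longrightarrow> hscale c x \<in> rad \<longleftrightarrow> x \<in> rad"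
  using rad_hscale[of "hscale c x" "inverse c"] rad_hscale[of x c] by (auto simp: hscale_hscale)

lemma rad_add_iff: "r \<in> rad \<Longrightarrow> x + r \<in> rad \<longleftrightarrow> x \<in> rad"
  using rad_add[of x r] rad_diff[of "x + r" r] by auto

lemma ncone_hscale: "c \<noteq> 0 \<Longrightarrow> hscale c x \<in> ncone \<longleftrightarrow> x \<in> ncone"
  by (simp add: ncone_def H_hscale rad_hscale_iff)

lemma ncone_nonzero: "x \<in> ncone \<Longrightarrow> x \<noteq> 0"
  by (auto simp: ncone_def)

lemma ncone_add_rad: "r \<in> rad \<Longrightarrow> x + r \<in> ncone \<longleftrightarrow> x \<in> ncone"
  by (simp add: ncone_def H_add rad_H rad_add_iff)

lemma proj_in_M: "v \<noteq> 0 \<Longrightarrow> proj v \<in> M \<longleftrightarrow> v \<in> ncone"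
  unfolding M_def using proj_eqD ncone_nonzero ncone_hscale by blast

lemma M_cases: assumes "q \<in> M" obtains x where "x \<in> ncone" "q = proj x"
  using assms by (auto simp: M_def)

lemma H_line:
  assumes "H x x = 0" "H y y = 0" "H x y = 0"
  shows "H (x + hscale t (y - x)) (x + hscale t (y - x)) = 0"
  using assms H_eq_0_commute[of x y] by (simp add: H_add H_hscale H_diff)

definition perp :: "'n cproj \<Rightarrow> 'n cproj \<Rightarrow> bool" where
  "perp p q \<longleftrightarrow> H (rep_cproj p) (rep_cproj q) = 0"

lemma perp_proj: assumes "x \<noteq> 0" "y \<noteq> 0" shows "perp (proj x) (proj y) \<longleftrightarrow> H x y = 0"
proof -
  obtain c d where "c \<noteq> 0" "rep_cproj (proj x) = hscale c x" "d \<noteq> 0" "rep_cproj (proj y) = hscale d y"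
    using proj_eqD[OF _ rep_cproj_nonzero] assms proj_rep_cproj by metis
  then show ?thesis by (simp add: perp_def H_hscale)
qed

lemma perp_commute: "perp p q \<longleftrightarrow> perp q p"
  by (simp add: perp_def H_eq_0_commute)

lemma closed_rad: "closed rad"
proof -
  have "closed {x :: 'n homog. eps j \<noteq> 0 \<longrightarrow> hcoord (IZ j) x = 0}" for j
    by (cases "eps j = 0") (auto intro!: closed_Collect_eq hcoord_continuous_on continuous_intros)
  then have "closed ({x. hcoord IZeta x = 0} \<inter> {x. hcoord IW x = 0} \<inter> (\<Inter>j. {x. eps j \<noteq> 0 \<longrightarrow> hcoord (IZ j) x = 0}))"
    by (intro closed_Int closed_INT closed_Collect_eq hcoord_continuous_on continuous_intros) auto
  moreover have "rad = {x. hcoord IZeta x = 0} \<inter> {x. hcoord IW x = 0} \<inter> (\<Inter>j. {x. eps j \<noteq> 0 \<longrightarrow> hcoord (IZ j) x = 0})"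
    by (auto simp: rad_def hcoord_simps simp del: hcoord.simps)
  ultimately show ?thesis by simp
qed

section \<open>Isotropy of holomorphic curves and preservation of orthogonality\<close>

lemma H_holomorphic:
  assumes "cderiv_on D y" "open D"
  shows "(\<lambda>t. H (y t) a) holomorphic_on D"
proof -
  note h = cderiv_on_hcoord[OF assms]
  show ?thesis unfolding H_def herm_def
    using h[of IZeta] h[of IW] h[of "IZ j" for j]
    by (intro holomorphic_intros) (simp_all add: hcoord_simps)
qed

lemma H_polarisation:
  assumes y: "cderiv_on D y" and D: "open D" "connected D"
    and null: "\<And>t. t \<in> D \<Longrightarrow> H (y t) (y t) = 0" and st: "s \<in> D" "t \<in> D"
  shows "H (y s) (y t) = 0"
proof -
  define K :: "'n hindex set" where "K = insert IZeta (insert IW (range IZ))"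
  \<comment> \<open>\<open>H\<close> pairs the coordinate w of one argument with \<zeta> of the
    other. So \<open>a\<close> carries the coefficients and \<open>b\<close> has its two outer
    coordinates exchanged, which makes \<open>H\<close> a plain sum of products over
    \<open>K\<close>.\<close>
  define a where "a k t = (case k of IZeta \<Rightarrow> - hcoord IZeta (y t) / (2 * \<i>) | IW \<Rightarrow> hcoord IW (y t) / (2 * \<i>)
    | IZ j \<Rightarrow> - of_real (eps j) * hcoord (IZ j) (y t))" for k t
  define b where "b k t = (case k of IZeta \<Rightarrow> hcoord IW (y t) | IW \<Rightarrow> hcoord IZeta (y t)
    | IZ j \<Rightarrow> hcoord (IZ j) (y t))" for k t
  have "(\<Sum>k\<in>range IZ. a k s * cnj (b k t)) = (\<Sum>j\<in>UNIV. a (IZ j) s * cnj (b (IZ j) t))" for s t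
    by (subst sum.reindex) (auto simp: inj_on_def)
  then have sum: "(\<Sum>k\<in>K. a k s * cnj (b k t)) = H (y s) (y t)" for s t
    unfolding K_def by (simp add: image_iff a_def b_def H_def herm_def hcoord_simps sum_negf diff_divide_distrib right_diff_distrib mult.assoc)
  note h = cderiv_on_hcoord[OF y D(1)]
  have "(\<Sum>k\<in>K. a k s * cnj (b k t)) = 0"
  proof (rule polarisation[of K D a b])
    show "a k holomorphic_on D" "b k holomorphic_on D" for k
      unfolding a_def b_def by (cases k; simp; intro holomorphic_intros h; simp)+
  qed (use D st null sum in \<open>auto simp: K_def\<close>)
  then show ?thesis by (simp add: sum)
qed

text \<open>From here on, \<open>C1\<close> smoothness and the CR condition enter only through this
  property of \<open>f\<close> and of its inverse.\<close>

definition lifts :: "('n cproj \<Rightarrow> 'n cproj) \<Rightarrow> bool" where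
  "lifts f \<longleftrightarrow> (\<forall>u v t\<^sub>0 e. e > 0 \<longrightarrow> (\<forall>t\<in>ball t\<^sub>0 e. u + hscale t v \<in> ncone) \<longrightarrow>
     (\<exists>\<delta> y. \<delta> > 0 \<and> \<delta> \<le> e \<and> cderiv_on (ball t\<^sub>0 \<delta>) y \<and>
        (\<forall>t\<in>ball t\<^sub>0 \<delta>. y t \<in> ncone \<and> f (proj (u + hscale t v)) = proj (y t))))"

lemma liftsD:
  assumes "lifts f" "e > 0" "\<And>t. t \<in> ball t\<^sub>0 e \<Longrightarrow> u + hscale t v \<in> ncone"
  obtains \<delta> y where "\<delta> > 0" "\<delta> \<le> e" "cderiv_on (ball t\<^sub>0 \<delta>) y"
    "\<And>t. t \<in> ball t\<^sub>0 \<delta> \<Longrightarrow> y t \<in> ncone \<and> f (proj (u + hscale t v)) = proj (y t)"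
proof -
  have "\<exists>\<delta> y. \<delta> > 0 \<and> \<delta> \<le> e \<and> cderiv_on (ball t\<^sub>0 \<delta>) y \<and>
        (\<forall>t\<in>ball t\<^sub>0 \<delta>. y t \<in> ncone \<and> f (proj (u + hscale t v)) = proj (y t))"
    by (rule assms(1)[unfolded lifts_def, rule_format, OF assms(2,3)])
  then obtain \<delta> y where "\<delta> > 0 \<and> \<delta> \<le> e \<and> cderiv_on (ball t\<^sub>0 \<delta>) y \<and>
        (\<forall>t\<in>ball t\<^sub>0 \<delta>. y t \<in> ncone \<and> f (proj (u + hscale t v)) = proj (y t))" by blast
  then show thesis by (intro that[of \<delta> y]) blast+
qed

text \<open>A holomorphic curve in the quadric spans an isotropic subspace, by polarisation.\<close>

lemma lifts_perp:
  assumes f: "lifts f" and pq: "p \<in> M" "q \<in> M" "perp p q"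
  shows "perp (f p) (f q)"
proof -
  obtain x where x: "x \<in> ncone" "p = proj x" using pq(1) by (rule M_cases)
  obtain y where y: "y \<in> ncone" "q = proj y" using pq(2) by (rule M_cases)
  have xy: "H x y = 0" using pq(3) perp_proj ncone_nonzero x y by blast
  define l where "l t = x + hscale t (y - x)" for t
  have l01: "l 0 = x" "l 1 = y" by (simp_all add: l_def)
  define D where "D = {t. l t \<notin> rad}"
  have ncone: "l t \<in> ncone \<longleftrightarrow> t \<in> D" for t
    using H_line[OF _ _ xy] x y by (auto simp: ncone_def D_def l_def)
  have "continuous_on UNIV l" unfolding l_def by (rule continuous_on_line)
  then have "open (l -` (- rad))" using closed_rad by (intro open_vimage) auto
  moreover have "D = l -` (- rad)" by (auto simp: D_def)
  ultimately have openD: "open D" by simp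
  have D01: "0 \<in> D" "1 \<in> D" using ncone l01 x y by auto
  \<comment> \<open>The line passes through \<open>x\<close>, which is not in the subspace
    \<open>rad\<close>, and so meets \<open>rad\<close> in at most one point; a punctured plane is
    connected.\<close>
  have connD: "connected D"
  proof (cases "D = UNIV")
    case False
    then obtain t\<^sub>1 where t\<^sub>1: "l t\<^sub>1 \<in> rad" by (auto simp: D_def)
    have "t = t\<^sub>1" if "l t \<in> rad" for t
    proof (rule ccontr)
      assume ne: "t \<noteq> t\<^sub>1"
      have "l t - l t\<^sub>1 = hscale (t - t\<^sub>1) (y - x)" by (simp add: l_def hscale.diff_left)
      then have "hscale (t - t\<^sub>1) (y - x) \<in> rad" using rad_diff[OF that t\<^sub>1] by simp
      then have "y - x \<in> rad" using ne rad_hscale_iff[of "t - t\<^sub>1"] by simp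
      then have "l t - hscale t (y - x) \<in> rad" using that rad_diff rad_hscale by blast
      then show False using x(1) by (simp add: l_def ncone_def)
    qed
    then have "D = - {t\<^sub>1}" using t\<^sub>1 unfolding D_def by blast
    moreover have "connected (- {t\<^sub>1})" by (rule connected_punctured_universe) simp
    ultimately show ?thesis by simp
  next
    case True
    then show ?thesis using connected_UNIV by metis
  qed
  have local: "\<exists>\<delta> Y. \<delta> > 0 \<and> ball t \<delta> \<subseteq> D \<and> cderiv_on (ball t \<delta>) Y \<and>
      (\<forall>s\<in>ball t \<delta>. Y s \<in> ncone \<and> f (proj (l s)) = proj (Y s))" if tD: "t \<in> D" for t
  proof -
    obtain e where e: "e > 0" "ball t e \<subseteq> D" using openE[OF openD tD] by blast
    then have "\<And>s. s \<in> ball t e \<Longrightarrow> x + hscale s (y - x) \<in> ncone" using ncone by (auto simp: l_def)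
    from liftsD[OF f e(1) this] obtain \<delta> Y where "\<delta> > 0" "\<delta> \<le> e" "cderiv_on (ball t \<delta>) Y"
      "\<And>s. s \<in> ball t \<delta> \<Longrightarrow> Y s \<in> ncone \<and> f (proj (x + hscale s (y - x))) = proj (Y s)" by blast
    then show ?thesis using e by (intro exI[of _ \<delta>] exI[of _ Y]) (auto simp: l_def)
  qed
  \<comment> \<open>Lifts exist only locally, so orthogonality to \<open>f p\<close> is carried from
    0 to 1 by connectedness. \<open>I\<close> is open by its form, and its complement in
    \<open>D\<close> is open by the identity theorem applied to the holomorphic function
    \<open>H (Y r) (Y0 0)\<close>.\<close>
  define I where "I = {t\<in>D. \<exists>\<eta>>0. \<forall>s\<in>ball t \<eta> \<inter> D. perp (f (proj (l s))) (f p)}"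
  obtain \<delta>0 Y0 where Y0: "\<delta>0 > 0" "ball 0 \<delta>0 \<subseteq> D" "cderiv_on (ball 0 \<delta>0) Y0"
      "\<forall>s\<in>ball 0 \<delta>0. Y0 s \<in> ncone \<and> f (proj (l s)) = proj (Y0 s)" using local[OF D01(1)] by blast
  have fp: "f p = proj (Y0 0)" "Y0 0 \<in> ncone" using Y0 x l01 by auto
  have "0 \<in> I"
  proof -
    have "perp (f (proj (l s))) (f p)" if "s \<in> ball 0 \<delta>0" for s
    proof -
      have "H (Y0 s) (Y0 0) = 0"
      proof (rule H_polarisation[OF Y0(3) open_ball connected_ball _ that])
        show "H (Y0 t) (Y0 t) = 0" if "t \<in> ball 0 \<delta>0" for t
          using Y0(4) that by (simp add: ncone_def)
      qed (simp add: Y0(1))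
      then show ?thesis
        using Y0(4) that fp perp_proj[OF ncone_nonzero ncone_nonzero, of "Y0 s" "Y0 0"] by simp
    qed
    then show ?thesis using D01 Y0(1) unfolding I_def by (auto intro!: exI[of _ \<delta>0])
  qed
  have openI: "open I"
    unfolding open_contains_ball
  proof
    fix t assume "t \<in> I"
    then obtain \<eta> where t: "t \<in> D" "\<eta> > 0" "\<forall>s\<in>ball t \<eta> \<inter> D. perp (f (proj (l s))) (f p)"
      by (auto simp: I_def)
    obtain e where e: "e > 0" "ball t e \<subseteq> D" using openE[OF openD t(1)] by blast
    have "ball t (min e \<eta>) \<subseteq> I"
    proof
      fix s assume s: "s \<in> ball t (min e \<eta>)"
      then have "s \<in> ball t \<eta>" by simp
      then obtain \<eta>' where "\<eta>' > 0" "ball s \<eta>' \<subseteq> ball t \<eta>" using openE[OF open_ball] by blast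
      then show "s \<in> I" using s e(2) t(3) unfolding I_def by (auto intro!: exI[of _ \<eta>'])
    qed
    then show "\<exists>e>0. ball t e \<subseteq> I" using e(1) t(2) by (metis min_less_iff_conj)
  qed
  have openJ: "open (D - I)"
    unfolding open_contains_ball
  proof
    fix t assume t: "t \<in> D - I"
    then obtain \<delta> Y where Y: "\<delta> > 0" "ball t \<delta> \<subseteq> D" "cderiv_on (ball t \<delta>) Y"
      "\<And>s. s\<in>ball t \<delta> \<Longrightarrow> Y s \<in> ncone \<and> f (proj (l s)) = proj (Y s)" using local[of t] by blast
    have iff: "perp (f (proj (l s))) (f p) \<longleftrightarrow> H (Y s) (Y0 0) = 0" if "s \<in> ball t \<delta>" for s
      using Y(4)[OF that] fp perp_proj[OF ncone_nonzero ncone_nonzero] by simp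
    have "ball t \<delta> \<inter> I = {}"
    proof (rule ccontr)
      assume "ball t \<delta> \<inter> I \<noteq> {}"
      then obtain s \<eta> where s: "s \<in> ball t \<delta>" "\<eta> > 0" "\<forall>s\<in>ball s \<eta> \<inter> D. perp (f (proj (l s))) (f p)"
        by (auto simp: I_def)
      have "H (Y r) (Y0 0) = 0" if "r \<in> ball t \<delta>" for r
      proof (rule analytic_continuation_open[of "ball s \<eta> \<inter> ball t \<delta>" "ball t \<delta>" "\<lambda>r. H (Y r) (Y0 0)" "\<lambda>_. 0"])
        show "ball s \<eta> \<inter> ball t \<delta> \<noteq> {}" using s(1,2) centre_in_ball[of s \<eta>] by blast
        show "H (Y z) (Y0 0) = 0" if "z \<in> ball s \<eta> \<inter> ball t \<delta>" for z
          using s(3) that iff[of z] Y(2) by blast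
      qed (use that H_holomorphic[OF Y(3) open_ball, of "Y0 0"] in \<open>simp_all add: open_Int\<close>)
      then have "\<forall>s\<in>ball t \<delta> \<inter> D. perp (f (proj (l s))) (f p)" using iff by blast
      then have "t \<in> I" using Y(1) t unfolding I_def by blast
      then show False using t by simp
    qed
    then show "\<exists>e>0. ball t e \<subseteq> D - I" using Y(1,2) by blast
  qed
  have "I \<subseteq> D" by (auto simp: I_def)
  then have "D - I = {}"
    using connectedD[OF connD openI openJ] \<open>0 \<in> I\<close> D01(1) by blast
  then have "1 \<in> I" using D01 by blast
  then have "perp (f (proj (l 1))) (f p)" using D01 by (auto simp: I_def)
  then show ?thesis using perp_commute l01 y by simp
qed

text \<open>The inverse is included so that orthogonality is preserved in both directions.\<close>

definition good :: "('n cproj \<Rightarrow> 'n cproj) \<Rightarrow> bool" where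
  "good f \<longleftrightarrow> bij_betw f M M \<and> lifts f \<and> lifts (inv_into M f)"

lemma lifts_CR:
  assumes "C1_smooth_on M f" "CR_commuting M f" "f ` M \<subseteq> M"
  shows "lifts f"
  unfolding lifts_def
proof (intro allI impI)
  fix u v t\<^sub>0 and e :: real
  assume e: "e > 0" and ncone: "\<forall>t\<in>ball t\<^sub>0 e. u + hscale t v \<in> ncone"
  have *: "\<And>t. t \<in> ball t\<^sub>0 e \<Longrightarrow> u + hscale t v \<noteq> 0 \<and> proj (u + hscale t v) \<in> M"
    using ncone ncone_nonzero proj_in_M by blast
  obtain \<delta> y where \<delta>: "\<delta> > 0" "\<delta> \<le> e" "cderiv_on (ball t\<^sub>0 \<delta>) y"
    "\<And>t. t \<in> ball t\<^sub>0 \<delta> \<Longrightarrow> y t \<noteq> 0 \<and> f (proj (u + hscale t v)) = proj (y t)"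
    using CR_lift_line[OF assms(1,2) e *] by metis
  have "y t \<in> ncone" if "t \<in> ball t\<^sub>0 \<delta>" for t
  proof -
    have "proj (u + hscale t v) \<in> M" using * that \<delta>(2) by auto
    then have "f (proj (u + hscale t v)) \<in> M" using assms(3) by blast
    then show ?thesis using \<delta>(4)[OF that] proj_in_M by simp
  qed
  then show "\<exists>\<delta> y. \<delta> > 0 \<and> \<delta> \<le> e \<and> cderiv_on (ball t\<^sub>0 \<delta>) y \<and>
        (\<forall>t\<in>ball t\<^sub>0 \<delta>. y t \<in> ncone \<and> f (proj (u + hscale t v)) = proj (y t))"
    using \<delta> by blast
qed

lemma good_CR:
  assumes "C1_CR_automorphism M f"
  shows "good f"
proof -
  have f: "bij_betw f M M" "C1_smooth_on M f" "C1_smooth_on M (inv_into M f)"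
    using assms unfolding C1_CR_automorphism_def C1_diffeomorphism_def by auto
  have "f ` M \<subseteq> M" "inv_into M f ` M \<subseteq> M"
    using bij_betw_imp_surj_on[OF f(1)] bij_betw_imp_surj_on[OF bij_betw_inv_into[OF f(1)]] by auto
  then show ?thesis
    unfolding good_def
    using f lifts_CR C1_CR_automorphism_commuting[OF assms] CR_commuting_inv[OF assms] by blast
qed

lemma goodD:
  assumes "good f"
  shows "lifts f" "lifts (inv_into M f)" "p \<in> M \<Longrightarrow> f p \<in> M" "p \<in> M \<Longrightarrow> inv_into M f p \<in> M"
    "p \<in> M \<Longrightarrow> f (inv_into M f p) = p" "p \<in> M \<Longrightarrow> inv_into M f (f p) = p"
proof -
  have bij: "bij_betw f M M" using assms by (simp add: good_def)
  show "lifts f" "lifts (inv_into M f)" using assms by (simp_all add: good_def)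
  show "p \<in> M \<Longrightarrow> f p \<in> M" using bij by (rule bij_betw_apply)
  show "p \<in> M \<Longrightarrow> inv_into M f p \<in> M" using bij_betw_inv_into[OF bij] by (rule bij_betw_apply)
  show "p \<in> M \<Longrightarrow> f (inv_into M f p) = p" using bij by (rule bij_betw_inv_into_right)
  show "p \<in> M \<Longrightarrow> inv_into M f (f p) = p" using bij by (rule bij_betw_inv_into_left)
qed

lemma good_perp:
  assumes "good f" "p \<in> M" "q \<in> M"
  shows "perp (f p) (f q) \<longleftrightarrow> perp p q"
  using lifts_perp[OF goodD(1)[OF assms(1)] assms(2,3)]
    lifts_perp[OF goodD(2)[OF assms(1)], of "f p" "f q"] goodD(3,6)[OF assms(1)] assms(2,3)
  by auto

lemma good_image_rep:
  assumes "good f" "x \<in> ncone"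
  obtains y where "y \<in> ncone" "f (proj x) = proj y"
proof -
  have "f (proj x) \<in> M" using goodD(3)[OF assms(1)] assms(2) by (simp add: M_def)
  then show thesis using that by (elim M_cases)
qed

lemma good_image_H:
  assumes "good f" "x \<in> ncone" "y \<in> ncone" "x' \<in> ncone" "y' \<in> ncone"
    and "f (proj x) = proj x'" "f (proj y) = proj y'"
  shows "H x' y' = 0 \<longleftrightarrow> H x y = 0"
proof -
  have "perp (f (proj x)) (f (proj y)) \<longleftrightarrow> perp (proj x) (proj y)"
    using assms by (intro good_perp) (simp_all add: M_def)
  then show ?thesis using assms by (simp add: perp_proj ncone_nonzero)
qed

end

section \<open>Criteria for affine maps\<close>

text \<open>\<open>third\<close> kills the mixed coefficient of the restriction of \<open>h\<close> to a plane spanned by two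
  of the given directions.\<close>

lemma affine_if_affine_in_directions:
  fixes h :: "complex ^ 'n \<Rightarrow> complex"
  assumes gen: "\<And>P z. P 0 \<Longrightarrow> (\<And>v y. v \<in> V \<Longrightarrow> P y \<Longrightarrow> P (y + v)) \<Longrightarrow> P z"
    and third: "\<And>u v. u \<in> V \<Longrightarrow> v \<in> V \<Longrightarrow> \<exists>a b. a \<noteq> 0 \<and> b \<noteq> 0 \<and> a *s u + b *s v \<in> V"
    and affine: "\<And>v z t. v \<in> V \<Longrightarrow> h (z + t *s v) = h z + t * (h (z + v) - h z)"
  shows "h (y + z) - h 0 = (h y - h 0) + (h z - h 0)" "h (c *s z) - h 0 = c * (h z - h 0)"
proof -
  have plane: "h (z + u + v) = h (z + u) + h (z + v) - h z" if uv: "u \<in> V" "v \<in> V" for z u v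
  proof -
    define P Q R where "P = h (z + u) - h z" and "Q = h (z + v) - h z"
      and "R = h (z + v + u) - h (z + v) - h (z + u) + h z"
    have G: "h (z + s *s u + t *s v) = h z + s * P + t * Q + s * t * R" for s t
    proof -
      have "h (z + s *s u + t *s v) = h (z + s *s u) + t * (h (z + s *s u + v) - h (z + s *s u))"
        by (rule affine[OF uv(2)])
      moreover have "h (z + s *s u) = h z + s * P" unfolding P_def by (rule affine[OF uv(1)])
      moreover have "h (z + s *s u + v) = h (z + v) + s * (h (z + v + u) - h (z + v))"
        using affine[OF uv(1), of "z + v" s] by (simp add: algebra_simps)
      ultimately have "h (z + s *s u + t *s v)
          = h z + s * P + t * (h (z + v) + s * (h (z + v + u) - h (z + v)) - (h z + s * P))" by simp
      then show ?thesis unfolding P_def Q_def R_def by algebra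
    qed
    obtain a b where ab: "a \<noteq> 0" "b \<noteq> 0" "a *s u + b *s v \<in> V" using third uv by blast
    define w where "w = a *s u + b *s v"
    have w: "z + t *s w = z + (t * a) *s u + (t * b) *s v" for t
      by (simp add: w_def vec_eq_iff algebra_simps)
    have "h (z + t *s w) = h z + t * a * P + t * b * Q + t * a * (t * b) * R" for t
      unfolding w by (rule G)
    \<comment> \<open>Along \<open>w\<close> the function is quadratic in \<open>t\<close> with
      leading coefficient \<open>a * b * R\<close>; comparing its values at 0, 1 and 2 with those of
      an affine function kills that coefficient.\<close>
    from this[of 1] this[of 2] affine[OF ab(3), of z 2, folded w_def]
    have "2 * a * b * R = 0" by (simp add: algebra_simps)
    then have "R = 0" using ab by simp
    then show ?thesis by (simp add: R_def algebra_simps)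
  qed
  have shift: "h (z + v) - h z = h v - h 0" if v: "v \<in> V" for v z
  proof (rule gen[of "\<lambda>z. h (z + v) - h z = h v - h 0" z])
    fix u y assume u: "u \<in> V" and y: "h (y + v) - h y = h v - h 0"
    show "h (y + u + v) - h (y + u) = h v - h 0" using plane[OF u v, of y] y by simp
  qed simp
  show add: "h (y + z) - h 0 = (h y - h 0) + (h z - h 0)" for y z
  proof (rule gen[of "\<lambda>z. h (y + z) - h 0 = (h y - h 0) + (h z - h 0)" z])
    fix v x assume v: "v \<in> V" and x: "h (y + x) - h 0 = (h y - h 0) + (h x - h 0)"
    show "h (y + (x + v)) - h 0 = (h y - h 0) + (h (x + v) - h 0)"
      using shift[OF v, of "y + x"] shift[OF v, of x] x unfolding add.assoc[symmetric] by algebra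
  qed simp
  show "h (c *s z) - h 0 = c * (h z - h 0)"
  proof (rule gen[of "\<lambda>z. h (c *s z) - h 0 = c * (h z - h 0)" z])
    fix v x assume v: "v \<in> V" and x: "h (c *s x) - h 0 = c * (h x - h 0)"
    have "h (c *s v) - h 0 = c * (h v - h 0)" using affine[OF v, of 0 c] by simp
    then show "h (c *s (x + v)) - h 0 = c * (h (x + v) - h 0)"
      using add[of "c *s x" "c *s v"] add[of x v] x unfolding vector_add_ldistrib by algebra
  qed simp
qed

lemma homog_affine_if_affine_in_directions:
  fixes B :: "complex ^ 'n \<Rightarrow> 'n::finite homog"
  assumes gen: "\<And>P z. P 0 \<Longrightarrow> (\<And>v y. v \<in> V \<Longrightarrow> P y \<Longrightarrow> P (y + v)) \<Longrightarrow> P z"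
    and third: "\<And>u v. u \<in> V \<Longrightarrow> v \<in> V \<Longrightarrow> \<exists>a b. a \<noteq> 0 \<and> b \<noteq> 0 \<and> a *s u + b *s v \<in> V"
    and affine: "\<And>v z t. v \<in> V \<Longrightarrow> B (z + t *s v) = B z + hscale t (B (z + v) - B z)"
  shows "B (y + z) - B 0 = (B y - B 0) + (B z - B 0)" "B (c *s z) - B 0 = hscale c (B z - B 0)"
proof -
  have h: "hcoord i (B (z + t *s v)) = hcoord i (B z) + t * (hcoord i (B (z + v)) - hcoord i (B z))"
    if "v \<in> V" for i v z t
    by (simp add: affine[OF that] hcoord_add hcoord_hscale hcoord_diff)
  show "B (y + z) - B 0 = (B y - B 0) + (B z - B 0)"
  proof (rule hcoord_eqI, unfold hcoord_diff hcoord_add)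
    fix i
    show "hcoord i (B (y + z)) - hcoord i (B 0) = hcoord i (B y) - hcoord i (B 0) + (hcoord i (B z) - hcoord i (B 0))"
      by (rule affine_if_affine_in_directions(1)[of V "\<lambda>z. hcoord i (B z)"]) (fact gen third h)+
  qed
  show "B (c *s z) - B 0 = hscale c (B z - B 0)"
  proof (rule hcoord_eqI, unfold hcoord_diff hcoord_hscale)
    fix i
    show "hcoord i (B (c *s z)) - hcoord i (B 0) = c * (hcoord i (B z) - hcoord i (B 0))"
      by (rule affine_if_affine_in_directions(2)[of V "\<lambda>z. hcoord i (B z)"]) (fact gen third h)+
  qed
qed

lemma entire_linear_growth:
  fixes h :: "complex \<Rightarrow> complex"
  assumes "h holomorphic_on UNIV" "\<And>t. A \<le> cmod t \<Longrightarrow> cmod (h t) \<le> B * cmod t"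
  shows "h t = h 0 + t * (h 1 - h 0)"
proof -
  have *: "h t = (\<Sum>k\<le>1. (deriv ^^ k) h 0 / fact k * t ^ k)" for t
    by (rule Liouville_polynomial[OF assms(1), of A B]) (simp add: assms(2))
  show ?thesis using *[of t] *[of 1] by simp
qed

text \<open>The difference quotient \<open>q\<close> of \<open>g\<close> at 0 is entire, and
  injectivity keeps it away from zero. The growth condition bounds \<open>1 / q\<close>, which is
  then constant by Liouville.\<close>

lemma injective_entire_affine:
  fixes g :: "complex \<Rightarrow> complex"
  assumes hol: "g holomorphic_on UNIV" and inj: "inj g"
    and growth: "\<And>t. R \<le> cmod t \<Longrightarrow> cmod t \<le> C * (1 + cmod (g t))"
  obtains a where "a \<noteq> 0" "\<And>t. g t = g 0 + a * t"
proof -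
  define q where "q t = (if t = 0 then deriv g 0 else (g t - g 0) / (t - 0))" for t
  have q_hol: "q holomorphic_on UNIV" unfolding q_def by (rule pole_lemma_open[OF hol]) simp
  have "deriv g 0 \<noteq> 0" by (rule holomorphic_injective_imp_regular[OF hol open_UNIV inj]) simp
  then have q_nz: "q t \<noteq> 0" for t using inj by (auto simp: q_def inj_def)
  have inv_hol: "(\<lambda>t. inverse (q t)) holomorphic_on UNIV"
    using q_hol q_nz by (intro holomorphic_intros) auto
  define C' where "C' = \<bar>C\<bar> + 1"
  \<comment> \<open>Beyond this radius the term with \<open>g 0\<close> takes up at most half of
    \<open>cmod t\<close>, which leaves
    \<open>cmod t \<le> 2 * C' * cmod (g t - g 0)\<close>.\<close>
  define \<rho> where "\<rho> = max (max R 1) (2 * C' * (1 + cmod (g 0)))"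
  have C': "C' > 0" by (simp add: C'_def)
  have far: "cmod (inverse (q t)) \<le> 2 * C'" if t: "cmod t \<ge> \<rho>" for t
  proof -
    have t0: "t \<noteq> 0" "cmod t > 0" using t by (auto simp: \<rho>_def)
    have "cmod t \<le> C * (1 + cmod (g t))" using growth t by (simp add: \<rho>_def)
    also have "\<dots> \<le> C' * (1 + cmod (g t))" by (intro mult_right_mono) (auto simp: C'_def)
    also have "cmod (g t) \<le> cmod (g t - g 0) + cmod (g 0)" using norm_triangle_ineq[of "g t - g 0" "g 0"] by simp
    finally have "cmod t \<le> C' * (1 + cmod (g 0)) + C' * cmod (g t - g 0)"
      using C' by (simp add: algebra_simps)
    moreover have "2 * (C' * (1 + cmod (g 0))) \<le> cmod t" using t by (simp add: \<rho>_def mult.assoc)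
    ultimately have "cmod t \<le> 2 * C' * cmod (g t - g 0)" by linarith
    then have "cmod t / cmod (g t - g 0) \<le> 2 * C'"
      using q_nz[of t] t0 by (simp add: q_def divide_simps split: if_splits)
    then show ?thesis using t0 by (simp add: q_def norm_divide norm_inverse)
  qed
  have "bounded ((\<lambda>t. inverse (q t)) ` cball 0 \<rho>)"
    by (intro compact_imp_bounded compact_continuous_image compact_cball
        holomorphic_on_imp_continuous_on holomorphic_on_subset[OF inv_hol]) simp
  then obtain B where "\<forall>x\<in>(\<lambda>t. inverse (q t)) ` cball 0 \<rho>. cmod x \<le> B" unfolding bounded_iff ..
  then have B: "cmod (inverse (q t)) \<le> B" if "cmod t \<le> \<rho>" for t using that by simp
  have "bounded (range (\<lambda>t. inverse (q t)))"
    unfolding bounded_iff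
  proof (intro exI ballI)
    fix x assume "x \<in> range (\<lambda>t. inverse (q t))"
    then obtain t where "x = inverse (q t)" by blast
    then show "cmod x \<le> max B (2 * C')" using B[of t] far[of t] by (cases "cmod t \<le> \<rho>") auto
  qed
  then have "(\<lambda>t. inverse (q t)) constant_on UNIV" by (rule Liouville_theorem[OF inv_hol])
  then have "inverse (q t) = inverse (q 0)" for t by (metis UNIV_I constant_on_def)
  then have qt: "q t = q 0" for t by simp
  show thesis
  proof (rule that[of "q 0"])
    show "q 0 \<noteq> 0" by (rule q_nz)
    show "g t = g 0 + q 0 * t" for t using qt[of t] by (cases "t = 0") (auto simp: q_def field_simps)
  qed
qed

section \<open>Limits of points of projective space\<close>

text \<open>Proportionality is tested by the 2x2 minors: they are continuous in the two lifts and
  pass to the limit without any control of the proportionality factor.\<close>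

lemma proj_eq_limit:
  fixes y y' :: "complex \<Rightarrow> 'n::finite homog"
  assumes "isCont y t" "isCont y' t" "y t \<noteq> 0" "y' t \<noteq> 0"
    and ev: "eventually (\<lambda>s. y s \<noteq> 0 \<and> y' s \<noteq> 0 \<and> proj (y s) = proj (y' s)) (at t)"
  shows "proj (y t) = proj (y' t)"
proof (rule proj_eqI_minors[OF assms(3,4)])
  fix i j
  let ?m = "\<lambda>s. hcoord i (y s) * hcoord j (y' s) - hcoord j (y s) * hcoord i (y' s)"
  have "(?m \<longlongrightarrow> ?m t) (at t)"
    using assms(1,2) unfolding isCont_def by (intro tendsto_intros hcoord_tendsto)
  moreover have "eventually (\<lambda>s. ?m s = 0) (at t)"
    using ev
  proof eventually_elim
    case (elim s)
    then obtain c where "y' s = hscale c (y s)" using proj_eqD by blast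
    then show ?case by (simp add: hcoord_hscale)
  qed
  then have "(?m \<longlongrightarrow> 0) (at t)" by (rule tendsto_eventually)
  ultimately have "?m t = 0" by (intro tendsto_unique[of "at t" ?m]) auto
  then show "hcoord i (y t) * hcoord j (y' t) = hcoord j (y t) * hcoord i (y' t)" by simp
qed

context hermitian_quadric
begin

definition sing :: "'n cproj set" where
  "sing = proj ` (rad - {0})"

lemma sing_cases: assumes "q \<in> sing" obtains r where "r \<in> rad" "r \<noteq> 0" "q = proj r"
  using assms by (auto simp: sing_def)

lemma M_sing_disjoint: "M \<inter> sing = {}"
proof -
  have False if q: "q \<in> M" "q \<in> sing" for q
  proof -
    obtain r where r: "r \<in> rad" "r \<noteq> 0" "q = proj r" using q(2) by (rule sing_cases)
    then show False using q(1) proj_in_M[of r] by (simp add: ncone_def)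
  qed
  then show ?thesis by blast
qed

text \<open>A point at infinity of the quadric; \<open>H x pinf\<close> is a multiple of the
  coordinate \<zeta> of \<open>x\<close>, so the hyperplane at infinity is the orthogonal complement
  of \<open>pinf\<close>.\<close>

definition pinf :: "'n homog" where "pinf = (0, 0, 1)"

lemma pinf_coords [simp]: "fst pinf = 0" "fst (snd pinf) = 0" "snd (snd pinf) = 1"
  by (simp_all add: pinf_def)

lemma H_pinf: "H x pinf = - fst x / (2 * \<i>)" "H pinf x = cnj (fst x) / (2 * \<i>)"
  by (simp_all add: H_def)

lemma pinf_in_ncone: "pinf \<in> ncone"
  by (simp add: ncone_def H_pinf rad_def)

lemma H_add_null:
  assumes "H u u = 0" "H v v = 0" "Re (H u v) = 0"
  shows "H (u + v) (u + v) = 0"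
proof -
  have "H (u + v) (u + v) = H u v + cnj (H u v)" using assms H_cnj[of v u] by (simp add: H_add)
  then show ?thesis using assms(3) by (simp add: complex_add_cnj)
qed

text \<open>The points of the affine quadric: \<open>herm z z\<close> is real, so it is the
  imaginary part of w, and \<open>\<tau>\<close> is the real part.\<close>

definition npt :: "complex ^ 'n \<Rightarrow> real \<Rightarrow> 'n homog" where
  "npt z \<tau> = (1, z, \<i> * herm z z + of_real \<tau>)"

lemma npt_coords [simp]: "fst (npt z \<tau>) = 1" "fst (snd (npt z \<tau>)) = z"
    "snd (snd (npt z \<tau>)) = \<i> * herm z z + of_real \<tau>"
  by (simp_all add: npt_def)

lemma npt_ncone: "npt z \<tau> \<in> ncone"
  using herm_cnj[of z z] by (simp add: ncone_def rad_def H_def field_simps)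

lemma eq_npt:
  assumes "H x x = 0" "fst x = 1"
  obtains \<tau> where "x = npt (fst (snd x)) \<tau>" "snd (snd x) = \<i> * herm (fst (snd x)) (fst (snd x)) + of_real \<tau>"
proof -
  have "snd (snd x) - cnj (snd (snd x)) = 2 * \<i> * herm (fst (snd x)) (fst (snd x))"
    using assms by (simp add: H_def field_simps)
  then have "snd (snd x) - \<i> * herm (fst (snd x)) (fst (snd x))
      = cnj (snd (snd x) - \<i> * herm (fst (snd x)) (fst (snd x)))"
    using herm_cnj[of "fst (snd x)" "fst (snd x)"] by (simp add: algebra_simps)
  then obtain \<tau> where \<tau>: "snd (snd x) - \<i> * herm (fst (snd x)) (fst (snd x)) = of_real \<tau>"
    by (metis Reals_cnj_iff Reals_cases)
  show thesis
  proof (rule that)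
    show w: "snd (snd x) = \<i> * herm (fst (snd x)) (fst (snd x)) + of_real \<tau>" using \<tau> by (simp add: algebra_simps)
    show "x = npt (fst (snd x)) \<tau>" by (rule homog_eqI) (simp_all add: w assms(2))
  qed
qed

lemma rad_add_ncone: "r \<in> rad \<Longrightarrow> x \<in> ncone \<Longrightarrow> s \<noteq> 0 \<Longrightarrow> r + hscale s x \<in> ncone"
  using ncone_add_rad[of r "hscale s x"] ncone_hscale[of s x] by (simp add: add.commute)

text \<open>Approach the singular point \<open>proj r\<close> along the curve \<open>r + s pinf\<close>, \<open>s \<rightarrow> 0\<close>.\<close>

lemma linear_extension:
  assumes T: "clin T" "surj T" and fT: "\<forall>x\<in>ncone. f (proj x) = proj (T x)"
  shows "holomorphic_automorphism (pmap T)"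
    and "\<And>p. p \<in> M \<Longrightarrow> pmap T p = f p"
    and "open U \<Longrightarrow> sing \<subseteq> U \<Longrightarrow> holomorphic_proj F U \<Longrightarrow> (\<And>p. p \<in> U \<inter> (M \<union> sing) \<Longrightarrow> F p = f p)
      \<Longrightarrow> p \<in> sing \<Longrightarrow> pmap T p = f p"
    and "continuous_on (M \<union> sing) f \<Longrightarrow> p \<in> sing \<Longrightarrow> pmap T p = f p"
    and "f ` M = M \<Longrightarrow> f p \<in> sing \<Longrightarrow> \<exists>!j. eps j = 0 \<Longrightarrow> p \<in> sing \<Longrightarrow> pmap T p = f p"
proof -
  note f = bspec[OF fT]
  note T' = clin_surj_bij[OF T]
  note inj = bij_is_inj[OF T']
  show "holomorphic_automorphism (pmap T)" using T(1) T' by (rule holomorphic_automorphism_pmap)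
  show M: "pmap T p = f p" if "p \<in> M" for p
    using that by (rule M_cases) (simp add: f pmap_proj[OF T(1) inj] ncone_nonzero)
  define l where "l r s = r + hscale s pinf" for r s
  have l: "l r s \<in> ncone" "l r s \<noteq> 0" "proj (l r s) \<in> M" "T (l r s) \<noteq> 0" if "r \<in> rad" "s \<noteq> 0" for r s
  proof -
    show *: "l r s \<in> ncone" unfolding l_def using that pinf_in_ncone by (intro rad_add_ncone)
    show **: "l r s \<noteq> 0" using * by (rule ncone_nonzero)
    show "proj (l r s) \<in> M" using * ** proj_in_M by blast
    show "T (l r s) \<noteq> 0" using clin_nonzero[OF T(1) inj **] .
  qed
  have contl: "isCont (l r) s" for s r
    unfolding l_def using continuous_on_line[of UNIV r pinf] by (simp add: continuous_on_eq_continuous_at)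
  have contT: "isCont (\<lambda>s. T (l r s)) s" for s r
    by (rule isCont_o2[OF contl]) (rule linear_continuous_at[OF clin_bounded_linear[OF T(1)]])
  have l0 [simp]: "l r 0 = r" for r by (simp add: l_def)
  have nonzero_ev: "eventually (\<lambda>s::complex. s \<noteq> 0) (at 0)" by (rule eventually_neq_at_within)
  show "pmap T p = f p" if U: "open U" "sing \<subseteq> U" "holomorphic_proj F U"
    "\<And>p. p \<in> U \<inter> (M \<union> sing) \<Longrightarrow> F p = f p" and p: "p \<in> sing" for U F p
  proof -
    obtain r where r: "r \<in> rad" "r \<noteq> 0" "p = proj r" using p by (rule sing_cases)
    obtain j where j: "F p \<in> chart_dom j" by (rule chart_dom_cover)
    have pU: "p \<in> U" using U(2) p by blast
    from holomorphic_proj_lift[OF U(3) r(2), of j]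
    obtain \<delta> Y where \<delta>: "\<delta> > 0"
      and Y: "\<And>v. v \<in> ball r \<delta> \<Longrightarrow> v \<noteq> 0 \<and> proj v \<in> U \<and> F (proj v) = proj (Y v) \<and> hcoord j (Y v) = 1"
      and dY: "\<And>v. v \<in> ball r \<delta> \<Longrightarrow> \<exists>A. clin A \<and> (Y has_derivative A) (at v)"
      using j pU r(3) by blast
    have Ynz: "Y v \<noteq> 0" if "v \<in> ball r \<delta>" for v using Y[OF that] by auto
    have rb: "r \<in> ball r \<delta>" using \<delta> by simp
    have "isCont Y r" using dY[OF rb] has_derivative_continuous by blast
    then have contY: "isCont (\<lambda>s. Y (l r s)) 0" using isCont_o2[OF contl[of 0 r], of Y] by simp
    have "eventually (\<lambda>s. l r s \<in> ball r \<delta>) (at 0)"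
      by (rule topological_tendstoD[OF contl[of 0 r, unfolded isCont_def l0] open_ball rb])
    then have "eventually (\<lambda>s. Y (l r s) \<noteq> 0 \<and> T (l r s) \<noteq> 0 \<and> proj (Y (l r s)) = proj (T (l r s))) (at 0)"
      using nonzero_ev
    proof eventually_elim
      case (elim s)
      have "F (proj (l r s)) = f (proj (l r s))"
        using U(4) Y[OF elim(1)] l(3)[OF r(1) elim(2)] by blast
      then show ?case
        using Y[OF elim(1)] Ynz[OF elim(1)] l[OF r(1) elim(2)] f[of "l r s"] by simp
    qed
    from proj_eq_limit[OF contY contT _ _ this]
    have "proj (Y r) = proj (T r)" using Ynz[OF rb] clin_nonzero[OF T(1) inj r(2)] by simp
    moreover have "F p = f p" using U(4) pU p by blast
    ultimately show ?thesis using Y[OF rb] r by (simp add: pmap_proj[OF T(1) inj])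
  qed
  show "pmap T p = f p" if cont: "continuous_on (M \<union> sing) f" and p: "p \<in> sing" for p
  proof (rule ccontr)
    assume ne: "pmap T p \<noteq> f p"
    obtain r where r: "r \<in> rad" "r \<noteq> 0" "p = proj r" using p by (rule sing_cases)
    obtain y where y: "y \<noteq> 0" "f p = proj y" by (rule cproj_cases)
    have Tr: "T r \<noteq> 0" using clin_nonzero[OF T(1) inj r(2)] .
    have "proj y \<noteq> proj (T r)" using ne y r by (simp add: pmap_proj[OF T(1) inj])
    then obtain i j where ij: "hcoord i y * hcoord j (T r) \<noteq> hcoord j y * hcoord i (T r)"
      using proj_eqI_minors[OF y(1) Tr] by blast
    define m where "m v = hcoord i v * hcoord j (T r) - hcoord j v * hcoord i (T r)" for v
    \<comment> \<open>Half of the ratio of \<open>cmod (m y)\<close> to \<open>norm y\<close>: the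
      vector \<open>y\<close> satisfies the strict inequality \<open>N\<close>, while
      \<open>m\<close> vanishes at \<open>T r\<close>. \<open>N\<close> is invariant under scaling,
      so it describes a neighbourhood of \<open>f p\<close> in projective space that stays away from
      \<open>proj (T r)\<close>.\<close>
    define \<epsilon> where "\<epsilon> = cmod (m y) / (2 * norm y)"
    have my: "cmod (m y) > 0" using ij by (simp add: m_def)
    then have \<epsilon>: "\<epsilon> > 0" "\<epsilon> * norm y < cmod (m y)" using y(1) by (simp_all add: \<epsilon>_def)
    define N where "N v \<longleftrightarrow> \<epsilon> * norm v < cmod (m v)" for v
    have N_scale: "N (hscale c v) \<longleftrightarrow> N v" if "c \<noteq> 0" for c v
    proof -
      have "m (hscale c v) = c * m v" by (simp add: m_def hcoord_hscale algebra_simps)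
      then have "N (hscale c v) \<longleftrightarrow> cmod c * (\<epsilon> * norm v) < cmod c * cmod (m v)"
        by (simp add: N_def norm_hscale norm_mult mult_ac)
      then show ?thesis using that by (simp add: N_def)
    qed
    define W where "W = {q. N (rep_cproj q)}"
    have W: "proj v \<in> W \<longleftrightarrow> N v" if v: "v \<noteq> 0" for v
    proof -
      obtain c where "c \<noteq> 0" "rep_cproj (proj v) = hscale c v"
        using proj_eqD[OF v rep_cproj_nonzero, of "proj v"] proj_rep_cproj[of "proj v"] by auto
      then show ?thesis by (simp add: W_def N_scale)
    qed
    have contm: "continuous_on UNIV m"
      unfolding m_def by (intro continuous_intros hcoord_continuous_on)
    have "open {v. N v}" unfolding N_def
      by (intro open_Collect_less continuous_intros contm)
    moreover have "{v. v \<noteq> 0 \<and> proj v \<in> W} = {v. N v} - {0}" using W by blast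
    ultimately have "open W" unfolding open_cproj_def by (simp add: open_Diff)
    then obtain V where V: "open V" "V \<inter> (M \<union> sing) = f -` W \<inter> (M \<union> sing)"
      using cont unfolding continuous_on_open_invariant by blast
    have "p \<in> V" using V(2) p y W[OF y(1)] \<epsilon>(2) by (auto simp: N_def)
    then have "r \<in> {v. v \<noteq> 0 \<and> proj v \<in> V}" using r by simp
    moreover have "open {v. v \<noteq> 0 \<and> proj v \<in> V}" using V(1) by (simp add: open_cproj_def)
    ultimately have "eventually (\<lambda>s. l r s \<in> {v. v \<noteq> 0 \<and> proj v \<in> V}) (at 0)"
      using topological_tendstoD[OF contl[of 0 r, unfolded isCont_def l0]] by blast
    then have "eventually (\<lambda>s. \<epsilon> * norm (T (l r s)) \<le> cmod (m (T (l r s)))) (at 0)"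
      using nonzero_ev
    proof eventually_elim
      case (elim s)
      have "f (proj (l r s)) \<in> W" using elim(1) V(2) l(3)[OF r(1) elim(2)] by blast
      then have "N (T (l r s))" using W l(1,4)[OF r(1) elim(2)] f by simp
      then show ?case by (simp add: N_def)
    qed
    moreover have "((\<lambda>s. T (l r s)) \<longlongrightarrow> T r) (at 0)" using contT[of 0 r] by (simp add: isCont_def)
    moreover have "isCont m (T r)" using contm by (simp add: continuous_on_eq_continuous_at)
    ultimately have "\<epsilon> * norm (T r) \<le> cmod (m (T r))"
      by (intro tendsto_le[of "at 0" "\<lambda>s. cmod (m (T (l r s)))" _ "\<lambda>s. \<epsilon> * norm (T (l r s))"])
        (auto intro!: tendsto_intros isCont_tendsto_compose[where g = m])
    then have "\<epsilon> * norm (T r) \<le> 0" by (simp add: m_def)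
    then show False using \<epsilon>(1) Tr by (simp add: mult_le_0_iff)
  qed
  show "pmap T p = f p" if fM: "f ` M = M" and fp: "f p \<in> sing"
    and eps0: "\<exists>!j. eps j = 0" and p: "p \<in> sing" for p
  proof -
    have single: "q = q'" if qq: "q \<in> sing" "q' \<in> sing" for q q'
    proof -
      obtain j where j: "eps j = 0" "\<And>i. eps i = 0 \<Longrightarrow> i = j" using eps0 by blast
      obtain r where r1: "r \<in> rad" "r \<noteq> 0" "q = proj r" using qq(1) by (rule sing_cases)
      obtain r' where r2: "r' \<in> rad" "r' \<noteq> 0" "q' = proj r'" using qq(2) by (rule sing_cases)
      note r = r1 r2
      have zero: "hcoord i x = 0" if "x \<in> rad" "i \<noteq> IZ j" for x i
      proof (cases i)
        case (IZ l)
        then have "eps l \<noteq> 0" using that(2) j(2) by blast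
        then show ?thesis using that(1) IZ by (simp add: rad_def hcoord_simps)
      qed (use that(1) in \<open>simp_all add: rad_def hcoord_simps\<close>)
      have "proj r = proj r'"
      proof (rule proj_eqI_minors[OF r(2,5)])
        show "hcoord a r * hcoord b r' = hcoord b r * hcoord a r'" for a b
          using zero[OF r(1), of a] zero[OF r(1), of b] zero[OF r(4), of a] zero[OF r(4), of b]
          by (cases "a = IZ j"; cases "b = IZ j") auto
      qed
      then show ?thesis using r by simp
    qed
    obtain r where r: "r \<in> rad" "r \<noteq> 0" "p = proj r" using p by (rule sing_cases)
    have Tr: "T r \<noteq> 0" using clin_nonzero[OF T(1) inj r(2)] .
    have null: "H (T (l r s)) (T (l r s)) = 0" if "s \<noteq> 0" for s
    proof -
      have "proj (T (l r s)) \<in> M" using f l(1,3)[OF r(1) that] fM by (metis imageI)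
      then show ?thesis using proj_in_M[OF l(4)[OF r(1) that]] by (simp add: ncone_def)
    qed
    have "T (l r s) = T r + hscale s (T pinf)" for s
      by (simp add: l_def clin_add[OF T(1)] clin_hscale[OF T(1)])
    then have "H (T (l r s)) (T (l r s)) = H (T r) (T r) + cnj s * H (T r) (T pinf) + s * H (T pinf) (T r)
        + s * cnj s * H (T pinf) (T pinf)" for s
      by (simp add: H_add H_hscale algebra_simps)
    \<comment> \<open>For real \<open>s\<close> this is a quadratic polynomial that vanishes at 1,
      -1, 2 and -2; hence its constant term \<open>H (T r) (T r)\<close> is zero.\<close>
    with null[of 1] null[of "-1"] null[of 2] null[of "-2"]
    have "H (T r) (T r) + H (T r) (T pinf) + H (T pinf) (T r) + H (T pinf) (T pinf) = 0"
      "H (T r) (T r) - H (T r) (T pinf) - H (T pinf) (T r) + H (T pinf) (T pinf) = 0"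
      "H (T r) (T r) + 2 * H (T r) (T pinf) + 2 * H (T pinf) (T r) + 4 * H (T pinf) (T pinf) = 0"
      "H (T r) (T r) - 2 * H (T r) (T pinf) - 2 * H (T pinf) (T r) + 4 * H (T pinf) (T pinf) = 0"
      by simp_all
    then have "H (T r) (T r) = 0" by algebra
    \<comment> \<open>Otherwise \<open>proj (T r)\<close> lies in \<open>M\<close>, which is the
      image of \<open>M\<close>, so \<open>pmap T\<close> takes the same value at
      \<open>proj r\<close> and at a point of \<open>M\<close>, against injectivity.\<close>
    have "T r \<in> rad"
    proof (rule ccontr)
      assume "T r \<notin> rad"
      then have "proj (T r) \<in> M" using proj_in_M[OF Tr] \<open>H (T r) (T r) = 0\<close> by (simp add: ncone_def)
      then obtain q where q: "q \<in> M" "proj (T r) = f q" using fM by (metis imageE)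
      obtain x where x: "x \<in> ncone" "q = proj x" using q(1) by (rule M_cases)
      have "pmap T (proj r) = pmap T (proj x)"
        using q(2) x f r(2) ncone_nonzero by (simp add: pmap_proj[OF T(1) inj])
      then have "proj r = proj x" by (rule injD[OF bij_is_inj[OF bij_pmap(1)[OF T(1) T']]])
      then show False using r(1,2) x(1) proj_in_M[of r] x q(1) by (simp add: ncone_def)
    qed
    then have "pmap T p \<in> sing" using r Tr by (simp add: pmap_proj[OF T(1) inj] sing_def)
    then show ?thesis using single fp by blast
  qed
qed

end

section \<open>Isometries\<close>

context hermitian_quadric
begin

lemma axis_component: "axis i c $ j = (if j = i then c else 0)"
  by (simp add: axis_def)

lemma herm_axis: "herm z (axis j c) = of_real (eps j) * z $ j * cnj c"
proof -
  have "herm z (axis j c) = (\<Sum>l\<in>UNIV. if l = j then of_real (eps j) * z $ j * cnj c else 0)"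
    unfolding herm_def by (rule sum.cong) (auto simp: axis_component)
  then show ?thesis by simp
qed

text \<open>In this form it is clear that surjective isometries preserve the radical.\<close>

lemma rad_iff: "x \<in> rad \<longleftrightarrow> (\<forall>y. H x y = 0)"
proof
  assume *: "\<forall>y. H x y = 0"
  have "fst x = 0" using *[rule_format, of pinf] by (simp add: H_pinf)
  moreover have "snd (snd x) = 0" using *[rule_format, of "(1, 0, 0)"] by (simp add: H_def)
  moreover have "fst (snd x) $ j = 0" if "eps j \<noteq> 0" for j
    using *[rule_format, of "(0, axis j 1, 0)"] that by (simp add: H_def herm_axis)
  ultimately show "x \<in> rad" by (simp add: rad_def)
qed (simp add: rad_H)

definition isom :: "('n homog \<Rightarrow> 'n homog) \<Rightarrow> bool" where
  "isom G \<longleftrightarrow> clin G \<and> bij G \<and> (\<forall>x y. H (G x) (G y) = H x y)"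

lemma isomD:
  assumes "isom G"
  shows "clin G" "bij G" "inj G" "H (G x) (G y) = H x y"
  using assms by (auto simp: isom_def bij_is_inj)

lemma isom_inv: assumes "isom G" shows "isom (inv G)"
proof -
  have "H (inv G x) (inv G y) = H x y" for x y
    using isomD(4)[OF assms, of "inv G x" "inv G y"] isomD(2)[OF assms]
    by (simp add: bij_is_surj surj_f_inv_f)
  then show ?thesis using isomD(1,2)[OF assms] by (simp add: isom_def clin_inv bij_imp_bij_inv)
qed

lemma isom_comp: "isom F \<Longrightarrow> isom G \<Longrightarrow> isom (F \<circ> G)"
  by (simp add: isom_def clin_comp bij_comp)

lemma isom_ncone: assumes "isom G" shows "G x \<in> ncone \<longleftrightarrow> x \<in> ncone"
proof -
  have "G x \<in> rad \<longleftrightarrow> x \<in> rad"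
    unfolding rad_iff using isomD(4)[OF assms] bij_is_surj[OF isomD(2)[OF assms]] by (metis surjD)
  then show ?thesis by (simp add: ncone_def isomD(4)[OF assms])
qed

lemma pmap_isom: "isom G \<Longrightarrow> x \<in> ncone \<Longrightarrow> pmap G (proj x) = proj (G x)"
  by (simp add: pmap_proj isomD ncone_nonzero)

lemma lifts_cong:
  assumes "lifts f" "\<And>p. p \<in> M \<Longrightarrow> f p = g p"
  shows "lifts g"
  unfolding lifts_def
proof (intro allI impI)
  fix u v t\<^sub>0 and e :: real
  assume e: "e > 0" and cone: "\<forall>t\<in>ball t\<^sub>0 e. u + hscale t v \<in> ncone"
  obtain \<delta> y where \<delta>: "\<delta> > 0" "\<delta> \<le> e" "cderiv_on (ball t\<^sub>0 \<delta>) y"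
    "\<And>t. t \<in> ball t\<^sub>0 \<delta> \<Longrightarrow> y t \<in> ncone \<and> f (proj (u + hscale t v)) = proj (y t)"
    using liftsD[OF assms(1) e] cone by metis
  have "g (proj (u + hscale t v)) = proj (y t)" if t: "t \<in> ball t\<^sub>0 \<delta>" for t
  proof -
    have "u + hscale t v \<in> ncone" using cone t \<delta>(2) by auto
    then have "proj (u + hscale t v) \<in> M" by (simp add: M_def)
    then show ?thesis using assms(2) \<delta>(4)[OF t] by metis
  qed
  then show "\<exists>\<delta> y. \<delta> > 0 \<and> \<delta> \<le> e \<and> cderiv_on (ball t\<^sub>0 \<delta>) y \<and>
        (\<forall>t\<in>ball t\<^sub>0 \<delta>. y t \<in> ncone \<and> g (proj (u + hscale t v)) = proj (y t))"
    using \<delta> by blast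
qed

lemma lifts_isom_left:
  assumes "lifts f" "isom G"
  shows "lifts (pmap G \<circ> f)"
  unfolding lifts_def
proof (intro allI impI)
  fix u v t\<^sub>0 and e :: real
  assume e: "e > 0" and cone: "\<forall>t\<in>ball t\<^sub>0 e. u + hscale t v \<in> ncone"
  obtain \<delta> y where \<delta>: "\<delta> > 0" "\<delta> \<le> e" "cderiv_on (ball t\<^sub>0 \<delta>) y"
    "\<And>t. t \<in> ball t\<^sub>0 \<delta> \<Longrightarrow> y t \<in> ncone \<and> f (proj (u + hscale t v)) = proj (y t)"
    using liftsD[OF assms(1) e] cone by metis
  show "\<exists>\<delta> y. \<delta> > 0 \<and> \<delta> \<le> e \<and> cderiv_on (ball t\<^sub>0 \<delta>) y \<and>
        (\<forall>t\<in>ball t\<^sub>0 \<delta>. y t \<in> ncone \<and> (pmap G \<circ> f) (proj (u + hscale t v)) = proj (y t))"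
  proof (intro exI conjI)
    show "cderiv_on (ball t\<^sub>0 \<delta>) (\<lambda>t. G (y t))" by (rule cderiv_on_clin[OF \<delta>(3) isomD(1)[OF assms(2)]])
    show "\<forall>t\<in>ball t\<^sub>0 \<delta>. G (y t) \<in> ncone \<and> (pmap G \<circ> f) (proj (u + hscale t v)) = proj (G (y t))"
      using \<delta>(4) by (simp add: isom_ncone[OF assms(2)] pmap_isom[OF assms(2)])
  qed (use \<delta> in auto)
qed

lemma lifts_isom_right:
  assumes "lifts f" "isom G"
  shows "lifts (f \<circ> pmap G)"
  unfolding lifts_def
proof (intro allI impI)
  fix u v t\<^sub>0 and e :: real
  assume e: "e > 0" and cone: "\<forall>t\<in>ball t\<^sub>0 e. u + hscale t v \<in> ncone"
  have G: "G (u + hscale t v) = G u + hscale t (G v)" for t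
    by (simp add: clin_add clin_hscale isomD(1)[OF assms(2)])
  have "\<And>t. t \<in> ball t\<^sub>0 e \<Longrightarrow> G u + hscale t (G v) \<in> ncone"
    using cone isom_ncone[OF assms(2)] unfolding G[symmetric] by blast
  from liftsD[OF assms(1) e this]
  obtain \<delta> y where \<delta>: "\<delta> > 0" "\<delta> \<le> e" "cderiv_on (ball t\<^sub>0 \<delta>) y"
    "\<And>t. t \<in> ball t\<^sub>0 \<delta> \<Longrightarrow> y t \<in> ncone \<and> f (proj (G u + hscale t (G v))) = proj (y t)" by blast
  have "(f \<circ> pmap G) (proj (u + hscale t v)) = proj (y t)" if t: "t \<in> ball t\<^sub>0 \<delta>" for t
  proof -
    have "u + hscale t v \<in> ncone" using cone t \<delta>(2) by auto
    then show ?thesis using \<delta>(4)[OF t] by (simp add: pmap_isom[OF assms(2)] G)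
  qed
  then show "\<exists>\<delta> y. \<delta> > 0 \<and> \<delta> \<le> e \<and> cderiv_on (ball t\<^sub>0 \<delta>) y \<and>
        (\<forall>t\<in>ball t\<^sub>0 \<delta>. y t \<in> ncone \<and> (f \<circ> pmap G) (proj (u + hscale t v)) = proj (y t))"
    using \<delta> by blast
qed

lemma good_inv:
  assumes "good f"
  shows "good (inv_into M f)"
proof -
  have bij: "bij_betw f M M" using assms by (simp add: good_def)
  have "lifts (inv_into M (inv_into M f))"
    by (rule lifts_cong[OF goodD(1)[OF assms]]) (simp add: inv_into_inv_into_eq[OF bij])
  then show ?thesis using assms by (simp add: good_def bij_betw_inv_into)
qed

lemma good_isom:
  assumes f: "good f" and G: "isom G"
  shows "good (pmap G \<circ> f)"
proof -
  have bij: "bij_betw f M M" using f by (simp add: good_def)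
  have GM: "pmap G p \<in> M" if "isom G" "p \<in> M" for G p
    using that(2) by (rule M_cases) (use that(1) in \<open>simp add: pmap_isom M_def isom_ncone\<close>)
  note G' = bij_pmap[OF isomD(1,2)[OF G]]
  have inv: "pmap (inv G) (pmap G p) = p" "pmap G (pmap (inv G) p) = p" for p
    using bij_is_inj[OF G'(1)] bij_is_surj[OF G'(1)] G'(2) by (metis inv_f_f, metis surj_f_inv_f)
  have bijG: "bij_betw (pmap G) M M"
    by (rule bij_betw_byWitness[of _ "pmap (inv G)"]) (use inv GM isom_inv G in auto)
  note bij' = bij_betw_trans[OF bij bijG]
  have "lifts (inv_into M (pmap G \<circ> f))"
  proof (rule lifts_cong[OF lifts_isom_right[OF goodD(2)[OF f] isom_inv[OF G]]])
    fix p assume p: "p \<in> M"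
    let ?q = "inv_into M f (pmap (inv G) p)"
    have "pmap (inv G) p \<in> M" using GM[OF isom_inv[OF G] p] .
    then have "?q \<in> M" "(pmap G \<circ> f) ?q = p" using goodD(4,5)[OF f] inv by auto
    then have "inv_into M (pmap G \<circ> f) p = ?q" using bij' by (metis bij_betw_inv_into_left)
    then show "(inv_into M f \<circ> pmap (inv G)) p = inv_into M (pmap G \<circ> f) p" by simp
  qed
  then show ?thesis using bij' lifts_isom_left[OF goodD(1)[OF f] G] by (simp add: good_def)
qed

section \<open>The inversion and the Heisenberg translations\<close>

definition swap :: "'n homog \<Rightarrow> 'n homog" where
  "swap x = (snd (snd x), fst (snd x), - fst x)"

text \<open>Heisenberg translation: on the affine part z goes to z + a, and the change of w is the
  one that keeps the imaginary part of w equal to the form, up to a real shift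
  \<open>r\<close>.\<close>

definition heis :: "complex ^ 'n \<Rightarrow> real \<Rightarrow> 'n homog \<Rightarrow> 'n homog" where
  "heis a r x = (fst x, fst (snd x) + fst x *s a,
     snd (snd x) + 2 * \<i> * herm (fst (snd x)) a + (\<i> * herm a a + of_real r) * fst x)"

lemma isom_swap: "isom swap"
proof -
  have "clin swap" unfolding clin_def by (auto intro!: homog_eqI simp: swap_def algebra_simps)
  moreover have "bij swap"
    by (rule o_bij[of "\<lambda>x. (- snd (snd x), fst (snd x), fst x)"]) (auto simp: fun_eq_iff swap_def)
  moreover have "H (swap x) (swap y) = H x y" for x y
    by (simp add: H_def swap_def field_simps)
  ultimately show ?thesis by (simp add: isom_def)
qed

lemma isom_heis: "isom (heis a r)"
proof -
  have real: "cnj (herm a a) = herm a a" using herm_cnj[of a a] by simp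
  have "clin (heis a r)" for a r
    unfolding clin_def by (auto intro!: homog_eqI simp: heis_def herm_add herm_scale algebra_simps)
  moreover have "heis (- a) (- r) (heis a r x) = x" for a r x
    by (rule homog_eqI) (simp_all add: heis_def herm_add herm_scale herm_minus algebra_simps)
  from this[of a r] this[of "- a" "- r"] have "bij (heis a r)"
    by (intro o_bij[of "heis (- a) (- r)"]) (simp_all add: fun_eq_iff)
  moreover have "H (heis a r x) (heis a r y) = H x y" for x y
    using real herm_cnj[of a "fst (snd y)"]
    by (simp add: H_def heis_def herm_add herm_scale field_simps)
  ultimately show ?thesis by (simp add: isom_def)
qed

text \<open>A finite point is translated to the origin and then inverted. A point at infinity with
  nonzero w becomes finite under the inversion. If \<zeta> and w both vanish, some z-coordinate
  outside the radical does not, and a translation along that axis makes w nonzero.\<close>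

lemma isom_to_infinity:
  assumes "y \<in> ncone"
  obtains G where "isom G" "fst (G y) = 0" "\<And>j. eps j \<noteq> 0 \<Longrightarrow> fst (snd (G y)) $ j = 0"
proof -
  define P where "P y \<longleftrightarrow> (\<exists>G. isom G \<and> fst (G y) = 0 \<and> fst (snd (G y)) = 0)" for y
  have comp: "P y" if "P (G y)" "isom G" for y G
    using that isom_comp unfolding P_def by (metis comp_apply)
  have 1: "P y" if y: "y \<in> ncone" "fst y \<noteq> 0" for y
  proof (rule comp[OF _ isom_heis])
    let ?a = "- inverse (fst y) *s fst (snd y)"
    let ?y = "heis ?a 0 y"
    have z: "fst (snd ?y) = 0" "fst ?y = fst y" using y(2) by (simp_all add: heis_def vec_eq_iff)
    have "?y \<in> ncone" using isom_ncone[OF isom_heis] y(1) by blast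
    then have "snd (snd ?y) * cnj (fst y) = fst y * cnj (snd (snd ?y))"
      using z by (simp add: ncone_def H_def)
    then have "snd (snd ?y) / fst y = cnj (snd (snd ?y) / fst y)" using y(2) by (simp add: field_simps)
    then obtain r where r: "snd (snd ?y) / fst y = of_real r" by (metis Reals_cnj_iff Reals_cases)
    have "isom (swap \<circ> heis 0 (- r))" by (intro isom_comp isom_swap isom_heis)
    moreover have "fst ((swap \<circ> heis 0 (- r)) ?y) = 0" "fst (snd ((swap \<circ> heis 0 (- r)) ?y)) = 0"
      using z r y(2) by (simp_all add: swap_def heis_def[of 0] field_simps)
    ultimately show "P ?y" unfolding P_def by blast
  qed
  have 2: "P y" if y: "y \<in> ncone" "snd (snd y) \<noteq> 0" for y
  proof (rule comp[OF 1 isom_swap])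
    show "swap y \<in> ncone" using isom_ncone[OF isom_swap] y(1) by blast
    show "fst (swap y) \<noteq> 0" using y(2) by (simp add: swap_def)
  qed
  have "P y"
  proof (cases "fst y = 0 \<and> snd (snd y) = 0")
    case True
    then obtain j where j: "eps j \<noteq> 0" "fst (snd y) $ j \<noteq> 0" using assms by (auto simp: ncone_def rad_def)
    show ?thesis
    proof (rule comp[OF 2 isom_heis])
      show "heis (axis j 1) 0 y \<in> ncone" using isom_ncone[OF isom_heis] assms by blast
      show "snd (snd (heis (axis j 1) 0 y)) \<noteq> 0" using True j by (simp add: heis_def herm_axis)
    qed
  qed (use 1 2 assms in blast)
  then show thesis using that unfolding P_def by auto
qed

end

section \<open>Null directions of an indefinite form\<close>

locale indefinite_quadric = hermitian_quadric eps for eps :: "'n::finite \<Rightarrow> real" +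
  assumes eps_pos: "\<exists>j. eps j = 1" and eps_neg: "\<exists>j. eps j = -1"
begin

definition rad0 :: "complex ^ 'n \<Rightarrow> bool" where
  "rad0 z \<longleftrightarrow> (\<forall>j. eps j \<noteq> 0 \<longrightarrow> z $ j = 0)"

definition nulldir :: "(complex ^ 'n) set" where
  "nulldir = {v. herm v v = 0 \<and> \<not> rad0 v}"

lemma rad0_herm: "rad0 z \<Longrightarrow> herm z y = 0" "rad0 z \<Longrightarrow> herm y z = 0"
  by (auto simp: rad0_def herm_def intro!: sum.neutral)

lemma rad0_diff: "rad0 y \<Longrightarrow> rad0 z \<Longrightarrow> rad0 (y - z)"
  and rad0_0 [simp]: "rad0 0"
  by (auto simp: rad0_def)

lemma rad0_scale_iff: "rad0 (c *s z) \<longleftrightarrow> c = 0 \<or> rad0 z"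
  by (auto simp: rad0_def)

lemma nulldir_scale: "v \<in> nulldir \<Longrightarrow> c \<noteq> 0 \<Longrightarrow> c *s v \<in> nulldir"
  by (simp add: nulldir_def herm_scale rad0_scale_iff)

text \<open>Take the sum and the difference of two unit vectors of opposite sign; the coordinate of
  the positive one in \<open>a *s u + b *s v\<close> is \<open>a + b\<close>, whence the last
  clause.\<close>

lemma hyperbolic_pair:
  obtains u v where "u \<in> nulldir" "v \<in> nulldir" "herm u v = 2"
    "\<And>a b. a \<noteq> - b \<Longrightarrow> \<not> rad0 (a *s u + b *s v)"
proof -
  obtain i j where ij: "eps i = 1" "eps j = -1" using eps_pos eps_neg by blast
  then have ne: "i \<noteq> j" by auto
  show thesis
  proof (rule that[of "axis i 1 + axis j 1" "axis i 1 - axis j 1"])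
    show "axis i 1 + axis j 1 \<in> nulldir" "axis i 1 - axis j 1 \<in> nulldir" "herm (axis i 1 + axis j 1) (axis i 1 - axis j 1) = 2"
      using ij ne by (auto simp: nulldir_def herm_add herm_diff herm_axis rad0_def axis_component intro!: exI[of _ i])
    show "\<not> rad0 (a *s (axis i 1 + axis j 1) + b *s (axis i 1 - axis j 1))" if "a \<noteq> - b" for a b
      using ij ne that unfolding rad0_def by (auto simp: axis_component add_eq_0_iff intro!: exI[of _ i])
  qed
qed

text \<open>An induction principle: null directions span additively. A multiple of a unit vector of
  nonzero sign is the mean of its sum and its difference with an equal multiple of a unit vector of
  opposite sign, both null. One of sign zero may be added to any null vector \<open>u\<close> and
  \<open>u\<close> be subtracted again.\<close>

lemma nulldir_gen:
  assumes P0: "P 0" and add: "\<And>v y. v \<in> nulldir \<Longrightarrow> P y \<Longrightarrow> P (y + v)"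
  shows "P z"
proof -
  obtain p q where pq: "eps p = 1" "eps q = -1" using eps_pos eps_neg by blast
  then have ne: "p \<noteq> q" by auto
  have pair: "axis p a + axis q b \<in> nulldir" if "cmod a = cmod b" "a \<noteq> 0" for a b
  proof -
    have "a * cnj a = b * cnj b" using that(1) by (simp add: complex_norm_square[symmetric])
    then show ?thesis
      using pq ne that(2) by (auto simp: nulldir_def herm_add herm_axis rad0_def axis_component intro!: exI[of _ p])
  qed
  have zero: "axis i c + v \<in> nulldir" if "eps i = 0" "v \<in> nulldir" for i c v
  proof -
    have "rad0 (axis i c)" using that(1) by (auto simp: rad0_def axis_component)
    then show ?thesis
      using that(2) rad0_diff[of "axis i c + v" "axis i c"] by (auto simp: nulldir_def herm_add rad0_herm)
  qed
  have same: "axis i c + axis j c \<in> nulldir \<and> axis i c - axis j c \<in> nulldir"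
    if "eps i = 1" "eps j = -1" "c \<noteq> 0" for i j c
    using that by (auto simp: nulldir_def herm_add herm_diff herm_axis rad0_def axis_component intro!: exI[of _ i] split: if_splits)
  have step: "P (y + axis i c)" if y: "P y" for y i c
  proof (cases "c = 0")
    case True
    then have "axis i c = 0" by (simp add: axis_component vec_eq_iff)
    then show ?thesis using y by (metis add.right_neutral)
  next
    case False
    have sum2: "P (y + u)" if "v \<in> nulldir" "v' \<in> nulldir" "u = v + v'" for u v v'
      using add[OF that(2) add[OF that(1) y]] that(3) by (simp add: add.assoc)
    have half: "axis i c = axis i (c / 2) + axis i (c / 2)"
      by (auto simp: vec_eq_iff axis_component)
    consider "eps i = 0" | "eps i = 1" | "eps i = -1" using eps_values by blast
    then show ?thesis
    proof cases
      case 1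
      obtain u where u: "u \<in> nulldir" using hyperbolic_pair by metis
      have "- u \<in> nulldir" using nulldir_scale[OF u, of "- 1"] by simp
      then show ?thesis by (rule sum2[OF zero[OF 1 u, of c], of "- u"]) simp
    next
      case 2
      note s = same[OF 2 pq(2), of "c / 2"]
      show ?thesis by (rule sum2[of "axis i (c / 2) + axis q (c / 2)" "axis i (c / 2) - axis q (c / 2)"])
          (use s half False in auto)
    next
      case 3
      note s = same[OF pq(1) 3, of "c / 2"]
      have "- 1 *s (axis p (c / 2) - axis i (c / 2)) \<in> nulldir"
        using s False by (intro nulldir_scale) auto
      then have m: "axis i (c / 2) - axis p (c / 2) \<in> nulldir" by simp
      show ?thesis by (rule sum2[of "axis p (c / 2) + axis i (c / 2)" "axis i (c / 2) - axis p (c / 2)"])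
          (use s m half False in auto)
    qed
  qed
  have "P (\<Sum>i\<in>I. axis i (z $ i))" if "finite I" for I
    using that
  proof induction
    case (insert i I)
    then show ?case using step[of "\<Sum>i\<in>I. axis i (z $ i)" i "z $ i"] by (simp add: add.commute)
  qed (simp add: P0)
  moreover have "z = (\<Sum>i\<in>UNIV. axis i (z $ i))"
    by (simp add: vec_eq_iff axis_component if_distrib[of "\<lambda>f. f _"] sum.delta cong: if_cong)
  ultimately show ?thesis by (metis finite)
qed

text \<open>With \<open>b = \<i> * herm u v\<close> the cross terms of \<open>u + r b v\<close>
  cancel for every real \<open>r\<close>; if \<open>herm u v = 0\<close>, any \<open>b\<close> will
  do. The vectors for \<open>r = 1\<close> and \<open>r = 2\<close> differ by \<open>b *s v\<close>,
  so they are not both in the radical.\<close>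

lemma nulldir_third:
  assumes "u \<in> nulldir" "v \<in> nulldir"
  shows "\<exists>a b. a \<noteq> 0 \<and> b \<noteq> 0 \<and> a *s u + b *s v \<in> nulldir"
proof -
  define b where "b = (if herm u v = 0 then 1 else \<i> * herm u v)"
  have b: "b \<noteq> 0" by (simp add: b_def)
  have null: "herm (1 *s u + (of_real r * b) *s v) (1 *s u + (of_real r * b) *s v) = 0" for r
    using assms herm_cnj[of u v] by (simp add: nulldir_def herm_add herm_scale b_def algebra_simps)
  have "\<not> (rad0 (1 *s u + (of_real 1 * b) *s v) \<and> rad0 (1 *s u + (of_real 2 * b) *s v))"
  proof
    assume "rad0 (1 *s u + (of_real 1 * b) *s v) \<and> rad0 (1 *s u + (of_real 2 * b) *s v)"
    then have "rad0 ((1 *s u + (of_real 2 * b) *s v) - (1 *s u + (of_real 1 * b) *s v))"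
      by (intro rad0_diff) auto
    moreover have "(1 *s u + (of_real 2 * b) *s v) - (1 *s u + (of_real 1 * b) *s v) = b *s v"
      by (simp add: vec_eq_iff algebra_simps)
    ultimately show False using b assms(2) by (simp add: rad0_scale_iff nulldir_def)
  qed
  then have "1 *s u + (of_real 1 * b) *s v \<in> nulldir \<or> 1 *s u + (of_real 2 * b) *s v \<in> nulldir"
    using null[of 1] null[of 2] by (auto simp: nulldir_def)
  then show ?thesis
    using b by (metis mult_eq_0_iff of_real_eq_0_iff zero_neq_numeral zero_neq_one)
qed

lemma herm_nondegenerate:
  assumes "\<And>v. v \<in> nulldir \<Longrightarrow> herm v z = 0"
  shows "rad0 z"
proof -
  have "herm y z = 0" for y
    by (rule nulldir_gen[of "\<lambda>y. herm y z = 0"]) (simp_all add: herm_add assms)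
  then have "herm z (axis j 1) = 0" for j by (metis herm_cnj complex_cnj_zero_iff)
  then show ?thesis by (auto simp: rad0_def herm_axis)
qed

text \<open>If \<open>E\<close> were independent of \<open>D\<close>, some \<open>h\<close> would satisfy \<open>herm h D = 0\<close>, \<open>herm h E = 1\<close>,
  and adding a multiple of \<open>E\<close> would make it null.\<close>

lemma nulldir_double_perp:
  assumes D: "D \<in> nulldir" and E: "herm E E = 0" "herm D E = 0"
    and perp: "\<And>u. u \<in> nulldir \<Longrightarrow> herm u D = 0 \<Longrightarrow> herm u E = 0"
  shows "\<exists>c. rad0 (E - c *s D)"
proof -
  obtain i where i: "eps i \<noteq> 0" "D $ i \<noteq> 0" using D by (auto simp: nulldir_def rad0_def)
  have "E $ j * D $ i = E $ i * D $ j" if j: "eps j \<noteq> 0" for j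
  proof (rule ccontr)
    assume ne: "E $ j * D $ i \<noteq> E $ i * D $ j"
    define \<Delta> where "\<Delta> = cnj (E $ j * D $ i - E $ i * D $ j)"
    have \<Delta>: "\<Delta> \<noteq> 0" using ne unfolding \<Delta>_def complex_cnj_zero_iff by simp
    have ij: "i \<noteq> j" using ne by auto
    \<comment> \<open>Cramer's rule for \<open>herm h D = 0\<close>, \<open>herm h E = 1\<close> in
      the coordinates \<open>i\<close> and \<open>j\<close>, with \<open>\<Delta>\<close> the
      conjugated determinant; the signs cancel those in \<open>herm\<close>.\<close>
    define h where "h = axis j (of_real (eps j) * cnj (D $ i) / \<Delta>) - axis i (of_real (eps i) * cnj (D $ j) / \<Delta>)"
    have eps2: "complex_of_real (eps l) * complex_of_real (eps l) = 1" if "eps l \<noteq> 0" for l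
      using eps_values[of l] that by auto
    have axis_left: "herm (axis l c) y = of_real (eps l) * c * cnj (y $ l)" for l c y
      using herm_cnj[of "axis l c" y] by (simp add: herm_axis mult_ac)
    have h1: "herm h D = 0" "herm h E = 1"
      using eps2[OF i(1)] eps2[OF j] \<Delta>
      by (simp_all add: h_def herm_diff axis_left divide_simps mult.assoc[symmetric])
        (simp_all add: \<Delta>_def algebra_simps)
    \<comment> \<open>Since \<open>herm h E = 1\<close> and \<open>b\<close> is real, adding
      \<open>b *s E\<close> changes \<open>herm h h\<close> by \<open>2 * b\<close>.\<close>
    define b where "b = - herm h h / 2"
    have b: "cnj b = b" using herm_cnj[of h h] by (simp add: b_def)
    define u where "u = h + b *s E"
    have "herm D h = 0" "herm E h = 1" using h1 herm_cnj[of D h] herm_cnj[of E h] by simp_all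
    have hE: "herm E D = 0" using E(2) herm_cnj[of E D] by simp
    have u: "herm u D = 0" "herm u E = 1" "herm u u = 0"
      using h1 E hE b \<open>herm E h = 1\<close> by (simp_all add: u_def herm_add herm_scale) (simp add: b_def)
    have "u \<in> nulldir" using u rad0_herm(1)[of u E] by (auto simp: nulldir_def)
    then show False using perp u by auto
  qed
  then have "rad0 (E - (E $ i / D $ i) *s D)" using i(2) by (auto simp: rad0_def field_simps)
  then show ?thesis by blast
qed

end

section \<open>The indefinite case\<close>

text \<open>\<open>infinity\<close> says that \<open>f\<close> preserves the hyperplane at infinity.
  As the orthogonal complement of \<open>pinf\<close>, that hyperplane is under control once an
  isometry has moved the image of \<open>pinf\<close> back to infinity.\<close>

locale normalised_map = indefinite_quadric eps for eps :: "'n::finite \<Rightarrow> real" +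
  fixes f :: "'n cproj \<Rightarrow> 'n cproj"
  assumes good: "good f"
    and infinity: "\<And>x y. x \<in> ncone \<Longrightarrow> y \<in> ncone \<Longrightarrow> f (proj x) = proj y \<Longrightarrow> fst y = 0 \<longleftrightarrow> fst x = 0"
begin

lemma image_rep:
  assumes "x \<in> ncone"
  obtains y where "y \<in> ncone" "f (proj x) = proj y" "fst y = 0 \<longleftrightarrow> fst x = 0"
proof -
  obtain y where "y \<in> ncone" "f (proj x) = proj y" using good_image_rep[OF good assms] .
  then show thesis using that infinity assms by blast
qed

lemma preimage_rep:
  assumes "y \<in> ncone"
  obtains x where "x \<in> ncone" "f (proj x) = proj y" "fst y = 0 \<longleftrightarrow> fst x = 0"
proof -
  have yM: "proj y \<in> M" using assms by (simp add: M_def)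
  have "inv_into M f (proj y) \<in> M" using goodD(4)[OF good yM] .
  then obtain x where "x \<in> ncone" "inv_into M f (proj y) = proj x" by (rule M_cases)
  then have "x \<in> ncone" "f (proj x) = proj y" using goodD(5)[OF good yM] by simp_all
  then show thesis using that infinity assms by blast
qed

lemmas image_H = good_image_H[OF good]

section \<open>The affine part of the quadric and its null lines\<close>

definition aff :: "'n homog set" where
  "aff = {x \<in> ncone. fst x = 1}"

definition af :: "'n homog \<Rightarrow> 'n homog" where
  "af x = hscale (inverse (fst (rep_cproj (f (proj x))))) (rep_cproj (f (proj x)))"

text \<open>For \<open>d\<close> in \<open>Dir\<close> and \<open>H x d = 0\<close>, the line
  \<open>x + hscale t d\<close> is a null line of the quadric, and \<open>proj d\<close> is its
  point at infinity.\<close>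

definition Dir :: "'n homog set" where
  "Dir = {d. fst d = 0 \<and> fst (snd d) \<in> nulldir}"

lemma affI: "fst x = 1 \<Longrightarrow> H x x = 0 \<Longrightarrow> x \<in> aff"
  by (simp add: aff_def ncone_def rad_def)

lemma affD: "x \<in> aff \<Longrightarrow> x \<in> ncone" "x \<in> aff \<Longrightarrow> fst x = 1" "x \<in> aff \<Longrightarrow> H x x = 0"
  by (simp_all add: aff_def ncone_def)

lemma aff_normalise: "x \<in> ncone \<Longrightarrow> fst x \<noteq> 0 \<Longrightarrow> hscale (inverse (fst x)) x \<in> aff"
  by (simp add: aff_def ncone_hscale)

lemma af_eq:
  assumes "x \<in> aff" "y \<in> ncone" "f (proj x) = proj y"
  shows "af x = hscale (inverse (fst y)) y"
proof -
  let ?r = "rep_cproj (f (proj x))"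
  obtain c where c: "c \<noteq> 0" "?r = hscale c y"
    using proj_eqD[OF ncone_nonzero[OF assms(2)] rep_cproj_nonzero] assms(3) proj_rep_cproj by metis
  have "fst y \<noteq> 0" using infinity[OF affD(1)[OF assms(1)] assms(2,3)] affD(2)[OF assms(1)] by simp
  then show ?thesis using c by (simp add: af_def hscale_hscale field_simps)
qed

lemma af_in_aff: "x \<in> aff \<Longrightarrow> af x \<in> aff" and proj_af: "x \<in> aff \<Longrightarrow> f (proj x) = proj (af x)"
proof -
  assume x: "x \<in> aff"
  obtain y where y: "y \<in> ncone" "f (proj x) = proj y" "fst y = 0 \<longleftrightarrow> fst x = 0"
    using image_rep[OF affD(1)[OF x]] .
  then have y0: "fst y \<noteq> 0" using affD(2)[OF x] by simp
  show "af x \<in> aff" using af_eq[OF x y(1,2)] aff_normalise[OF y(1) y0] by simp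
  show "f (proj x) = proj (af x)" using af_eq[OF x y(1,2)] y y0 by (simp add: proj_hscale ncone_nonzero)
qed

lemma H_at_infinity: "fst d = 0 \<Longrightarrow> fst e = 0 \<Longrightarrow> H d e = - herm (fst (snd d)) (fst (snd e))"
  by (simp add: H_def)

lemma Dir_ncone: "d \<in> Dir \<Longrightarrow> d \<in> ncone"
  by (auto simp: Dir_def ncone_def H_at_infinity nulldir_def rad_def rad0_def)

lemma DirI: "d \<in> ncone \<Longrightarrow> fst d = 0 \<Longrightarrow> \<not> rad0 (fst (snd d)) \<Longrightarrow> d \<in> Dir"
  by (simp add: Dir_def nulldir_def ncone_def H_at_infinity)

text \<open>\<open>H d x = 0\<close> is complex tangency at \<open>x\<close>; it determines the
  w-part of a direction from its z-part.\<close>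

lemma Dir_perp_exists:
  assumes "fst x = 1" "v \<in> nulldir"
  obtains d where "d \<in> Dir" "fst (snd d) = v" "H x d = 0" "H d x = 0"
proof (rule that)
  let ?d = "(0, v, 2 * \<i> * herm v (fst (snd x)))"
  show "?d \<in> Dir" "fst (snd ?d) = v" using assms(2) by (simp_all add: Dir_def)
  show "H ?d x = 0" using assms(1) by (simp add: H_def)
  then show "H x ?d = 0" by (simp add: H_eq_0_commute)
qed

lemma aff_line: "x \<in> aff \<Longrightarrow> d \<in> Dir \<Longrightarrow> H x d = 0 \<Longrightarrow> x + hscale t d \<in> aff"
  using H_eq_0_commute[of x d] Dir_ncone[of d]
  by (intro affI) (simp_all add: affD Dir_def H_add H_hscale ncone_def)

text \<open>Encodes equality of z-parts modulo the radical by orthogonality to points at infinity, a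
  relation that \<open>f\<close> preserves in both directions; this is what transfers it to
  \<open>af\<close>.\<close>

lemma same_base_iff:
  assumes "x \<in> aff" "y \<in> aff"
  shows "rad0 (fst (snd x) - fst (snd y)) \<longleftrightarrow> (\<forall>d\<in>ncone. fst d = 0 \<longrightarrow> (H x d = 0 \<longleftrightarrow> H y d = 0))"
proof
  have H: "H x d - H y d = - herm (fst (snd x) - fst (snd y)) (fst (snd d))" if "fst d = 0" for d
    using that affD(2)[OF assms(1)] affD(2)[OF assms(2)] by (simp add: H_def herm_diff)
  show "\<forall>d\<in>ncone. fst d = 0 \<longrightarrow> (H x d = 0 \<longleftrightarrow> H y d = 0)" if "rad0 (fst (snd x) - fst (snd y))"
    using H rad0_herm(1)[OF that] by fastforce
  assume *: "\<forall>d\<in>ncone. fst d = 0 \<longrightarrow> (H x d = 0 \<longleftrightarrow> H y d = 0)"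
  have "herm v (fst (snd x) - fst (snd y)) = 0" if v: "v \<in> nulldir" for v
  proof -
    obtain d where d: "d \<in> Dir" "fst (snd d) = v" "H x d = 0"
      using Dir_perp_exists[OF affD(2)[OF assms(1)] v] by blast
    then have d0: "fst d = 0" by (simp add: Dir_def)
    then have "H y d = 0" using * d Dir_ncone by blast
    then have "herm (fst (snd x) - fst (snd y)) v = 0" using H[OF d0] d by simp
    then show ?thesis using herm_cnj[of v] by simp
  qed
  then show "rad0 (fst (snd x) - fst (snd y))" by (rule herm_nondegenerate)
qed

lemma af_same_base:
  assumes "x \<in> aff" "y \<in> aff"
  shows "rad0 (fst (snd (af x)) - fst (snd (af y))) \<longleftrightarrow> rad0 (fst (snd x) - fst (snd y))"
proof -
  have im: "H (af x) d' = 0 \<longleftrightarrow> H x d = 0"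
    if "x \<in> aff" "d \<in> ncone" "d' \<in> ncone" "f (proj d) = proj d'" for x d d'
    using image_H[OF affD(1)[OF that(1)] that(2) affD(1)[OF af_in_aff[OF that(1)]] that(3) proj_af[OF that(1)] that(4)] .
  have "(\<forall>d\<in>ncone. fst d = 0 \<longrightarrow> (H (af x) d = 0 \<longleftrightarrow> H (af y) d = 0)) \<longleftrightarrow>
    (\<forall>d\<in>ncone. fst d = 0 \<longrightarrow> (H x d = 0 \<longleftrightarrow> H y d = 0))"
  proof (rule iffI; intro ballI impI)
    fix d assume *: "\<forall>d\<in>ncone. fst d = 0 \<longrightarrow> (H (af x) d = 0 \<longleftrightarrow> H (af y) d = 0)" and d: "d \<in> ncone" "fst d = 0"
    obtain d' where d': "d' \<in> ncone" "f (proj d) = proj d'" "fst d' = 0 \<longleftrightarrow> fst d = 0"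
      using image_rep[OF d(1)] .
    then show "H x d = 0 \<longleftrightarrow> H y d = 0" using * d im[OF assms(1) d(1) d'(1,2)] im[OF assms(2) d(1) d'(1,2)] by blast
  next
    fix d' assume *: "\<forall>d\<in>ncone. fst d = 0 \<longrightarrow> (H x d = 0 \<longleftrightarrow> H y d = 0)" and d': "d' \<in> ncone" "fst d' = 0"
    obtain d where d: "d \<in> ncone" "f (proj d) = proj d'" "fst d' = 0 \<longleftrightarrow> fst d = 0"
      using preimage_rep[OF d'(1)] .
    then show "H (af x) d' = 0 \<longleftrightarrow> H (af y) d' = 0"
      using * d' im[OF assms(1) d(1) d'(1) d(2)] im[OF assms(2) d(1) d'(1) d(2)] by blast
  qed
  then show ?thesis using same_base_iff assms af_in_aff by simp
qed

text \<open>An image with radical z-part would be orthogonal to every point at infinity. Pulled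
  back, \<open>d\<close> would be orthogonal to all null directions, so its own z-part would be
  radical.\<close>

lemma Dir_image:
  assumes d: "d \<in> Dir" and d': "d' \<in> ncone" "f (proj d) = proj d'"
  shows "d' \<in> Dir"
proof (rule DirI[OF d'(1)])
  have d0: "d \<in> ncone" "fst d = 0" using d Dir_ncone by (auto simp: Dir_def)
  show d'0: "fst d' = 0" using infinity[OF d0(1) d'] d0(2) by simp
  show "\<not> rad0 (fst (snd d'))"
  proof
    assume rad: "rad0 (fst (snd d'))"
    have "herm v (fst (snd d)) = 0" if v: "v \<in> nulldir" for v
    proof -
      define u :: "'n homog" where "u = (0, v, 0)"
      have u: "u \<in> Dir" "fst u = 0" "fst (snd u) = v" using v by (simp_all add: Dir_def u_def)
      obtain u' where u': "u' \<in> ncone" "f (proj u) = proj u'" "fst u' = 0 \<longleftrightarrow> fst u = 0"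
        using image_rep[OF Dir_ncone[OF u(1)]] .
      then have "H u' d' = 0" using u(2) d'0 rad0_herm(2)[OF rad] by (simp add: H_at_infinity)
      then have "H u d = 0"
        using image_H[OF Dir_ncone[OF u(1)] d0(1) u'(1) d'(1) u'(2) d'(2)] by simp
      then show ?thesis using d0(2) u by (simp add: H_at_infinity)
    qed
    then have "rad0 (fst (snd d))" by (rule herm_nondegenerate)
    then show False using d by (simp add: Dir_def nulldir_def)
  qed
qed

text \<open>Modulo the radical, the image of a null line is contained in a null line; this uses only that
  \<open>f\<close> preserves orthogonality.\<close>

lemma af_line_base:
  assumes x: "x \<in> aff" and d: "d \<in> Dir" "H x d = 0"
  defines "D \<equiv> fst (snd (af (x + d))) - fst (snd (af x))"
  shows "D \<in> nulldir" and "\<exists>c. rad0 (fst (snd (af (x + hscale t d))) - fst (snd (af x)) - c *s D)"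
proof -
  let ?l = "\<lambda>t. x + hscale t d"
  have l: "?l t \<in> aff" for t using aff_line[OF x d] .
  note a = af_in_aff[OF l]
  have d0: "fst d = 0" "\<not> rad0 (fst (snd d))" using d(1) by (auto simp: Dir_def nulldir_def)
  have Hdx: "H d x = 0" "H d d = 0" using d Dir_ncone by (auto simp: H_eq_0_commute ncone_def)
  have "H (?l s) (?l t) = 0" for s t
    using d Hdx affD(3)[OF x] by (simp add: H_add H_hscale)
  then have perp: "H (af (?l s)) (af (?l t)) = 0" for s t
    using image_H[OF affD(1)[OF l] affD(1)[OF l] affD(1)[OF a] affD(1)[OF a] proj_af[OF l] proj_af[OF l]] by blast
  have herm: "herm (fst (snd (af (?l s))) - fst (snd (af (?l 0)))) (fst (snd (af (?l t))) - fst (snd (af (?l 0)))) = 0" for s t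
    using H_at_infinity[of "af (?l s) - af (?l 0)" "af (?l t) - af (?l 0)"] affD(2)[OF a]
      perp[of s t] perp[of s 0] perp[of 0 t] perp[of 0 0] affD(2)[OF a[of 0]] by (simp add: H_diff)
  have l01: "?l 0 = x" "?l 1 = x + d" by simp_all
  have D': "D = fst (snd (af (?l 1))) - fst (snd (af (?l 0)))" by (simp add: D_def)
  have "\<not> rad0 D"
    using af_same_base[OF l[of 1] l[of 0]] d0(2) by (simp add: D_def)
  then show Dnull: "D \<in> nulldir" using herm[of 1 1] by (simp add: nulldir_def D')
  have "\<exists>c. rad0 ((fst (snd (af (?l t))) - fst (snd (af (?l 0)))) - c *s D)"
  proof (rule nulldir_double_perp[OF Dnull herm herm[of 1 t, folded D']])
    fix u assume u: "u \<in> nulldir" "herm u D = 0"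
    obtain d' where d': "d' \<in> Dir" "fst (snd d') = u" "H d' (af (?l 0)) = 0"
      using Dir_perp_exists[OF affD(2)[OF a] u(1)] by blast
    have d'0: "fst d' = 0" using d'(1) by (simp add: Dir_def)
    have diff: "H d' (af (?l t)) - H d' (af (?l 0)) = - herm u (fst (snd (af (?l t))) - fst (snd (af (?l 0))))" for t
      using d'0 d'(2) affD(2)[OF a] affD(2)[OF a[of 0]] by (simp add: H_def herm_diff)
    obtain d'' where d'': "d'' \<in> ncone" "f (proj d'') = proj d'"
      using preimage_rep[OF Dir_ncone[OF d'(1)]] by blast
    have iff: "H d' (af (?l t)) = 0 \<longleftrightarrow> H d'' (?l t) = 0" for t
      using image_H[OF d''(1) affD(1)[OF l] Dir_ncone[OF d'(1)] affD(1)[OF a] d''(2) proj_af[OF l]] .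
    have "H d' (af (?l 1)) = 0" using diff[of 1] u(2) d'(3) D' by simp
    then have "H d'' (?l 1) = 0" "H d'' (?l 0) = 0" using iff d'(3) by blast+
    then have "H d'' (?l t) = 0" by (simp add: H_add H_hscale)
    then have "H d' (af (?l t)) = 0" using iff by blast
    then show "herm u (fst (snd (af (?l t))) - fst (snd (af (?l 0)))) = 0" using diff[of t] d'(3) by simp
  qed
  then show "\<exists>c. rad0 (fst (snd (af (?l t))) - fst (snd (af x)) - c *s D)" by simp
qed

lemma af_line_holomorphic:
  assumes x: "x \<in> aff" and d: "d \<in> Dir" "H x d = 0"
  shows "(\<lambda>t. hcoord i (af (x + hscale t d))) holomorphic_on UNIV"
  unfolding holomorphic_on_def
proof
  fix t
  have l: "x + hscale t d \<in> aff" for t using aff_line[OF x d] .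
  obtain \<delta> y where \<delta>: "\<delta> > 0" "cderiv_on (ball t \<delta>) y"
    and y: "\<And>s. s \<in> ball t \<delta> \<Longrightarrow> y s \<in> ncone \<and> f (proj (x + hscale s d)) = proj (y s)"
    using liftsD[OF goodD(1)[OF good], of 1 t x d] affD(1)[OF l] by (metis zero_less_one)
  note hol = cderiv_on_hcoord[OF \<delta>(2) open_ball]
  have eq: "hcoord i (af (x + hscale s d)) = hcoord i (y s) / hcoord IZeta (y s)" if "s \<in> ball t \<delta>" for s
    using af_eq[OF l, of "y s" s] y[OF that] by (simp add: hcoord_hscale hcoord_simps(1) divide_inverse_commute)
  have nz: "hcoord IZeta (y s) \<noteq> 0" if "s \<in> ball t \<delta>" for s
    using infinity[OF affD(1)[OF l], of "y s" s] y[OF that] affD(2)[OF l] by (simp add: hcoord_simps(1))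
  have "(\<lambda>s. hcoord i (y s) / hcoord IZeta (y s)) holomorphic_on ball t \<delta>"
    using nz by (intro holomorphic_intros hol) auto
  then have "(\<lambda>s. hcoord i (af (x + hscale s d))) holomorphic_on ball t \<delta>"
    by (rule holomorphic_transform) (simp add: eq)
  then show "(\<lambda>t. hcoord i (af (x + hscale t d))) field_differentiable at t within UNIV"
    using \<delta>(1) holomorphic_on_imp_differentiable_at[OF _ open_ball, of _ t \<delta> t] by simp
qed

text \<open>The lift at the point at infinity of the line bounds the growth: its coordinate \<open>\<zeta>\<close>
  vanishes there, so the base coordinate grows at least linearly, hence exactly linearly since it
  is injective; all coordinates are comparable to it.\<close>

lemma af_line:
  assumes x: "x \<in> aff" and d: "d \<in> Dir" "H x d = 0"
  defines "e \<equiv> af (x + d) - af x"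
  shows "af (x + hscale t d) = af x + hscale t e" and "e \<in> Dir" and "f (proj d) = proj e"
proof -
  let ?l = "\<lambda>t. x + hscale t d" and ?a = "\<lambda>t. af (x + hscale t d)"
  have l: "?l t \<in> aff" for t using aff_line[OF x d] .
  note a = af_in_aff[OF l]
  have l01: "?l 0 = x" "?l 1 = x + d" by simp_all
  define D where "D = fst (snd (af (x + d))) - fst (snd (af x))"
  have Dnull: "D \<in> nulldir" unfolding D_def by (rule af_line_base[OF x d])
  have "fst e = 0" using affD(2)[OF a[of 0]] affD(2)[OF a[of 1]] by (simp add: e_def)
  then show eDir: "e \<in> Dir" using Dnull by (simp add: Dir_def e_def D_def)
  \<comment> \<open>The same line in the parameter \<open>s = inverse t\<close>;
    \<open>s = 0\<close> gives its point at infinity.\<close>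
  have cone0: "d + hscale s x \<in> ncone" for s
  proof (cases "s = 0")
    case False
    have "d + hscale s x = hscale s (?l (inverse s))" using False by (simp add: hscale_add_right hscale_hscale add.commute)
    then show ?thesis using affD(1)[OF l] False by (simp add: ncone_hscale)
  qed (use d Dir_ncone in simp)
  obtain \<delta> y where \<delta>: "\<delta> > 0" "cderiv_on (ball 0 \<delta>) y"
    and y: "\<And>s. s \<in> ball 0 \<delta> \<Longrightarrow> y s \<in> ncone \<and> f (proj (d + hscale s x)) = proj (y s)"
    using liftsD[OF goodD(1)[OF good], of 1 0 d x] cone0 by (metis zero_less_one)
  have y0: "y 0 \<in> Dir" using Dir_image[OF d(1), of "y 0"] y[of 0] \<delta>(1) by simp
  define lam where "lam s = fst (y s)" for s
  have ys: "y s = hscale (lam s) (?a (inverse s))" "lam s \<noteq> 0" if s: "s \<in> ball 0 \<delta>" "s \<noteq> 0" for s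
  proof -
    have "d + hscale s x = hscale s (?l (inverse s))" using s by (simp add: hscale_add_right hscale_hscale add.commute)
    then have "f (proj (?l (inverse s))) = proj (y s)"
      using y[OF s(1)] s(2) ncone_nonzero[OF affD(1)[OF l]] by (simp add: proj_hscale)
    note af_eq[OF l _ this] infinity[OF affD(1)[OF l] _ this]
    then show "y s = hscale (lam s) (?a (inverse s))" "lam s \<noteq> 0"
      using y[OF s(1)] affD(2)[OF l] by (simp_all add: lam_def hscale_hscale)
  qed
  have lam0: "lam 0 = 0" using y0 by (simp add: lam_def Dir_def)
  note hol = cderiv_on_hcoord[OF \<delta>(2) open_ball]
  have cont: "isCont (\<lambda>s. hcoord i (y s)) 0" for i
    using hol[of i] \<delta>(1) by (meson centre_in_ball continuous_on_eq_continuous_at holomorphic_on_imp_continuous_on open_ball)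
  obtain j where j: "eps j \<noteq> 0" "fst (snd (y 0)) $ j \<noteq> 0" using y0 by (auto simp: Dir_def nulldir_def rad0_def)
  define b where "b t = fst (snd (?a t)) $ j" for t
  define g where "g t = (b t - b 0) / D $ j" for t
  have base: "fst (snd (?a t)) $ i - fst (snd (?a 0)) $ i = c * D $ i"
    if "eps i \<noteq> 0" "rad0 (fst (snd (?a t)) - fst (snd (af x)) - c *s D)" for t i c
    using that by (simp add: rad0_def)
  \<comment> \<open>If \<open>D $ j\<close> were zero, \<open>b\<close> would be constant, so
    coordinate \<open>j\<close> of \<open>y s\<close> would be a constant times \<open>lam s\<close>
    and tend to 0; but it is nonzero at \<open>s = 0\<close>.\<close>
  have Dj: "D $ j \<noteq> 0"
  proof
    assume "D $ j = 0"
    then have const: "b t = b 0" for t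
      using base[OF j(1)] af_line_base(2)[OF x d, of t] unfolding D_def[symmetric] b_def by fastforce
    have "eventually (\<lambda>s. s \<in> ball 0 \<delta> - {0}) (at (0::complex))"
      using \<delta>(1) by (intro eventually_at_in_open) auto
    then have "eventually (\<lambda>s. hcoord (IZ j) (y s) = lam s * b 0) (at 0)"
    proof eventually_elim
      case (elim s)
      then show ?case using ys(1)[of s] const[of "inverse s"] by (simp add: hcoord_simps b_def)
    qed
    moreover have "((\<lambda>s. lam s * b 0) \<longlongrightarrow> 0 * b 0) (at 0)"
      using cont[of IZeta] lam0 by (intro tendsto_intros) (simp add: isCont_def hcoord_simps(1) lam_def)
    ultimately have "((\<lambda>s. hcoord (IZ j) (y s)) \<longlongrightarrow> 0) (at 0)"
      by (simp add: tendsto_cong)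
    moreover have "((\<lambda>s. hcoord (IZ j) (y s)) \<longlongrightarrow> hcoord (IZ j) (y 0)) (at 0)"
      using cont by (simp add: isCont_def)
    ultimately have "hcoord (IZ j) (y 0) = 0" by (intro tendsto_unique[of "at (0::complex)"]) auto
    then show False using j(2) by (simp add: hcoord_simps)
  qed
  have base_g: "rad0 (fst (snd (?a t)) - fst (snd (af x)) - g t *s D)" for t
  proof -
    obtain c where c: "rad0 (fst (snd (?a t)) - fst (snd (af x)) - c *s D)"
      using af_line_base(2)[OF x d] D_def by blast
    then have "g t = c" using base[OF j(1) c] Dj by (simp add: g_def b_def)
    then show ?thesis using c by simp
  qed
  have g01: "g 0 = 0" "g 1 = 1" using Dj by (simp_all add: g_def b_def D_def)
  have b_hol: "b holomorphic_on UNIV"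
    using af_line_holomorphic[OF x d, of "IZ j"] by (simp add: b_def[abs_def] hcoord_simps)
  have g_hol: "g holomorphic_on UNIV"
    unfolding g_def by (intro holomorphic_intros b_hol) (use Dj in auto)
  have g_inj: "inj g"
  proof (rule injI, rule ccontr)
    fix t s assume gts: "g t = g s" and ts: "t \<noteq> s"
    have "rad0 (fst (snd (?a t)) - fst (snd (?a s)))"
      using rad0_diff[OF base_g[of t] base_g[of s]] gts by simp
    then have "rad0 (fst (snd (?l t)) - fst (snd (?l s)))" using af_same_base[OF l l] by blast
    moreover have "fst (snd (?l t)) - fst (snd (?l s)) = (t - s) *s fst (snd d)"
      by (simp add: vec_eq_iff algebra_simps)
    ultimately have "rad0 ((t - s) *s fst (snd d))" by (simp only:)
    then show False using ts d(1) unfolding rad0_scale_iff by (simp add: Dir_def nulldir_def)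
  qed
  have "eventually (\<lambda>s. hcoord (IZ j) (y s) \<noteq> 0) (at 0)"
    using cont[of "IZ j"] j(2) by (intro tendsto_imp_eventually_ne[of _ "hcoord (IZ j) (y 0)"])
      (auto simp: isCont_def hcoord_simps)
  then obtain \<delta>1 where \<delta>1: "\<delta>1 > 0" "\<And>s. s \<noteq> 0 \<Longrightarrow> cmod s < \<delta>1 \<Longrightarrow> hcoord (IZ j) (y s) \<noteq> 0"
    by (auto simp: eventually_at dist_norm)
  define \<rho> where "\<rho> = min \<delta> \<delta>1 / 2"
  have \<rho>: "\<rho> > 0" "\<rho> < \<delta>" "\<rho> < \<delta>1" using \<delta>(1) \<delta>1(1) by (auto simp: \<rho>_def)
  have yj: "hcoord (IZ j) (y s) \<noteq> 0" if "s \<in> cball 0 \<rho>" for s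
    using \<delta>1(2)[of s] that \<rho> j(2) by (cases "s = 0") (auto simp: hcoord_simps)
  have quotient_bound: "\<exists>K>0. \<forall>s. s \<noteq> 0 \<longrightarrow> cmod s \<le> \<rho> \<longrightarrow> cmod (q s) \<le> K"
    if "q holomorphic_on ball 0 \<delta>1'" "\<rho> < \<delta>1'" for q :: "complex \<Rightarrow> complex" and \<delta>1'
  proof -
    have "bounded (q ` cball 0 \<rho>)"
      using that by (intro compact_imp_bounded compact_continuous_image compact_cball
          holomorphic_on_imp_continuous_on holomorphic_on_subset[OF that(1)]) auto
    then obtain K where K: "K > 0" "\<forall>z\<in>q ` cball 0 \<rho>. cmod z \<le> K" by (auto simp: bounded_pos)
    then show ?thesis by (intro exI[of _ K]) (auto simp: dist_norm)
  qed
  define \<delta>' where "\<delta>' = min \<delta> \<delta>1"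
  have \<delta>': "\<rho> < \<delta>'" "\<delta>' > 0" "ball 0 \<delta>' \<subseteq> ball (0::complex) \<delta>" using \<rho> by (auto simp: \<delta>'_def)
  have yj': "hcoord (IZ j) (y s) \<noteq> 0" if "s \<in> ball 0 \<delta>'" for s
    using \<delta>1(2)[of s] that j(2) by (cases "s = 0") (auto simp: hcoord_simps \<delta>'_def)
  have ratio: "\<exists>K>0. \<forall>s. s \<noteq> 0 \<longrightarrow> cmod s \<le> \<rho> \<longrightarrow> cmod (hcoord i (y s) / hcoord (IZ j) (y s)) \<le> K" for i
    using yj' by (intro quotient_bound[OF _ \<delta>'(1)] holomorphic_intros holomorphic_on_subset[OF hol \<delta>'(3)]) auto
  \<comment> \<open>\<open>lam\<close> vanishes at 0, so its quotient by coordinate \<open>j\<close>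
    of \<open>y\<close> is divisible by \<open>s\<close>. With \<open>s = inverse t\<close> this
    bounds \<open>cmod t\<close> by a multiple of \<open>cmod (b t)\<close>.\<close>
  have "\<exists>K>0. \<forall>s. s \<noteq> 0 \<longrightarrow> cmod s \<le> \<rho> \<longrightarrow> cmod (lam s / hcoord (IZ j) (y s) / s) \<le> K"
  proof -
    let ?q = "\<lambda>s. lam s / hcoord (IZ j) (y s)"
    have "?q holomorphic_on ball 0 \<delta>'"
      using yj' holomorphic_on_subset[OF hol \<delta>'(3)]
      by (intro holomorphic_intros) (auto simp: lam_def hcoord_simps(1)[symmetric])
    then have "(\<lambda>z. if z = 0 then deriv ?q 0 else (?q z - ?q 0) / (z - 0)) holomorphic_on ball 0 \<delta>'"
      by (rule pole_lemma_open) simp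
    from quotient_bound[OF this \<delta>'(1)] show ?thesis by (simp add: lam0 cong: if_cong)
  qed
  then obtain K where K: "K > 0" "\<And>s. s \<noteq> 0 \<Longrightarrow> cmod s \<le> \<rho> \<Longrightarrow> cmod (lam s / hcoord (IZ j) (y s) / s) \<le> K"
    by blast
  have far: "inverse t \<in> ball 0 \<delta>" "inverse t \<noteq> 0" "cmod (inverse t) \<le> \<rho>" "t \<noteq> 0"
    if t: "cmod t \<ge> inverse \<rho>" for t
  proof -
    show t0: "t \<noteq> 0" using t \<rho>(1) by (metis norm_zero inverse_positive_iff_positive not_le)
    then show "inverse t \<noteq> 0" by simp
    show *: "cmod (inverse t) \<le> \<rho>"
      using le_imp_inverse_le[OF t] \<rho>(1) by (simp add: norm_inverse)
    show "inverse t \<in> ball 0 \<delta>" using * \<rho> by simp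
  qed
  have yb: "hcoord (IZ j) (y (inverse t)) = lam (inverse t) * b t" if t: "cmod t \<ge> inverse \<rho>" for t
    using ys(1)[OF far(1,2)[OF t]] far(4)[OF t] by (simp add: hcoord_simps b_def)
  have growth: "cmod t \<le> (K * (cmod (D $ j) + cmod (b 0))) * (1 + cmod (g t))"
    if t: "cmod t \<ge> inverse \<rho>" for t
  proof -
    have nz: "lam (inverse t) \<noteq> 0" "hcoord (IZ j) (y (inverse t)) \<noteq> 0"
      using ys(2)[OF far(1,2)[OF t]] yj[of "inverse t"] far(3)[OF t] by auto
    then have bt: "b t \<noteq> 0" using yb[OF t] by auto
    have "cmod (lam (inverse t) / hcoord (IZ j) (y (inverse t)) / inverse t) \<le> K"
      using K(2) far[OF t] by blast
    then have "cmod t / cmod (b t) \<le> K"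
      unfolding yb[OF t] using nz bt far(4)[OF t] by (simp add: norm_divide norm_mult norm_inverse field_simps)
    then have "cmod t \<le> K * cmod (b t)" using bt by (simp add: field_simps)
    also have "b t = g t * D $ j + b 0" using Dj by (simp add: g_def)
    also have "cmod (g t * D $ j + b 0) \<le> cmod (g t) * cmod (D $ j) + cmod (b 0)"
      using norm_triangle_ineq[of "g t * D $ j" "b 0"] by (simp add: norm_mult)
    also have "\<dots> \<le> (cmod (D $ j) + cmod (b 0)) * (1 + cmod (g t))"
      by (simp add: algebra_simps)
    finally show ?thesis using K(1) by (simp add: mult_left_mono mult.assoc)
  qed
  obtain \<alpha> where \<alpha>: "\<alpha> \<noteq> 0" "\<And>t. g t = g 0 + \<alpha> * t" using injective_entire_affine[OF g_hol g_inj growth] by metis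
  have gt: "g t = t" for t using \<alpha>(2)[of 1] \<alpha>(2)[of t] g01 by simp
  \<comment> \<open>By \<open>ratio\<close>, every coordinate of the image is bounded by a multiple
    of \<open>b t\<close>, which is now known to be affine in \<open>t\<close>.\<close>
  have coord: "hcoord i (?a t) = hcoord i (?a 0) + t * (hcoord i (?a 1) - hcoord i (?a 0))" for i t
  proof -
    obtain K' where K': "K' > 0" "\<And>s. s \<noteq> 0 \<Longrightarrow> cmod s \<le> \<rho> \<Longrightarrow> cmod (hcoord i (y s) / hcoord (IZ j) (y s)) \<le> K'"
      using ratio by blast
    show ?thesis
    proof (rule entire_linear_growth[OF af_line_holomorphic[OF x d], where A = "max 1 (inverse \<rho>)"])
      fix t assume "max 1 (inverse \<rho>) \<le> cmod t"
      then have t: "cmod t \<ge> inverse \<rho>" "cmod t \<ge> 1" by auto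
      have nz: "lam (inverse t) \<noteq> 0" "hcoord (IZ j) (y (inverse t)) \<noteq> 0"
        using ys(2)[OF far(1,2)[OF t(1)]] yj[of "inverse t"] far(3)[OF t(1)] by auto
      then have bt: "b t \<noteq> 0" using yb[OF t(1)] by auto
      have yi: "hcoord i (y (inverse t)) = lam (inverse t) * hcoord i (?a t)"
        using ys(1)[OF far(1,2)[OF t(1)]] far(4)[OF t(1)] by (simp add: hcoord_hscale)
      have "cmod (hcoord i (y (inverse t)) / hcoord (IZ j) (y (inverse t))) \<le> K'"
        using K'(2) far[OF t(1)] by blast
      then have "cmod (hcoord i (?a t)) \<le> K' * cmod (b t)"
        unfolding yi yb[OF t(1)] using nz bt by (simp add: norm_divide norm_mult divide_simps)
      also have "b t = t * D $ j + b 0" using Dj gt[of t] by (simp add: g_def field_simps)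
      also have "cmod (t * D $ j + b 0) \<le> cmod t * cmod (D $ j) + cmod t * cmod (b 0)"
        using norm_triangle_ineq[of "t * D $ j" "b 0"] mult_right_mono[OF t(2), of "cmod (b 0)"]
        by (simp add: norm_mult)
      finally show "cmod (hcoord i (?a t)) \<le> K' * (cmod (D $ j) + cmod (b 0)) * cmod t"
        using K'(1) by (simp add: mult_left_mono algebra_simps)
    qed
  qed
  have affine: "?a t = af x + hscale t e" for t
    by (rule hcoord_eqI) (simp add: coord[of _ t] hcoord_add hcoord_hscale hcoord_diff e_def)
  then show "?a t = af x + hscale t e" .
  have enz: "e \<noteq> 0" using ncone_nonzero[OF Dir_ncone[OF eDir]] .
  \<comment> \<open>By affinity this is a second lift of the image line near infinity; the two lifts
    agree projectively for \<open>s \<noteq> 0\<close>, hence also at \<open>s = 0\<close>, where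
    \<open>?y'\<close> is the slope \<open>e\<close>.\<close>
  let ?y' = "\<lambda>s. e + hscale s (af x)"
  have "eventually (\<lambda>s. s \<in> ball 0 \<delta> - {0}) (at (0::complex))"
    using \<delta>(1) by (intro eventually_at_in_open) auto
  then have "eventually (\<lambda>s. y s \<noteq> 0 \<and> ?y' s \<noteq> 0 \<and> proj (y s) = proj (?y' s)) (at 0)"
  proof eventually_elim
    case (elim s)
    then have s: "s \<in> ball 0 \<delta>" "s \<noteq> 0" by auto
    have eq: "y s = hscale (lam s * inverse s) (?y' s)"
      unfolding ys(1)[OF s] affine using s by (simp add: hscale_add_right hscale_hscale add.commute mult.assoc)
    have ynz: "y s \<noteq> 0" using ncone_nonzero y[OF s(1)] by blast
    then have "?y' s \<noteq> 0" using eq by auto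
    then show ?case using ynz eq proj_hscale[of "lam s * inverse s" "?y' s"] ys(2)[OF s] s by simp
  qed
  moreover have "isCont ?y' 0"
    using continuous_on_line[of UNIV e "af x"] by (simp add: continuous_on_eq_continuous_at)
  ultimately have "proj (y 0) = proj (?y' 0)"
    using cderiv_on_continuous[OF \<delta>(2)] \<delta>(1) ncone_nonzero[OF Dir_ncone[OF y0]] enz
    by (intro proj_eq_limit) auto
  then show "f (proj d) = proj e" using y[of 0] \<delta>(1) by simp
qed

end

lemma hcoord_minus: "hcoord i (- v) = - hcoord i v"
  using hcoord_diff[of i 0 v] by simp

lemma (in indefinite_quadric) affine_if_affine_in_nulldir:
  fixes B :: "complex ^ 'n \<Rightarrow> 'n homog"
  assumes "\<And>v z t. v \<in> nulldir \<Longrightarrow> B (z + t *s v) = B z + hscale t (B (z + v) - B z)"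
  shows "B (y + z) - B 0 = (B y - B 0) + (B z - B 0)" "B (c *s z) - B 0 = hscale c (B z - B 0)"
  by (rule homog_affine_if_affine_in_directions[of nulldir]; fact nulldir_gen nulldir_third assms)+

section \<open>Slopes of the map along null lines and along the real vertical lines\<close>

context normalised_map
begin

abbreviation pt :: "complex ^ 'n \<Rightarrow> 'n homog" where
  "pt z \<equiv> npt z 0"

lemma pt_aff: "pt z \<in> aff"
  using npt_ncone[of z 0] by (simp add: aff_def)

lemma aff_vertical: "x \<in> aff \<Longrightarrow> x + hscale (of_real \<tau>) pinf \<in> aff"
  by (intro affI) (simp_all add: affD H_add H_hscale H_pinf ncone_def)

lemma aff_eq_pt:
  assumes "x \<in> aff"
  obtains \<tau> :: real where "x = pt (fst (snd x)) + hscale (of_real \<tau>) pinf"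
proof -
  obtain \<tau> where \<tau>: "x = npt (fst (snd x)) \<tau>" using eq_npt[OF affD(3,2)[OF assms]] by blast
  have "npt z \<tau> = pt z + hscale (of_real \<tau>) pinf" for z by (rule homog_eqI) simp_all
  then show thesis using that \<tau> by metis
qed

text \<open>\<open>pt\<close> is not affine in \<open>z\<close> because of the quadratic term; along
  a null direction the deviation of \<open>pt\<close> from the null line is a real multiple of
  \<open>pinf\<close>.\<close>

lemma pt_translate:
  assumes "d \<in> Dir" "H (pt z) d = 0"
  obtains \<tau> :: real where "pt (z + t *s fst (snd d)) = (pt z + hscale t d) + hscale (of_real \<tau>) pinf"
    "\<i> * herm (z + t *s fst (snd d)) (z + t *s fst (snd d)) = \<i> * herm z z + t * snd (snd d) + of_real \<tau>"
proof -
  have x: "pt z + hscale t d \<in> aff" using aff_line[OF pt_aff assms] .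
  have z: "fst (snd (pt z + hscale t d)) = z + t *s fst (snd d)" by simp
  obtain \<tau> where \<tau>: "pt z + hscale t d = pt (z + t *s fst (snd d)) + hscale (of_real \<tau>) pinf"
    using aff_eq_pt[OF x] unfolding z by blast
  show thesis
  proof (rule that[of "- \<tau>"])
    show "pt (z + t *s fst (snd d)) = (pt z + hscale t d) + hscale (of_real (- \<tau>)) pinf"
      unfolding \<tau> by (simp add: hscale.minus_left)
    show "\<i> * herm (z + t *s fst (snd d)) (z + t *s fst (snd d)) = \<i> * herm z z + t * snd (snd d) + of_real (- \<tau>)"
      using arg_cong[OF \<tau>, of "\<lambda>x. snd (snd x)"] by (simp add: algebra_simps)
  qed
qed

text \<open>The z-part modulo the radical, which is what orthogonality to points at infinity
  detects.\<close>

definition base :: "'n homog \<Rightarrow> 'n homog" where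
  "base y = (0, (\<chi> j. if eps j = 0 then 0 else fst (snd y) $ j), 0)"

lemma base_eq_iff: "base x = base y \<longleftrightarrow> rad0 (fst (snd x) - fst (snd y))"
  by (auto simp: base_def rad0_def vec_eq_iff)

lemma base_0 [simp]: "base 0 = 0"
  by (rule homog_eqI) (simp_all add: base_def)

lemma base_linear: "base (x + hscale t y) = base x + hscale t (base y)"
  by (rule homog_eqI) (simp_all add: base_def)

text \<open>Affine points with equal \<open>z\<close> have images with equal \<open>base\<close>, so
  \<open>base\<close> of the image is a function of \<open>z\<close> alone. \<open>af_line\<close>
  makes it affine along null directions, with a slope that does not see the w-part of the starting
  point.\<close>

lemma base_af_affine:
  assumes v: "v \<in> nulldir"
  shows "base (af (pt (z + t *s v))) = base (af (pt z)) + hscale t (base (af (pt (z + v))) - base (af (pt z)))"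
    and "x \<in> aff \<Longrightarrow> d \<in> Dir \<Longrightarrow> fst (snd d) = v \<Longrightarrow> H x d = 0 \<Longrightarrow> fst (snd x) = z
      \<Longrightarrow> base (af (x + d) - af x) = base (af (pt (z + v))) - base (af (pt z))"
proof -
  have same: "base (af x) = base (af y)" if "x \<in> aff" "y \<in> aff" "fst (snd x) = fst (snd y)" for x y
    unfolding base_eq_iff using af_same_base[OF that(1,2)] that(3) by simp
  have *: "base (af (pt (z + t *s v))) = base (af (pt z)) + hscale t (base (af (x + d) - af x))"
    if x: "x \<in> aff" "fst (snd x) = z" and d: "d \<in> Dir" "fst (snd d) = v" "H x d = 0" for x d t
  proof -
    have "base (af (pt (z + t *s v))) = base (af (x + hscale t d))"
      by (rule same) (simp_all add: pt_aff aff_line x d)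
    also have "\<dots> = base (af x) + hscale t (base (af (x + d) - af x))"
      unfolding af_line(1)[OF x(1) d(1,3)] by (rule base_linear)
    also have "base (af x) = base (af (pt z))" by (rule same) (simp_all add: pt_aff x)
    finally show ?thesis .
  qed
  show 2: "base (af (x + d) - af x) = base (af (pt (z + v))) - base (af (pt z))"
    if "x \<in> aff" "d \<in> Dir" "fst (snd d) = v" "H x d = 0" "fst (snd x) = z" for x d
    using *[OF that(1,5,2,3,4), of 1] by simp
  obtain d where d: "d \<in> Dir" "fst (snd d) = v" "H (pt z) d = 0"
    using Dir_perp_exists[OF npt_coords(1) v] by metis
  show "base (af (pt (z + t *s v))) = base (af (pt z)) + hscale t (base (af (pt (z + v))) - base (af (pt z)))"
    using *[OF pt_aff _ d, of t] 2[OF pt_aff d] by simp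
qed

text \<open>The image \<open>f (proj d)\<close> determines the slope along \<open>d\<close> up to scaling, and its base part,
  which is already known to depend on \<open>d\<close> only, fixes the scale.\<close>

lemma slope_unique:
  assumes x: "x \<in> aff" "H x d = 0" and x': "x' \<in> aff" "H x' d = 0" and d: "d \<in> Dir"
  shows "af (x' + d) - af x' = af (x + d) - af x"
proof -
  let ?e = "af (x + d) - af x" and ?e' = "af (x' + d) - af x'"
  have v: "fst (snd d) \<in> nulldir" using d by (simp add: Dir_def)
  note e = af_line(2,3)[OF x(1) d x(2)] and e' = af_line(2,3)[OF x'(1) d x'(2)]
  have "proj ?e = proj ?e'" using e(2) e'(2) by simp
  then obtain c where c: "?e' = hscale c ?e"
    using proj_eqD[OF ncone_nonzero[OF Dir_ncone[OF e(1)]] ncone_nonzero[OF Dir_ncone[OF e'(1)]]] by blast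
  let ?B = "\<lambda>z. base (af (pt z))"
  note lin = affine_if_affine_in_nulldir(1)[of ?B, OF base_af_affine(1)]
  have B: "?B (z + fst (snd d)) - ?B z = ?B (fst (snd d)) - ?B 0" for z
    using lin[of z "fst (snd d)"] by (simp add: algebra_simps)
  have "base ?e' = base ?e"
    using base_af_affine(2)[OF v x(1) d _ x(2)] base_af_affine(2)[OF v x'(1) d _ x'(2)] B by simp
  moreover have "base (0 + hscale c ?e) = base 0 + hscale c (base ?e)" by (rule base_linear)
  then have "base ?e' = hscale c (base ?e)" unfolding c by simp
  ultimately have eq: "hscale (c - 1) (base ?e) = 0" by (simp add: hscale.diff_left)
  have "base ?e \<noteq> 0"
  proof
    assume "base ?e = 0"
    then have "base ?e = base 0" by simp
    then have "rad0 (fst (snd ?e) - fst (snd (0 :: 'n homog)))" unfolding base_eq_iff .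
    then have "rad0 (fst (snd ?e))" by simp
    then show False using e(1) by (simp add: Dir_def nulldir_def)
  qed
  then have "c = 1" using eq hscale_eq_0_iff[of "c - 1" "base ?e"] by auto
  then show ?thesis using c by simp
qed

text \<open>The extension of \<open>af\<close> that is homogeneous of degree one on null vectors
  with nonzero \<zeta>. Sums of null vectors leave the affine chart, and additivity is a statement
  about this extension.\<close>

definition ah :: "'n homog \<Rightarrow> 'n homog" where
  "ah y = hscale (fst y) (af (hscale (inverse (fst y)) y))"

lemma ah_hscale: "c \<noteq> 0 \<Longrightarrow> ah (hscale c y) = hscale c (ah y)"
  by (simp add: ah_def hscale_hscale field_simps)

lemma ah_aff: "x \<in> aff \<Longrightarrow> ah x = af x"
  by (simp add: ah_def affD)

lemma ah_add_Dir:
  assumes X: "X \<in> ncone" "fst X \<noteq> 0" and d: "d \<in> Dir" "H X d = 0"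
    and x: "x \<in> aff" "H x d = 0"
  shows "ah (X + d) = ah X + (af (x + d) - af x)"
proof -
  let ?X = "hscale (inverse (fst X)) X"
  have X': "?X \<in> aff" "H ?X d = 0" using X d by (simp_all add: aff_normalise H_hscale)
  have d0: "fst d = 0" using d(1) by (simp add: Dir_def)
  have "ah (X + d) = hscale (fst X) (af (?X + hscale (inverse (fst X)) d))"
    using d0 by (simp add: ah_def hscale_add_right)
  also have "\<dots> = hscale (fst X) (af ?X) + (af (?X + d) - af ?X)"
    unfolding af_line(1)[OF X'(1) d(1) X'(2)] using X(2) by (simp add: hscale_add_right hscale_hscale)
  also have "af (?X + d) - af ?X = af (x + d) - af x" by (rule slope_unique[OF x X' d(1)])
  finally show ?thesis by (simp add: ah_def)
qed

text \<open>The normalised vectors span a null line, and up to scale \<open>X + Y\<close> is its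
  point with barycentric weights \<open>fst X\<close> and \<open>fst Y\<close>; \<open>af\<close> is
  affine on that line.\<close>

lemma ah_add_orth:
  assumes X: "X \<in> ncone" "fst X \<noteq> 0" and Y: "Y \<in> ncone" "fst Y \<noteq> 0" and XY: "fst X + fst Y \<noteq> 0" "H X Y = 0"
    and indep: "\<not> rad0 (inverse (fst Y) *s fst (snd Y) - inverse (fst X) *s fst (snd X))"
  shows "ah (X + Y) = ah X + ah Y"
proof -
  let ?X = "hscale (inverse (fst X)) X" and ?Y = "hscale (inverse (fst Y)) Y"
  have X': "?X \<in> aff" and Y': "?Y \<in> aff" using X Y by (simp_all add: aff_normalise)
  define d where "d = ?Y - ?X"
  define s where "s = fst X + fst Y"
  have H: "H ?X ?Y = 0" using XY by (simp add: H_hscale)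
  then have H': "H ?Y ?X = 0" using H_eq_0_commute by blast
  have "H d d = 0" using H H' affD(3)[OF X'] affD(3)[OF Y'] by (simp add: d_def H_diff)
  moreover have "fst d = 0" using X Y by (simp add: d_def)
  moreover have "\<not> rad0 (fst (snd d))" using indep by (simp add: d_def)
  ultimately have d: "d \<in> Dir" by (simp add: Dir_def nulldir_def H_at_infinity)
  have Xd: "H ?X d = 0" using H affD(3)[OF X'] by (simp add: d_def H_diff)
  have "hscale (inverse s) (X + Y) = ?X + hscale (inverse s * fst Y) d"
  proof (rule hcoord_eqI)
    fix i
    have "inverse s * (x + y) = inverse (fst X) * x + inverse s * fst Y * (inverse (fst Y) * y - inverse (fst X) * x)" for x y
      using X(2) Y(2) XY(1) unfolding s_def by (simp add: divide_simps) algebra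
    then show "hcoord i (hscale (inverse s) (X + Y)) = hcoord i (?X + hscale (inverse s * fst Y) d)"
      by (simp only: hcoord_hscale hcoord_add hcoord_diff d_def)
  qed
  then have "ah (X + Y) = hscale s (af ?X + hscale (inverse s * fst Y) (af (?X + d) - af ?X))"
    using af_line(1)[OF X' d Xd] by (simp add: ah_def s_def)
  also have "?X + d = ?Y" by (simp add: d_def)
  also have "hscale s (af ?X + hscale (inverse s * fst Y) (af ?Y - af ?X)) = hscale (fst X) (af ?X) + hscale (fst Y) (af ?Y)"
  proof (rule hcoord_eqI)
    fix i
    have "s * (x + inverse s * fst Y * (y - x)) = fst X * x + fst Y * y" for x y
    proof -
      have "s \<noteq> 0" using XY by (simp add: s_def)
      then have "s * (x + inverse s * fst Y * (y - x)) = s * x + fst Y * (y - x)" by (simp add: field_simps)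
      then show ?thesis by (simp add: s_def algebra_simps)
    qed
    then show "hcoord i (hscale s (af ?X + hscale (inverse s * fst Y) (af ?Y - af ?X))) = hcoord i (hscale (fst X) (af ?X) + hscale (fst Y) (af ?Y))"
      by (simp only: hcoord_hscale hcoord_add hcoord_diff)
  qed
  finally show ?thesis by (simp add: ah_def)
qed

text \<open>Let \<open>u = x\<close>, \<open>v = x + pinf\<close>, whose real span is null. For real \<open>c\<close>, \<open>s\<close> put \<open>u' = c u + s v\<close>
  and \<open>v' = c v - s u\<close>; then \<open>u + \<kappa> i v = e (u' + \<kappa> i v')\<close> for \<open>\<kappa> = \<plusminus>1\<close> and \<open>e = 1 / (c - \<kappa> i s)\<close>.
  Adding null vectors \<open>q\<close>, \<open>p\<close> orthogonal to \<open>u\<close> and \<open>v\<close> makes both sums sums of orthogonal null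
  vectors, on which \<open>ah\<close> is additive.\<close>

lemma ah_rotation:
  assumes x: "x \<in> aff" and \<kappa>: "\<kappa> = 1 \<or> \<kappa> = - 1"
    and cs: "c + s \<noteq> 0" "c - s \<noteq> 0"
  defines "u' \<equiv> hscale (of_real c) x + hscale (of_real s) (x + pinf)"
    and "v' \<equiv> hscale (of_real c) (x + pinf) - hscale (of_real s) x"
    and "e \<equiv> inverse (of_real c - of_real \<kappa> * \<i> * of_real s)"
  shows "hscale e (ah u') + hscale (of_real \<kappa> * \<i> * e) (ah v') = af x + hscale (of_real \<kappa> * \<i>) (af (x + pinf))"
proof -
  obtain n1 n2 where n: "n1 \<in> nulldir" "n2 \<in> nulldir" "herm n1 n2 = 2"
    "\<And>a b. a \<noteq> - b \<Longrightarrow> \<not> rad0 (a *s n1 + b *s n2)" using hyperbolic_pair by blast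
  \<comment> \<open>The factor makes \<open>H q p = - \<kappa> / 2\<close>, the opposite of the
    value \<open>\<kappa> / 2\<close> that \<open>H U V\<close> will have.\<close>
  define m2 where "m2 = (of_real \<kappa> / 4) *s n2"
  have m2: "m2 \<in> nulldir" unfolding m2_def using n(2) \<kappa> by (intro nulldir_scale) auto
  obtain q where q: "q \<in> Dir" "fst (snd q) = n1" "H x q = 0" "H q x = 0"
    using Dir_perp_exists[OF affD(2)[OF x] n(1)] .
  obtain p where p: "p \<in> Dir" "fst (snd p) = m2" "H x p = 0" "H p x = 0"
    using Dir_perp_exists[OF affD(2)[OF x] m2] .
  have qp0: "fst q = 0" "fst p = 0" using q p by (simp_all add: Dir_def)
  have Hqp: "H q p = - of_real \<kappa> / 2"
    using qp0 q p n(3) by (simp add: H_at_infinity m2_def herm_scale)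
  have Hself: "H q q = 0" "H p p = 0" using Dir_ncone[OF q(1)] Dir_ncone[OF p(1)] by (auto simp: ncone_def)
  let ?xp = "x + pinf"
  have Hx: "H x pinf = \<i> / 2" "H pinf x = - \<i> / 2" "H x x = 0" "H pinf pinf = 0" "H q pinf = 0" "H pinf q = 0" "H p pinf = 0" "H pinf p = 0"
    using affD[OF x] qp0 pinf_in_ncone by (simp_all add: H_pinf ncone_def field_simps)
  have xp: "?xp \<in> aff" using aff_vertical[OF x, of 1] by simp
  have fx: "fst x = 1" using affD[OF x] by simp
  \<comment> \<open>The right-hand side is free of \<open>a\<close>, \<open>c\<close> and
    \<open>s\<close>, so the left-hand sides for \<open>c\<close>, \<open>s\<close> and for
    \<open>c = 1\<close>, \<open>s = 0\<close> can be compared, and the terms of \<open>q\<close>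
    and \<open>p\<close> cancel.\<close>
  have main: "ah (hscale a (hscale (of_real c) x + hscale (of_real s) ?xp)) + (af (x + q) - af x)
      + (ah (hscale (of_real \<kappa> * \<i> * a) (hscale (of_real c) ?xp - hscale (of_real s) x)) + (af (x + p) - af x))
      = ah (x + hscale (of_real \<kappa> * \<i>) ?xp + q + p)"
    if cs: "c + s \<noteq> 0" "c - s \<noteq> 0" and a: "a * (of_real c - of_real \<kappa> * \<i> * of_real s) = 1"
    for a :: complex and c s :: real
  proof -
    define U where "U = hscale a (hscale (of_real c) x + hscale (of_real s) ?xp)"
    define V where "V = hscale (of_real \<kappa> * \<i> * a) (hscale (of_real c) ?xp - hscale (of_real s) x)"
    have a0: "a \<noteq> 0" using a by auto
    \<comment> \<open>This absorbs the factor \<open>c\<^sup>2 + s\<^sup>2\<close> of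
      \<open>H U V\<close>, so that the same \<open>q\<close> and \<open>p\<close> serve for all
      \<open>c\<close> and \<open>s\<close>.\<close>
    have aa: "a * cnj a * of_real (c\<^sup>2 + s\<^sup>2) = 1"
    proof -
      have "(a * (of_real c - of_real \<kappa> * \<i> * of_real s)) * cnj (a * (of_real c - of_real \<kappa> * \<i> * of_real s)) = 1"
        unfolding a by simp
      then show ?thesis using \<kappa> by (auto simp: power2_eq_square algebra_simps)
    qed
    have cs': "of_real c + of_real s \<noteq> (0::complex)" "of_real c - of_real s \<noteq> (0::complex)"
      using cs by (metis of_real_add of_real_eq_0_iff, metis of_real_diff of_real_eq_0_iff)
    have fU: "fst U = a * (of_real c + of_real s)" and fV: "fst V = of_real \<kappa> * \<i> * a * (of_real c - of_real s)"
      by (simp_all add: U_def V_def fx)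
    have fU0: "fst U \<noteq> 0" and fV0: "fst V \<noteq> 0" using fU fV a0 cs' \<kappa> by auto
    have "fst U + fst V = a * ((of_real c + of_real s) + of_real \<kappa> * \<i> * (of_real c - of_real s))"
      unfolding fU fV by (simp add: algebra_simps)
    moreover have "(of_real c + of_real s) + of_real \<kappa> * \<i> * (of_real c - of_real s) \<noteq> (0::complex)"
      using cs by (auto simp: complex_eq_iff)
    ultimately have fUV: "fst U + fst V \<noteq> 0" using a0 by simp
    have HU: "H U U = 0" "H V V = 0" "H U q = 0" "H q U = 0" "H V p = 0" "H p V = 0" "H U p = 0" "H q V = 0"
      by (simp_all add: U_def V_def H_hscale H_add H_diff Hx q p) (simp_all add: algebra_simps)
    have "H (hscale (of_real c) x + hscale (of_real s) ?xp) (hscale (of_real c) ?xp - hscale (of_real s) x)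
        = \<i> / 2 * of_real (c\<^sup>2 + s\<^sup>2)"
      by (simp add: H_hscale H_add H_diff Hx power2_eq_square field_simps)
    then have "H U V = a * cnj (of_real \<kappa> * \<i> * a) * (\<i> / 2) * of_real (c\<^sup>2 + s\<^sup>2)"
      unfolding U_def V_def H_hscale by simp
    also have "\<dots> = of_real \<kappa> / 2 * (a * cnj a * of_real (c\<^sup>2 + s\<^sup>2))" by (simp add: algebra_simps)
    finally have HUV: "H U V = of_real \<kappa> / 2" unfolding aa by simp
    have cone: "U \<in> ncone" "V \<in> ncone" "U + q \<in> ncone" "V + p \<in> ncone"
      using HU Hself fU0 fV0 qp0 by (auto simp: ncone_def rad_def H_add)
    have "ah ((U + q) + (V + p)) = ah (U + q) + ah (V + p)"
    proof (rule ah_add_orth)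
      show "H (U + q) (V + p) = 0" using HU HUV Hqp by (simp add: H_add)
      have zU: "inverse (fst U) *s fst (snd U) = fst (snd x)"
      proof -
        have "fst (snd U) = fst U *s fst (snd x)" unfolding fU by (simp add: U_def vec_eq_iff algebra_simps)
        then show ?thesis using fU0 by (simp add: vector_smult_assoc)
      qed
      have zV: "inverse (fst V) *s fst (snd V) = fst (snd x)"
      proof -
        have "fst (snd V) = fst V *s fst (snd x)" unfolding fV by (simp add: V_def vec_eq_iff algebra_simps)
        then show ?thesis using fV0 by (simp add: vector_smult_assoc)
      qed
      have eq: "inverse (fst (V + p)) *s fst (snd (V + p)) - inverse (fst (U + q)) *s fst (snd (U + q))
          = (- inverse (fst U)) *s n1 + (inverse (fst V) * of_real \<kappa> / 4) *s n2"
        using zU zV by (simp add: qp0 q p m2_def vector_add_ldistrib)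
      \<comment> \<open>Equality would say that \<open>4 * \<i> * (c - s) = c + s\<close>,
        impossible for real \<open>c\<close>, \<open>s\<close> with \<open>c + s \<noteq> 0\<close>.
        Thus the two points have different z-parts modulo the radical.\<close>
      have "- inverse (fst U) \<noteq> - (inverse (fst V) * of_real \<kappa> / 4)"
      proof
        assume "- inverse (fst U) = - (inverse (fst V) * of_real \<kappa> / 4)"
        then have "4 * fst V = of_real \<kappa> * fst U" using fU0 fV0 by (simp add: field_simps)
        then have "a * of_real \<kappa> * (4 * \<i> * (of_real c - of_real s)) = a * of_real \<kappa> * (of_real c + of_real s)"
          unfolding fU fV by (simp add: algebra_simps)
        then have "4 * \<i> * (of_real c - of_real s) = of_real c + of_real s" using a0 \<kappa> by auto
        then show False using cs by (auto simp: complex_eq_iff)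
      qed
      then show "\<not> rad0 (inverse (fst (V + p)) *s fst (snd (V + p)) - inverse (fst (U + q)) *s fst (snd (U + q)))"
        unfolding eq by (rule n(4))
    qed (use cone qp0 fU0 fV0 fUV in simp_all)
    also have "ah (U + q) = ah U + (af (x + q) - af x)" by (rule ah_add_Dir[OF cone(1) fU0 q(1) HU(3) x q(3)])
    also have "ah (V + p) = ah V + (af (x + p) - af x)" by (rule ah_add_Dir[OF cone(2) fV0 p(1) HU(5) x p(3)])
    finally have 1: "ah (U + V + q + p) = ah U + (af (x + q) - af x) + (ah V + (af (x + p) - af x))"
      by (simp add: add_ac)
    have "U + V = x + hscale (of_real \<kappa> * \<i>) ?xp"
    proof (rule hcoord_eqI)
      fix i
      have kk: "of_real \<kappa> * \<i> * (of_real \<kappa> * \<i>) = (- 1::complex)" using \<kappa> by auto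
      have "a * (of_real c * y + of_real s * y') + of_real \<kappa> * \<i> * a * (of_real c * y' - of_real s * y)
          = (a * (of_real c - of_real \<kappa> * \<i> * of_real s)) * (y + of_real \<kappa> * \<i> * y')
            + a * of_real s * y' * (1 + of_real \<kappa> * \<i> * (of_real \<kappa> * \<i>))" for y y'
        by (simp add: algebra_simps)
      then have "a * (of_real c * y + of_real s * y') + of_real \<kappa> * \<i> * a * (of_real c * y' - of_real s * y)
          = y + of_real \<kappa> * \<i> * y'" for y y' unfolding kk a by simp
      then show "hcoord i (U + V) = hcoord i (x + hscale (of_real \<kappa> * \<i>) ?xp)"
        unfolding U_def V_def hcoord_add[of i "hscale _ _" "hscale _ _"] hcoord_hscale hcoord_diff hcoord_add[of i x "hscale _ _"]
        by (simp only: hcoord_hscale)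
    qed
    then show ?thesis using 1 unfolding U_def V_def by simp
  qed
  have k0: "of_real \<kappa> * \<i> \<noteq> (0::complex)" using \<kappa> by auto
  have "of_real c - of_real \<kappa> * \<i> * of_real s \<noteq> (0::complex)" using cs \<kappa> by (auto simp: complex_eq_iff)
  then have e: "e * (of_real c - of_real \<kappa> * \<i> * of_real s) = 1" "e \<noteq> 0" by (simp_all add: e_def)
  have cancel: "a + b = a' + b'" if "a + P + (b + Q) = a' + P + (b' + Q)" for a b a' b' P Q :: "'n homog"
  proof -
    have "(a + b) + (P + Q) = (a' + b') + (P + Q)" using that by (simp add: add_ac)
    then show ?thesis by simp
  qed
  have "ah (hscale e u') + ah (hscale (of_real \<kappa> * \<i> * e) v') = ah x + ah (hscale (of_real \<kappa> * \<i>) ?xp)"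
    using main[of 1 0 1] unfolding u'_def v'_def by (intro cancel[OF trans[OF main[OF cs e(1)] sym]]) simp
  then show ?thesis using e(2) k0 by (simp add: ah_hscale ah_aff x xp)
qed

text \<open>For \<open>c = 1 - \<tau>\<close> and \<open>s = \<tau>\<close> the vector
  \<open>u'\<close> is \<open>x + \<tau> pinf\<close>, and the two rotation identities for
  \<open>\<kappa> = 1\<close> and \<open>\<kappa> = - 1\<close> together eliminate
  \<open>v'\<close>. The excluded value of \<open>\<tau>\<close> is \<open>c = s\<close>, where
  \<open>v'\<close> leaves the affine part.\<close>

lemma af_vertical_aux:
  assumes x: "x \<in> aff" and \<tau>: "\<tau> \<noteq> 1 / 2"
  shows "af (x + hscale (of_real \<tau>) pinf) = af x + hscale (of_real \<tau>) (af (x + pinf) - af x)"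
proof -
  define c s where "c = 1 - \<tau>" and "s = \<tau>"
  have cs: "c + s \<noteq> 0" "c - s \<noteq> 0" using \<tau> by (auto simp: c_def s_def)
  define u' where "u' = hscale (of_real c) x + hscale (of_real s) (x + pinf)"
  define v' where "v' = hscale (of_real c) (x + pinf) - hscale (of_real s) x"
  have u': "u' = x + hscale (of_real \<tau>) pinf"
    by (rule hcoord_eqI) (simp add: u'_def c_def s_def hcoord_add hcoord_hscale algebra_simps)
  have "hcoord i (ah u') = of_real c * hcoord i (af x) + of_real s * hcoord i (af (x + pinf))" for i
  proof -
    let ?A = "hcoord i (af x)" and ?B = "hcoord i (af (x + pinf))"
      and ?U = "hcoord i (ah u')" and ?V = "hcoord i (ah v')"
    have rot: "?U + of_real \<kappa> * \<i> * ?V = (of_real c - of_real \<kappa> * \<i> * of_real s) * (?A + of_real \<kappa> * \<i> * ?B)"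
      if \<kappa>: "\<kappa> = 1 \<or> \<kappa> = - 1" for \<kappa> :: real
    proof -
      define w :: complex where "w = of_real c - of_real \<kappa> * \<i> * of_real s"
      have "w \<noteq> 0" using cs \<kappa> by (auto simp: complex_eq_iff w_def)
      then have "w * inverse w = 1" by simp
      moreover have "inverse w * ?U + of_real \<kappa> * \<i> * inverse w * ?V = ?A + of_real \<kappa> * \<i> * ?B"
        using arg_cong[OF ah_rotation[OF x \<kappa> cs], of "hcoord i"]
        unfolding u'_def v'_def w_def hcoord_add hcoord_hscale by simp
      ultimately show ?thesis unfolding w_def[symmetric] by algebra
    qed
    have "?U + \<i> * ?V = (of_real c - \<i> * of_real s) * (?A + \<i> * ?B)"
      "?U - \<i> * ?V = (of_real c + \<i> * of_real s) * (?A - \<i> * ?B)"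
      using rot[of 1] rot[of "- 1"] by simp_all
    then have "2 * ?U = (of_real c - \<i> * of_real s) * (?A + \<i> * ?B) + (of_real c + \<i> * of_real s) * (?A - \<i> * ?B)"
      by algebra
    also have "\<dots> = 2 * (of_real c * ?A + of_real s * ?B)" by (simp add: algebra_simps)
    finally show ?thesis by (simp only: mult_cancel_left) simp
  qed
  moreover have "ah u' = af u'" unfolding u' by (rule ah_aff[OF aff_vertical[OF x]])
  ultimately show ?thesis
    unfolding u'[symmetric] by (intro hcoord_eqI) (simp add: hcoord_add hcoord_hscale hcoord_diff c_def s_def algebra_simps)
qed

lemma af_vertical:
  assumes x: "x \<in> aff"
  shows "af (x + hscale (of_real \<tau>) pinf) = af x + hscale (of_real \<tau>) (af (x + pinf) - af x)"
proof (cases "\<tau> = 1 / 2")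
  case True
  \<comment> \<open>Seen from a base point lowered by \<open>pinf\<close>, the excluded parameter
    \<open>1 / 2\<close> becomes \<open>3 / 2\<close>.\<close>
  define x' where "x' = x + hscale (of_real (- 1)) pinf"
  have x': "x' \<in> aff" unfolding x'_def by (rule aff_vertical[OF x])
  have shift: "x' + pinf = x" "x' + hscale (of_real (3 / 2)) pinf = x + hscale (of_real (1 / 2)) pinf"
    by (rule hcoord_eqI, simp add: x'_def hcoord_add hcoord_hscale algebra_simps)+
  have 1: "af x' = af x + hscale (of_real (- 1)) (af (x + pinf) - af x)"
    unfolding x'_def by (rule af_vertical_aux[OF x]) simp
  have 2: "af (x + hscale (of_real (1 / 2)) pinf) = af x' + hscale (of_real (3 / 2)) (af x - af x')"
    using af_vertical_aux[OF x', of "3 / 2"] unfolding shift by simp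
  show ?thesis unfolding True 2 1
    by (intro hcoord_eqI) (simp add: hcoord_add hcoord_hscale hcoord_diff hcoord_minus field_simps)
qed (rule af_vertical_aux[OF x])

text \<open>The slope \<open>g\<close> is unchanged by vertical moves and, by
  \<open>slope_unique\<close>, by moves along null lines; together these connect any two affine
  points.\<close>

lemma vertical_slope_const:
  assumes x: "x \<in> aff"
  shows "af (x + pinf) - af x = af (pt 0 + pinf) - af (pt 0)"
proof -
  define g where "g x = af (x + pinf) - af x" for x
  have vert: "g (x + hscale (of_real \<tau>) pinf) = g x" if x: "x \<in> aff" for x \<tau>
  proof -
    have eq: "x + hscale (of_real \<tau>) pinf + pinf = x + hscale (of_real (\<tau> + 1)) pinf"
      by (simp add: hscale_add_left add.assoc)
    show ?thesis
      unfolding g_def eq af_vertical[OF x, of "\<tau> + 1"] af_vertical[OF x, of \<tau>]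
      by (intro hcoord_eqI) (simp add: hcoord_add hcoord_hscale hcoord_diff algebra_simps)
  qed
  have line: "g (x + d) = g x" if x: "x \<in> aff" and d: "d \<in> Dir" "H x d = 0" for x d
  proof -
    have xp: "x + pinf \<in> aff" using aff_vertical[OF x, of 1] by simp
    have "fst d = 0" using d(1) by (simp add: Dir_def)
    then have "H (x + pinf) d = 0" using d(2) by (simp add: H_add H_pinf)
    from slope_unique[OF x d(2) xp this d(1)]
    have "af (x + pinf + d) - af (x + pinf) = af (x + d) - af x" .
    moreover have "x + d + pinf = x + pinf + d" by (simp add: add_ac)
    ultimately show ?thesis by (simp add: g_def algebra_simps)
  qed
  have "g (pt z) = g (pt 0)" for z
  proof (rule nulldir_gen[of "\<lambda>z. g (pt z) = g (pt 0)"])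
    fix v z assume v: "v \<in> nulldir" and z: "g (pt z) = g (pt 0)"
    obtain d where d: "d \<in> Dir" "fst (snd d) = v" "H (pt z) d = 0"
      using Dir_perp_exists[OF npt_coords(1) v] by metis
    obtain \<tau> where "pt (z + 1 *s fst (snd d)) = (pt z + hscale 1 d) + hscale (of_real \<tau>) pinf"
      using pt_translate[OF d(1,3)] by blast
    then have "pt (z + v) = (pt z + d) + hscale (of_real \<tau>) pinf" using d(2) by simp
    moreover have "pt z + d \<in> aff" using aff_line[OF pt_aff d(1,3), of 1] by simp
    ultimately show "g (pt (z + v)) = g (pt 0)" using vert line[OF pt_aff d(1,3)] z by simp
  qed simp
  moreover obtain \<tau> where "x = pt (fst (snd x)) + hscale (of_real \<tau>) pinf" using aff_eq_pt[OF x] .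
  ultimately have "g x = g (pt 0)" using vert[OF pt_aff] by metis
  then show ?thesis by (simp add: g_def)
qed

lemma af_linear: "\<exists>T. clin T \<and> (\<forall>x\<in>aff. af x = T x)"
proof -
  define g where "g = af (pt 0 + pinf) - af (pt 0)"
  have vert: "af (x + hscale (of_real \<tau>) pinf) = af x + hscale (of_real \<tau>) g" if "x \<in> aff" for x \<tau>
    using af_vertical[OF that, of \<tau>] vertical_slope_const[OF that] by (simp add: g_def)
  \<comment> \<open>Subtracting the vertical contribution of the quadratic term of
    \<open>pt z\<close> leaves a function that is affine along null directions.\<close>
  define B where "B z = af (pt z) - hscale (\<i> * herm z z) g" for z
  have affine: "B (z + t *s v) = B z + hscale t (B (z + v) - B z)" if v: "v \<in> nulldir" for v z t
  proof -
    obtain d where d: "d \<in> Dir" "fst (snd d) = v" "H (pt z) d = 0"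
      using Dir_perp_exists[OF npt_coords(1) v] by metis
    define \<sigma> where "\<sigma> = af (pt z + d) - af (pt z)"
    have *: "B (z + t *s v) = B z + hscale t (\<sigma> - hscale (snd (snd d)) g)" for t
    proof -
      obtain \<tau> where \<tau>: "pt (z + t *s v) = (pt z + hscale t d) + hscale (of_real \<tau>) pinf"
        "\<i> * herm (z + t *s v) (z + t *s v) = \<i> * herm z z + t * snd (snd d) + of_real \<tau>"
        using pt_translate[OF d(1,3), of t] unfolding d(2) by blast
      have "af (pt (z + t *s v)) = af (pt z) + hscale t \<sigma> + hscale (of_real \<tau>) g"
        unfolding \<tau>(1) \<sigma>_def by (simp add: vert aff_line[OF pt_aff d(1,3)] af_line(1)[OF pt_aff d(1,3)])
      then show ?thesis
        unfolding B_def \<tau>(2) by (intro hcoord_eqI) (simp add: hcoord_add hcoord_hscale hcoord_diff algebra_simps)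
    qed
    show ?thesis using *[of t] *[of 1] by simp
  qed
  note lin = affine_if_affine_in_nulldir[of B, OF affine]
  define T where "T y = hscale (fst y) (B 0) + (B (fst (snd y)) - B 0) + hscale (snd (snd y)) g" for y
  have "clin T"
    unfolding clin_def T_def
    by (intro conjI allI hcoord_eqI; simp add: lin hcoord_add hcoord_hscale; algebra)
  moreover have "af x = T x" if x: "x \<in> aff" for x
  proof -
    obtain \<tau> where \<tau>: "x = pt (fst (snd x)) + hscale (of_real \<tau>) pinf" using aff_eq_pt[OF x] .
    have "snd (snd x) = \<i> * herm (fst (snd x)) (fst (snd x)) + of_real \<tau>"
      using arg_cong[OF \<tau>, of "\<lambda>x. snd (snd x)"] by simp
    moreover have "af x = af (pt (fst (snd x))) + hscale (of_real \<tau>) g"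
      using vert[OF pt_aff, of "fst (snd x)" \<tau>] \<tau> by simp
    ultimately show ?thesis
      using affD(2)[OF x] unfolding T_def B_def
      by (intro hcoord_eqI) (simp add: hcoord_add hcoord_hscale hcoord_diff algebra_simps)
  qed
  ultimately show ?thesis by blast
qed

lemma linear: "\<exists>T. clin T \<and> surj T \<and> (\<forall>x\<in>ncone. f (proj x) = proj (T x))"
proof -
  obtain T where T: "clin T" "\<And>x. x \<in> aff \<Longrightarrow> af x = T x" using af_linear by blast
  have finite_part: "f (proj x) = proj (T x) \<and> T x \<noteq> 0" if x: "x \<in> ncone" "fst x \<noteq> 0" for x
  proof -
    let ?x = "hscale (inverse (fst x)) x"
    have a: "?x \<in> aff" using aff_normalise[OF x] .
    have Tx: "T ?x \<noteq> 0" using ncone_nonzero[OF affD(1)[OF af_in_aff[OF a]]] T(2)[OF a] by simp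
    have "proj x = proj ?x" using x ncone_nonzero[OF x(1)] by (simp add: proj_hscale)
    then have "f (proj x) = proj (T ?x)" using proj_af[OF a] T(2)[OF a] by simp
    moreover have Te: "T ?x = hscale (inverse (fst x)) (T x)" by (rule clin_hscale[OF T(1)])
    moreover have "T x \<noteq> 0" using Tx Te by auto
    ultimately show ?thesis using x(2) by (simp add: proj_hscale)
  qed
  have surj: "surj T"
  proof -
    have aff_range: "y \<in> range T" if y: "y \<in> aff" for y
    proof -
      obtain x where x: "x \<in> ncone" "f (proj x) = proj y" "fst y = 0 \<longleftrightarrow> fst x = 0"
        using preimage_rep[OF affD(1)[OF y]] .
      then have "proj (T x) = proj y" "T x \<noteq> 0" using finite_part[OF x(1)] affD(2)[OF y] by simp_all
      then obtain c where "y = hscale c (T x)" using proj_eqD ncone_nonzero[OF affD(1)[OF y]] by blast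
      then show ?thesis by (simp add: clin_hscale[OF T(1), symmetric])
    qed
    have add: "x + y \<in> range T" if "x \<in> range T" "y \<in> range T" for x y
      using that by (auto simp: clin_add[OF T(1), symmetric])
    have scale: "hscale c x \<in> range T" if "x \<in> range T" for c x
      using that by (auto simp: clin_hscale[OF T(1), symmetric])
    have q: "(1, 0, 0) \<in> range T" using aff_range[OF pt_aff[of 0]] by (simp add: npt_def)
    have mq: "hscale (- 1) (1, 0, 0) \<in> range T" using scale[OF q] .
    have "pt 0 + pinf \<in> range T" using aff_range[OF aff_vertical[OF pt_aff[of 0], of 1]] by simp
    from add[OF this mq] have p: "pinf \<in> range T" by (simp add: npt_def hscale_def pinf_def)
    have z: "(0, z, 0) \<in> range T" for z
    proof (rule nulldir_gen[of "\<lambda>z. (0, z, 0) \<in> range T"])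
      show "(0, 0, 0) \<in> range T" using clin_0[OF T(1)] by (metis rangeI zero_prod_def)
      fix v y assume v: "v \<in> nulldir" and y: "(0, y, 0) \<in> range T"
      have "(1, v, 0) \<in> range T" using aff_range[OF pt_aff[of v]] v by (simp add: npt_def nulldir_def)
      from add[OF this mq] have "(0, v, 0) \<in> range T" by (simp add: hscale_def)
      from add[OF y this] show "(0, y + v, 0) \<in> range T" by simp
    qed
    have "v \<in> range T" for v
      using add[OF add[OF scale[OF q, of "fst v"] z[of "fst (snd v)"]] scale[OF p, of "snd (snd v)"]]
        hcoord_expand[of v] by (simp add: pinf_def)
    then show ?thesis by blast
  qed
  note inj = bij_is_inj[OF clin_surj_bij[OF T(1) surj]]
  have Dir_part: "f (proj d) = proj (T d)" if d: "d \<in> Dir" for d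
  proof -
    have v: "fst (snd d) \<in> nulldir" and d0: "fst d = 0" using d by (simp_all add: Dir_def)
    obtain j where j: "eps j \<noteq> 0" "fst (snd d) $ j \<noteq> 0" using v by (auto simp: nulldir_def rad0_def)
    \<comment> \<open>Solves \<open>H d (pt z) = 0\<close>, which prescribes
      \<open>herm (fst (snd d)) z\<close>: every \<open>d\<close> in \<open>Dir\<close> is the
      direction of a null line through some \<open>pt z\<close>.\<close>
    define z where "z = axis j (cnj (snd (snd d) / (2 * \<i>) / (of_real (eps j) * fst (snd d) $ j)))"
    have "herm (fst (snd d)) z = snd (snd d) / (2 * \<i>)" using j by (simp add: z_def herm_axis)
    then have "H d (pt z) = 0" using d0 by (simp add: H_def)
    then have "H (pt z) d = 0" by (simp add: H_eq_0_commute)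
    from af_line(3)[OF pt_aff d this]
    have "f (proj d) = proj (af (pt z + d) - af (pt z))" .
    also have "af (pt z + d) - af (pt z) = T d"
      using T(2)[OF pt_aff] T(2)[OF aff_line[OF pt_aff d \<open>H (pt z) d = 0\<close>, of 1]] by (simp add: clin_add[OF T(1)])
    finally show ?thesis .
  qed
  have "f (proj x) = proj (T x)" if x: "x \<in> ncone" for x
  proof -
    consider "fst x \<noteq> 0" | "x \<in> Dir" | "fst x = 0" "rad0 (fst (snd x))" using x DirI by blast
    then show ?thesis
    proof cases
      \<comment> \<open>The remaining points at infinity are limits of the points
        \<open>x + hscale s d\<close> with directions in \<open>Dir\<close>; a local lift of
        \<open>f\<close> and the linear map agree for \<open>s \<noteq> 0\<close>, hence at
        \<open>s = 0\<close>.\<close>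
      case 3
      obtain v where v: "v \<in> nulldir" using hyperbolic_pair by metis
      define d where "d = (0 :: complex, v, 0 :: complex)"
      have dd: "herm v v = 0" "\<not> rad0 v" using v by (simp_all add: nulldir_def)
      have dir: "x + hscale t d \<in> Dir" if "t \<noteq> 0" for t
      proof -
        have "\<not> rad0 (fst (snd x) + t *s v)"
          using rad0_diff[OF _ 3(2), of "fst (snd x) + t *s v"] dd that by (auto simp: rad0_scale_iff)
        then show ?thesis
          using 3 dd by (simp add: Dir_def nulldir_def d_def herm_add herm_scale rad0_herm[OF 3(2)])
      qed
      have cone: "x + hscale t d \<in> ncone" for t using dir[of t] Dir_ncone x by (cases "t = 0") auto
      obtain \<delta> y where \<delta>: "\<delta> > 0" "cderiv_on (ball 0 \<delta>) y"
        and y: "\<And>s. s \<in> ball 0 \<delta> \<Longrightarrow> y s \<in> ncone \<and> f (proj (x + hscale s d)) = proj (y s)"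
        using liftsD[OF goodD(1)[OF good], of 1 0 x d] cone by (metis zero_less_one)
      have "eventually (\<lambda>s. s \<in> ball 0 \<delta> - {0}) (at (0::complex))"
        using \<delta>(1) by (intro eventually_at_in_open) auto
      then have "eventually (\<lambda>s. y s \<noteq> 0 \<and> T x + hscale s (T d) \<noteq> 0 \<and> proj (y s) = proj (T x + hscale s (T d))) (at 0)"
      proof eventually_elim
        case (elim s)
        have Ts: "T (x + hscale s d) = T x + hscale s (T d)" by (simp add: clin_add clin_hscale T(1))
        have "T (x + hscale s d) \<noteq> 0" by (rule clin_nonzero[OF T(1) inj ncone_nonzero[OF cone]])
        moreover have "f (proj (x + hscale s d)) = proj (T (x + hscale s d))" using Dir_part[OF dir] elim by simp
        ultimately show ?case using y[of s] elim ncone_nonzero[of "y s"] unfolding Ts by simp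
      qed
      moreover have "isCont (\<lambda>s. T x + hscale s (T d)) 0"
        using continuous_on_line[of UNIV "T x" "T d"] by (simp add: continuous_on_eq_continuous_at)
      ultimately have "proj (y 0) = proj (T x + hscale 0 (T d))"
        using cderiv_on_continuous[OF \<delta>(2)] \<delta>(1) ncone_nonzero y[of 0] clin_nonzero[OF T(1) inj ncone_nonzero[OF x]]
        by (intro proj_eq_limit) auto
      then show ?thesis using y[of 0] \<delta>(1) by simp
    qed (use finite_part x Dir_part in blast)+
  qed
  then show ?thesis using T(1) surj by blast
qed

end

text \<open>An isometry \<open>G\<close> carries the image of \<open>pinf\<close> to a point whose
  orthogonal complement is again the hyperplane at infinity. So \<open>pmap G \<circ> f\<close>
  satisfies \<open>infinity\<close>, and \<open>G\<close> is undone at the end.\<close>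

lemma (in indefinite_quadric) linear_if_good:
  assumes "good f"
  shows "\<exists>T. clin T \<and> surj T \<and> (\<forall>x\<in>ncone. f (proj x) = proj (T x))"
proof -
  obtain y where y: "y \<in> ncone" "f (proj pinf) = proj y" using good_image_rep[OF assms pinf_in_ncone] .
  obtain G where G: "isom G" "fst (G y) = 0" "\<And>j. eps j \<noteq> 0 \<Longrightarrow> fst (snd (G y)) $ j = 0"
    using isom_to_infinity[OF y(1)] by blast
  define f' where "f' = pmap G \<circ> f"
  have good': "good f'" unfolding f'_def using assms G(1) by (rule good_isom)
  have Gy: "G y \<in> ncone" using isom_ncone[OF G(1)] y(1) by simp
  have f'p: "f' (proj pinf) = proj (G y)" by (simp add: f'_def y pmap_isom[OF G(1)])
  have wGy: "snd (snd (G y)) \<noteq> 0" using Gy G(2,3) by (auto simp: ncone_def rad_def)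
  have perp_Gy: "H x (G y) = 0 \<longleftrightarrow> fst x = 0" for x
    using G(2,3) wGy rad0_herm(2)[of "fst (snd (G y))"] by (simp add: H_def rad0_def)
  interpret f': normalised_map eps f'
  proof
    show "good f'" by (rule good')
    fix x x' assume x: "x \<in> ncone" "x' \<in> ncone" "f' (proj x) = proj x'"
    have "H x' (G y) = 0 \<longleftrightarrow> H x pinf = 0"
      using good_image_H[OF good' x(1) pinf_in_ncone x(2) Gy x(3) f'p] .
    then show "fst x' = 0 \<longleftrightarrow> fst x = 0" by (simp add: perp_Gy H_pinf)
  qed
  obtain T where T: "clin T" "surj T" "\<And>x. x \<in> ncone \<Longrightarrow> f' (proj x) = proj (T x)" using f'.linear by blast
  note G' = isom_inv[OF G(1)]
  have "f (proj x) = proj ((inv G \<circ> T) x)" if x: "x \<in> ncone" for x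
  proof -
    have "T x \<noteq> 0" by (rule clin_nonzero[OF T(1) bij_is_inj[OF clin_surj_bij[OF T(1,2)]] ncone_nonzero[OF x]])
    then have "pmap (inv G) (f' (proj x)) = proj ((inv G \<circ> T) x)"
      by (simp add: T(3)[OF x] pmap_proj isomD[OF G'])
    moreover have "pmap (inv G) (f' (proj x)) = f (proj x)"
      using bij_pmap[OF isomD(1,2)[OF G(1)]] by (simp add: f'_def bij_is_inj flip: bij_pmap(2)[OF isomD(1,2)[OF G(1)]])
    ultimately show ?thesis by simp
  qed
  moreover have "clin (inv G \<circ> T)" by (intro clin_comp isomD(1)[OF G'] T(1))
  moreover have "surj (inv G \<circ> T)" by (intro comp_surj T(2) bij_is_surj isomD(2)[OF G'])
  ultimately show ?thesis by blast
qed

section \<open>The definite case\<close>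

subsection \<open>Entire functions\<close>

lemma Schwarz_scaled:
  assumes h: "h holomorphic_on ball 0 R" and R: "R > 0" and "h 0 = 0"
    and B: "\<And>s. s \<in> ball 0 R \<Longrightarrow> cmod (h s) < B" and s: "s \<in> ball 0 R"
  shows "cmod (h s) \<le> B / R * cmod s"
proof -
  have B0: "B > 0" using B[of 0] R by (simp add: \<open>h 0 = 0\<close>)
  define g where "g z = h (of_real R * z) / of_real B" for z
  have in_ball: "of_real R * z \<in> ball 0 R" if "z \<in> ball 0 1" for z :: complex
    using that R by (simp add: norm_mult)
  have "(h \<circ> (\<lambda>z. of_real R * z)) holomorphic_on ball 0 1"
    using in_ball by (intro holomorphic_on_compose_gen[OF _ h] holomorphic_intros) auto
  then have "g holomorphic_on ball 0 1"
    unfolding g_def using B0 by (intro holomorphic_intros) (auto simp: o_def)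
  moreover have "g 0 = 0" by (simp add: g_def \<open>h 0 = 0\<close>)
  moreover have "cmod (g z) < 1" if "cmod z < 1" for z
    using B[OF in_ball, of z] that B0 by (simp add: g_def norm_divide)
  moreover have "cmod (s / of_real R) < 1" using s R by (simp add: norm_divide)
  ultimately have "cmod (g (s / of_real R)) \<le> cmod (s / of_real R)" by (rule Schwarz_Lemma(1))
  then show ?thesis using R B0 by (simp add: g_def norm_divide field_simps)
qed

lemma islimpt_Reals_0: "R > 0 \<Longrightarrow> (0::complex) islimpt (of_real ` {0<..<R})"
  unfolding islimpt_approachable
proof (intro allI impI)
  fix e :: real assume "R > 0" "e > 0"
  then show "\<exists>x'\<in>complex_of_real ` {0<..<R}. x' \<noteq> 0 \<and> dist x' 0 < e"
    by (intro bexI[of _ "of_real (min R e / 2)"] imageI) auto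
qed

lemma holomorphic_eq_on_reals:
  fixes g h :: "complex \<Rightarrow> complex"
  assumes "g holomorphic_on ball 0 R" "h holomorphic_on ball 0 R"
    and "\<And>b. 0 < b \<Longrightarrow> b < R \<Longrightarrow> g (of_real b) = h (of_real b)" and z: "z \<in> ball 0 R"
  shows "g z = h z"
proof -
  have R: "R > 0" using z by (auto simp: dist_norm intro: le_less_trans[OF norm_ge_zero])
  have "(\<lambda>z. g z - h z) z = 0"
    by (rule analytic_continuation[of "\<lambda>z. g z - h z" "ball 0 R" "of_real ` {0<..<R}" 0])
      (use assms R islimpt_Reals_0[OF R] in \<open>auto intro: holomorphic_intros\<close>)
  then show ?thesis by simp
qed

text \<open>\<open>E\<close> is known through \<open>G s b = s / (1 + s E b)\<close>, which is holomorphic in \<open>b\<close> on a disc whose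
  radius tends to infinity as \<open>s \<rightarrow> 0\<close>.\<close>

lemma entire_extension:
  fixes E :: "real \<Rightarrow> complex" and G :: "real \<Rightarrow> complex \<Rightarrow> complex"
  assumes hol: "\<And>R. R > 0 \<Longrightarrow> \<exists>\<sigma>>0. \<forall>s. 0 < s \<longrightarrow> s \<le> \<sigma> \<longrightarrow> G s holomorphic_on ball 0 R \<and>
      (\<forall>b. \<bar>b\<bar> < R \<longrightarrow> (1 + of_real s * E b) * G s (of_real b) = of_real s)"
    and lim: "\<And>b. ((\<lambda>s. G s b / of_real s) \<longlongrightarrow> 1) (at_right 0)"
  obtains E' where "E' holomorphic_on UNIV" "\<And>b. E' (of_real b) = E b"
proof -
  define K where "K s b = G s b / of_real s" for s b
  \<comment> \<open>For real \<open>b\<close>, \<open>K\<close> is the inverse of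
    \<open>1 + s E b\<close>, so \<open>e\<close> solves for \<open>E\<close>; the formula makes
    sense for complex \<open>b\<close> where \<open>K\<close> does not vanish.\<close>
  define e where "e s b = (inverse (K s b) - 1) / of_real s" for s b
  have disc: "\<exists>\<sigma>>0. e \<sigma> holomorphic_on ball 0 R \<and> (\<forall>b. \<bar>b\<bar> < R \<longrightarrow> e \<sigma> (of_real b) = E b) \<and>
      (\<forall>s b. 0 < s \<longrightarrow> s \<le> \<sigma> \<longrightarrow> b \<in> ball 0 R \<longrightarrow> e s b = e \<sigma> b)" if R: "R > 0" for R
  proof -
    obtain \<sigma> where \<sigma>: "\<sigma> > 0" and G: "\<And>s. 0 < s \<Longrightarrow> s \<le> \<sigma> \<Longrightarrow> G s holomorphic_on ball 0 R"
      "\<And>s b. 0 < s \<Longrightarrow> s \<le> \<sigma> \<Longrightarrow> \<bar>b\<bar> < R \<Longrightarrow> (1 + of_real s * E b) * G s (of_real b) = of_real s"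
      using hol[OF R] by blast
    have K_hol: "K s holomorphic_on ball 0 R" if "0 < s" "s \<le> \<sigma>" for s
      unfolding K_def using G(1)[OF that] that by (intro holomorphic_intros) auto
    have K_real: "(1 + of_real s * E b) * K s (of_real b) = 1" if "0 < s" "s \<le> \<sigma>" "\<bar>b\<bar> < R" for s b
      using G(2)[OF that] that(1) by (simp add: K_def field_simps)
    \<comment> \<open>Independence of \<open>e\<close> from \<open>s\<close>, cleared of
      denominators so that it can be continued from real \<open>b\<close> before \<open>K\<close> is
      known to have no zeros.\<close>
    have cross: "of_real s' * (1 - K s b) * K s' b = of_real s * (1 - K s' b) * K s b"
      if s: "0 < s" "s \<le> \<sigma>" "0 < s'" "s' \<le> \<sigma>" and b: "b \<in> ball 0 R" for s s' b
    proof (rule holomorphic_eq_on_reals[OF _ _ _ b])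
      show "(\<lambda>b. of_real s' * (1 - K s b) * K s' b) holomorphic_on ball 0 R"
        "(\<lambda>b. of_real s * (1 - K s' b) * K s b) holomorphic_on ball 0 R"
        using s by (intro holomorphic_intros K_hol; simp)+
      fix b assume "0 < b" "b < R"
      then have "\<bar>b\<bar> < R" by simp
      from K_real[OF s(1,2) this] K_real[OF s(3,4) this]
      show "of_real s' * (1 - K s (of_real b)) * K s' (of_real b) = of_real s * (1 - K s' (of_real b)) * K s (of_real b)"
        by algebra
    qed
    \<comment> \<open>By \<open>cross\<close>, a zero of \<open>K s\<close> at \<open>b\<close> is a
      zero of \<open>K s'\<close> at \<open>b\<close> for all small \<open>s'\<close>, against the
      limit 1.\<close>
    have K_nz: "K s b \<noteq> 0" if s: "0 < s" "s \<le> \<sigma>" and b: "b \<in> ball 0 R" for s b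
    proof
      assume K0: "K s b = 0"
      have "eventually (\<lambda>s'. s' \<in> {0<..<\<sigma>}) (at_right 0)" using \<sigma> by (rule eventually_at_right_real)
      then have "eventually (\<lambda>s'. K s' b = 0) (at_right 0)"
      proof eventually_elim
        case (elim s')
        then show ?case using cross[OF s, of s' b] b K0 by simp
      qed
      then have "((\<lambda>s'. K s' b) \<longlongrightarrow> 0) (at_right 0)" by (rule tendsto_eventually)
      then have "(0::complex) = 1"
        using lim[of b] unfolding K_def[symmetric] by (intro tendsto_unique[of "at_right (0::real)"]) auto
      then show False by simp
    qed
    have "e \<sigma> holomorphic_on ball 0 R"
      unfolding e_def using K_nz \<sigma> by (intro holomorphic_intros K_hol) auto
    moreover have "e \<sigma> (of_real b) = E b" if "\<bar>b\<bar> < R" for b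
    proof -
      have "inverse (K \<sigma> (of_real b)) = 1 + of_real \<sigma> * E b"
        using K_real[OF \<sigma> order_refl that] by (metis inverse_unique mult.commute)
      then show ?thesis using \<sigma> by (simp add: e_def)
    qed
    moreover have "e s b = e \<sigma> b" if "0 < s" "s \<le> \<sigma>" "b \<in> ball 0 R" for s b
      using cross[OF that(1,2) \<sigma> order_refl that(3)] K_nz[OF that] K_nz[OF \<sigma> order_refl that(3)] that(1) \<sigma>
      by (simp add: e_def field_simps)
    ultimately show ?thesis using \<sigma> by blast
  qed
  have const: "\<exists>w. eventually (\<lambda>s. e s b = w) (at_right 0)" for b
  proof -
    obtain \<sigma> where \<sigma>: "\<sigma> > 0" "\<forall>s b'. 0 < s \<longrightarrow> s \<le> \<sigma> \<longrightarrow> b' \<in> ball 0 (cmod b + 1) \<longrightarrow> e s b' = e \<sigma> b'"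
      using disc[OF add_nonneg_pos[OF norm_ge_zero[of b] zero_less_one]] by blast
    have "eventually (\<lambda>s. s \<in> {0<..<\<sigma>}) (at_right 0)" using \<sigma>(1) by (rule eventually_at_right_real)
    then have "eventually (\<lambda>s. e s b = e \<sigma> b) (at_right 0)"
    proof eventually_elim
      case (elim s)
      then have "0 < s" "s \<le> \<sigma>" by auto
      then show ?case by (rule \<sigma>(2)[rule_format]) simp
    qed
    then show ?thesis by blast
  qed
  define E' where "E' b = (SOME w. eventually (\<lambda>s. e s b = w) (at_right 0))" for b
  have E': "eventually (\<lambda>s. e s b = E' b) (at_right 0)" for b
    unfolding E'_def using const by (rule someI_ex)
  have local: "\<exists>\<sigma>. e \<sigma> holomorphic_on ball 0 R \<and> (\<forall>b. \<bar>b\<bar> < R \<longrightarrow> e \<sigma> (of_real b) = E b) \<and>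
      (\<forall>b\<in>ball 0 R. E' b = e \<sigma> b)" if R: "R > 0" for R
  proof -
    obtain \<sigma> where \<sigma>: "\<sigma> > 0" "e \<sigma> holomorphic_on ball 0 R" "\<forall>b. \<bar>b\<bar> < R \<longrightarrow> e \<sigma> (of_real b) = E b"
      "\<forall>s b. 0 < s \<longrightarrow> s \<le> \<sigma> \<longrightarrow> b \<in> ball 0 R \<longrightarrow> e s b = e \<sigma> b" using disc[OF R] by blast
    have "E' b = e \<sigma> b" if b: "b \<in> ball 0 R" for b
    proof -
      have "eventually (\<lambda>s. s \<in> {0<..<\<sigma>}) (at_right 0)" using \<sigma>(1) by (rule eventually_at_right_real)
      with E'[of b] have "eventually (\<lambda>s. E' b = e \<sigma> b) (at_right (0::real))"
      proof eventually_elim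
        case (elim s)
        then have s: "0 < s" "s \<le> \<sigma>" by auto
        show ?case using \<sigma>(4)[rule_format, OF s b] elim(1) by simp
      qed
      then show ?thesis by simp
    qed
    then show ?thesis using \<sigma> by blast
  qed
  show thesis
  proof (rule that)
    show "E' holomorphic_on UNIV"
      unfolding holomorphic_on_def
    proof
      fix b :: complex
      have pos: "cmod b + 1 > 0" using add_nonneg_pos[OF norm_ge_zero[of b] zero_less_one] .
      obtain \<sigma> where \<sigma>: "e \<sigma> holomorphic_on ball 0 (cmod b + 1)" "\<forall>b'\<in>ball 0 (cmod b + 1). E' b' = e \<sigma> b'"
        using local[OF pos] by blast
      have "E' holomorphic_on ball 0 (cmod b + 1)"
        using \<sigma>(1) by (rule holomorphic_transform) (simp add: \<sigma>(2))
      then show "E' field_differentiable at b within UNIV"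
        using holomorphic_on_imp_differentiable_at[OF _ open_ball, of E' 0 "cmod b + 1" b] by simp
    qed
    fix b
    obtain \<sigma> where "\<forall>b'. \<bar>b'\<bar> < \<bar>b\<bar> + 1 \<longrightarrow> e \<sigma> (of_real b') = E b'" "\<forall>b'\<in>ball 0 (\<bar>b\<bar> + 1). E' b' = e \<sigma> b'"
      using local[OF add_nonneg_pos[OF abs_ge_zero[of b] zero_less_one]] by blast
    then show "E' (of_real b) = E b" by simp
  qed
qed

text \<open>The relation \<open>E1 b = b * E2 (inverse b)\<close> continues to all nonzero
  \<open>b\<close>. It bounds \<open>E1\<close> linearly at infinity, so \<open>E1\<close> is
  affine, and letting \<open>b\<close> tend to infinity identifies its slope as
  \<open>E2 0\<close>.\<close>

lemma entire_homogeneous_affine: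
  assumes E1: "E1 holomorphic_on UNIV" and E2: "E2 holomorphic_on UNIV"
    and hom: "\<And>b. b > 0 \<Longrightarrow> E1 (of_real b) = of_real b * E2 (inverse (of_real b))"
  shows "E1 1 = E1 0 + E2 0"
proof -
  have eq: "E1 b = b * E2 (inverse b)" if b: "b \<noteq> 0" for b
  proof -
    have "(\<lambda>b. E1 b - b * E2 (inverse b)) b = 0"
    proof (rule analytic_continuation[of "\<lambda>b. E1 b - b * E2 (inverse b)" "- {0}" "of_real ` {0<..}" 1])
      have "(E2 \<circ> inverse) holomorphic_on - {0}"
        by (intro holomorphic_on_compose_gen[OF _ E2] holomorphic_intros) auto
      then show "(\<lambda>b. E1 b - b * E2 (inverse b)) holomorphic_on - {0}"
        by (intro holomorphic_intros holomorphic_on_subset[OF E1]) (auto simp: o_def)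
      show "connected (- {0::complex})" by (rule connected_punctured_universe) simp
      show "(1::complex) islimpt of_real ` {0<..}"
        unfolding islimpt_approachable
      proof (intro allI impI)
        fix e :: real assume "e > 0"
        then show "\<exists>x'\<in>complex_of_real ` {0<..}. x' \<noteq> 1 \<and> dist x' 1 < e"
          by (intro bexI[of _ "of_real (1 + e / 2)"] imageI) (auto simp: dist_norm)
      qed
    qed (use b hom in auto)
    then show ?thesis by simp
  qed
  have cont: "isCont E2 0"
    using E2 by (metis UNIV_I continuous_on_eq_continuous_at holomorphic_on_imp_continuous_on open_UNIV)
  have "bounded (E2 ` cball 0 1)"
    by (intro compact_imp_bounded compact_continuous_image compact_cball
        holomorphic_on_imp_continuous_on holomorphic_on_subset[OF E2]) simp
  then obtain B where B: "\<forall>z\<in>E2 ` cball 0 1. cmod z \<le> B" unfolding bounded_iff ..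
  have lin: "E1 t = E1 0 + t * (E1 1 - E1 0)" for t
  proof (rule entire_linear_growth[OF E1, of 1 B])
    fix t :: complex assume t: "1 \<le> cmod t"
    then have t0: "t \<noteq> 0" by auto
    have "inverse t \<in> cball 0 1" using t t0 by (simp add: norm_inverse inverse_le_1_iff)
    then have "cmod (E2 (inverse t)) \<le> B" using B by blast
    then have "cmod t * cmod (E2 (inverse t)) \<le> cmod t * B" by (intro mult_left_mono) auto
    then show "cmod (E1 t) \<le> B * cmod t" unfolding eq[OF t0] by (simp add: norm_mult mult.commute)
  qed
  have "eventually (\<lambda>c. c \<noteq> 0) (at (0::complex))" by (rule eventually_neq_at_within)
  then have "eventually (\<lambda>c. E2 c = c * E1 0 + (E1 1 - E1 0)) (at 0)"
  proof eventually_elim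
    case (elim c)
    then have "E2 c = c * E1 (inverse c)" using eq[of "inverse c"] by simp
    also have "\<dots> = c * (E1 0 + inverse c * (E1 1 - E1 0))" using lin[of "inverse c"] by simp
    also have "\<dots> = c * E1 0 + (E1 1 - E1 0)" using elim by (simp add: field_simps)
    finally show ?case .
  qed
  moreover have "((\<lambda>c. c * E1 0 + (E1 1 - E1 0)) \<longlongrightarrow> 0 * E1 0 + (E1 1 - E1 0)) (at 0)"
    by (intro tendsto_intros)
  ultimately have "(E2 \<longlongrightarrow> E1 1 - E1 0) (at 0)" by (simp add: tendsto_cong)
  moreover have "(E2 \<longlongrightarrow> E2 0) (at 0)" using cont by (simp add: isCont_def)
  ultimately have "E2 0 = E1 1 - E1 0" by (intro tendsto_unique[of "at (0::complex)" E2]) auto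
  then show ?thesis by simp
qed

lemma norm_hcoord_le: "cmod (hcoord i v) \<le> norm v"
proof -
  have *: "norm (fst v) \<le> norm v" "norm (snd v) \<le> norm v" for v :: "'b::real_normed_vector \<times> 'c::real_normed_vector"
    using norm_fst_le[of "fst v" "snd v"] norm_snd_le[of "snd v" "fst v"] by simp_all
  have "cmod (fst (snd v) $ j) \<le> norm v" for j
    using Finite_Cartesian_Product.norm_nth_le[of "fst (snd v)" j] *(1)[of "snd v"] *(2)[of v] by simp
  moreover have "cmod (fst v) \<le> norm v" by (rule *)
  moreover have "cmod (snd (snd v)) \<le> norm v" using *(2)[of "snd v"] *(2)[of v] by simp
  ultimately show ?thesis by (cases i) (simp_all add: hcoord_simps)
qed

subsection \<open>Leaves\<close>

locale definite_quadric = hermitian_quadric eps for eps :: "'n::finite \<Rightarrow> real" +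
  assumes eps_nonneg: "eps j \<ge> 0"
begin

lemma herm_definite:
  assumes "herm z z = 0" "eps j \<noteq> 0"
  shows "z $ j = 0"
proof -
  have "herm z z = of_real (\<Sum>j\<in>UNIV. eps j * (cmod (z $ j))\<^sup>2)"
    unfolding herm_def by (simp add: mult.assoc complex_norm_square[symmetric])
  then have "(\<Sum>j\<in>UNIV. eps j * (cmod (z $ j))\<^sup>2) = 0" using assms(1) by (metis of_real_eq_0_iff)
  then have "eps j * (cmod (z $ j))\<^sup>2 = 0"
    by (subst (asm) sum_nonneg_eq_0_iff) (auto simp: eps_nonneg)
  then show ?thesis using assms(2) by simp
qed

lemma leaf_at_infinity:
  assumes "x \<in> ncone" "fst x = 0"
  shows "snd (snd x) \<noteq> 0" "x - hscale (snd (snd x)) pinf \<in> rad"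
proof -
  have "herm (fst (snd x)) (fst (snd x)) = 0" using assms by (simp add: ncone_def H_def)
  then have z: "eps j \<noteq> 0 \<Longrightarrow> fst (snd x) $ j = 0" for j by (rule herm_definite)
  then show "snd (snd x) \<noteq> 0" using assms by (auto simp: ncone_def rad_def)
  show "x - hscale (snd (snd x)) pinf \<in> rad" using z assms(2) by (simp add: rad_def)
qed

text \<open>Subtract the multiple of \<open>x\<close> that cancels \<zeta>. The difference is null
  and orthogonal to \<open>x\<close>; outside the radical it would be a nonzero multiple of
  \<open>pinf\<close> modulo the radical, which is orthogonal to no finite point. Points at infinity
  all lie on the leaf of \<open>pinf\<close>.\<close>

lemma perp_same_leaf:
  assumes x: "x \<in> ncone" and y: "y \<in> ncone" and H: "H x y = 0"
  shows "\<exists>c. c \<noteq> 0 \<and> y - hscale c x \<in> rad"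
proof -
  have inf: "fst y = 0" if "x \<in> ncone" "H x y = 0" "fst x = 0" for x y
  proof -
    have "H (x - hscale (snd (snd x)) pinf) y = 0" using rad_H(1) leaf_at_infinity(2)[OF that(1,3)] by blast
    then have "H (hscale (snd (snd x)) pinf) y = 0" using that(2) by (simp add: H_diff)
    then show ?thesis using leaf_at_infinity(1)[OF that(1,3)] by (simp add: H_hscale H_pinf)
  qed
  have H': "H y x = 0" using H H_eq_0_commute by blast
  show ?thesis
  proof (cases "fst x = 0")
    case True
    then have y0: "fst y = 0" using inf[OF x H] by simp
    define c where "c = snd (snd y) / snd (snd x)"
    have w: "snd (snd x) \<noteq> 0" "snd (snd y) \<noteq> 0" using leaf_at_infinity(1) x y True y0 by auto
    have "y - hscale c x \<in> rad"
      using leaf_at_infinity(2)[OF x True] leaf_at_infinity(2)[OF y y0] w True y0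
      by (simp add: rad_def c_def)
    then show ?thesis using w by (intro exI[of _ c]) (simp add: c_def)
  next
    case False
    then have y0: "fst y \<noteq> 0" using inf[OF y H'] by auto
    define c where "c = fst y / fst x"
    define d where "d = y - hscale c x"
    have d0: "fst d = 0" using False by (simp add: d_def c_def)
    have Hd: "H d d = 0" "H d x = 0" using x y H H' by (simp_all add: d_def H_diff H_hscale ncone_def)
    have "d \<in> rad"
    proof (rule ccontr)
      assume "d \<notin> rad"
      then have "d \<in> ncone" using Hd(1) by (simp add: ncone_def)
      then show False using inf[OF _ Hd(2) d0] False by blast
    qed
    then show ?thesis using False y0 by (intro exI[of _ c]) (simp add: d_def c_def)
  qed
qed

lemma leaf_coordinates:
  assumes X: "X \<in> ncone" and \<rho>: "\<rho> \<in> rad" "\<rho>' \<in> rad" and eq: "hscale c (X + \<rho>) = hscale d X + \<rho>'"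
  shows "c = d" "\<rho>' = hscale c \<rho>"
proof -
  have *: "hscale (c - d) X = \<rho>' - hscale c \<rho>"
    using eq by (simp add: hscale_add_right hscale.diff_left algebra_simps)
  then have "hscale (c - d) X \<in> rad" using rad_diff[OF \<rho>(2) rad_hscale[OF \<rho>(1)]] by simp
  then show cd: "c = d" using X rad_hscale_iff[of "c - d" X] by (auto simp: ncone_def)
  then show "\<rho>' = hscale c \<rho>" using * by simp
qed

lemma leaf_proj_eq:
  assumes "X \<in> ncone" "\<rho> \<in> rad" "\<rho>' \<in> rad" "proj (X + \<rho>) = proj (X + \<rho>')"
  shows "\<rho> = \<rho>'"
proof -
  have "X + \<rho> \<in> ncone" "X + \<rho>' \<in> ncone" using assms by (simp_all add: ncone_add_rad)
  then obtain c where "X + \<rho>' = hscale c (X + \<rho>)" using assms(4) proj_eqD ncone_nonzero by blast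
  then have "hscale c (X + \<rho>) = hscale 1 X + \<rho>'" by simp
  from leaf_coordinates[OF assms(1-3) this] show ?thesis by simp
qed

text \<open>The leaf of \<open>proj x\<close> is parametrised by \<open>proj (x + r)\<close> with
  \<open>r\<close> in the radical; this is the map between the leaves of \<open>x\<close> and
  \<open>X\<close> in these coordinates.\<close>

definition leafmap :: "('n cproj \<Rightarrow> 'n cproj) \<Rightarrow> 'n homog \<Rightarrow> 'n homog \<Rightarrow> 'n homog \<Rightarrow> 'n homog" where
  "leafmap g x X r = (THE \<rho>. \<rho> \<in> rad \<and> g (proj (x + r)) = proj (X + \<rho>))"

lemma leafmap_eq:
  assumes "X \<in> ncone" "\<rho> \<in> rad" "g (proj (x + r)) = proj (X + \<rho>)"
  shows "leafmap g x X r = \<rho>"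
  unfolding leafmap_def by (rule the_equality) (use assms leaf_proj_eq in auto)

lemma leafmap:
  assumes g: "good g" and x: "x \<in> ncone" "X \<in> ncone" "g (proj x) = proj X" and r: "r \<in> rad"
  shows "leafmap g x X r \<in> rad" "g (proj (x + r)) = proj (X + leafmap g x X r)"
proof -
  have xr: "x + r \<in> ncone" using x r by (simp add: ncone_add_rad)
  obtain y where y: "y \<in> ncone" "g (proj (x + r)) = proj y" using good_image_rep[OF g xr] .
  have "H x (x + r) = 0" using x(1) r by (simp add: H_add rad_H ncone_def)
  then have "H X y = 0" using good_image_H[OF g x(1) xr x(2) y(1) x(3) y(2)] by simp
  then obtain c where c: "c \<noteq> 0" "y - hscale c X \<in> rad" using perp_same_leaf x(2) y(1) by blast
  let ?\<rho> = "hscale (inverse c) (y - hscale c X)"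
  have \<rho>: "?\<rho> \<in> rad" using rad_hscale c(2) by blast
  have "X + ?\<rho> = hscale (inverse c) y" using c(1) by (simp add: hscale.diff_right hscale_hscale)
  then have eq: "g (proj (x + r)) = proj (X + ?\<rho>)" using y c(1) by (simp add: proj_hscale ncone_nonzero)
  have "leafmap g x X r = ?\<rho>" by (rule leafmap_eq) (rule x(2) \<rho> eq)+
  then show "leafmap g x X r \<in> rad" "g (proj (x + r)) = proj (X + leafmap g x X r)"
    using \<rho> eq by simp_all
qed

text \<open>Such a coordinate fixes the scale of a homogeneous vector in the leaf of
  \<open>X\<close> without seeing its radical part.\<close>

lemma base_index:
  assumes "X \<notin> rad"
  obtains i where "hcoord i X \<noteq> 0" "\<And>\<rho>. \<rho> \<in> rad \<Longrightarrow> hcoord i \<rho> = 0"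
proof -
  consider "fst X \<noteq> 0" | "snd (snd X) \<noteq> 0" | j where "eps j \<noteq> 0" "fst (snd X) $ j \<noteq> 0"
    using assms by (auto simp: rad_def)
  then show thesis
  proof cases
    case 1
    then show ?thesis by (intro that[of IZeta]) (simp_all add: hcoord_simps rad_def)
  next
    case 2
    then show ?thesis by (intro that[of IW]) (simp_all add: hcoord_simps rad_def)
  next
    case (3 j)
    then show ?thesis by (intro that[of "IZ j"]) (simp_all add: hcoord_simps rad_def)
  qed
qed

lemma leafmap_holomorphic:
  assumes g: "good g" and x: "x \<in> ncone" "X \<in> ncone" "g (proj x) = proj X" and r: "r\<^sub>0 \<in> rad" "r\<^sub>1 \<in> rad"
  shows "(\<lambda>t. hcoord i (leafmap g x X (r\<^sub>0 + hscale t r\<^sub>1))) holomorphic_on UNIV"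
  unfolding holomorphic_on_def
proof
  fix t
  obtain k where k: "hcoord k X \<noteq> 0" "\<And>\<rho>. \<rho> \<in> rad \<Longrightarrow> hcoord k \<rho> = 0"
    using base_index[of X] x(2) by (auto simp: ncone_def)
  have rt: "r\<^sub>0 + hscale t r\<^sub>1 \<in> rad" for t using r by (intro rad_add rad_hscale)
  have line: "(x + r\<^sub>0) + hscale t r\<^sub>1 \<in> ncone" for t
    using rt[of t] x(1) by (simp add: ncone_add_rad add.assoc)
  obtain \<delta> y where \<delta>: "\<delta> > 0" "cderiv_on (ball t \<delta>) y"
    and y: "\<And>s. s \<in> ball t \<delta> \<Longrightarrow> y s \<in> ncone \<and> g (proj ((x + r\<^sub>0) + hscale s r\<^sub>1)) = proj (y s)"
    using liftsD[OF goodD(1)[OF g], of 1 t "x + r\<^sub>0" r\<^sub>1] line by (metis zero_less_one)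
  note hol = cderiv_on_hcoord[OF \<delta>(2) open_ball]
  have *: "hcoord k (y s) \<noteq> 0 \<and>
      hcoord i (leafmap g x X (r\<^sub>0 + hscale s r\<^sub>1)) = hcoord i (y s) * hcoord k X / hcoord k (y s) - hcoord i X"
    if s: "s \<in> ball t \<delta>" for s
  proof -
    let ?\<rho> = "leafmap g x X (r\<^sub>0 + hscale s r\<^sub>1)"
    note \<rho> = leafmap[OF g x rt[of s]]
    have "X + ?\<rho> \<in> ncone" using x(2) \<rho>(1) by (simp add: ncone_add_rad)
    moreover have "proj (X + ?\<rho>) = proj (y s)" using \<rho>(2) y[OF s] by (simp add: add.assoc)
    ultimately obtain c where c: "c \<noteq> 0" "y s = hscale c (X + ?\<rho>)" using proj_eqD y[OF s] ncone_nonzero by blast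
    then show ?thesis using k(1) k(2)[OF \<rho>(1)] by (simp add: hcoord_hscale hcoord_add field_simps)
  qed
  have "(\<lambda>s. hcoord i (y s) * hcoord k X / hcoord k (y s) - hcoord i X) holomorphic_on ball t \<delta>"
    using * by (intro holomorphic_intros hol) auto
  then have "(\<lambda>s. hcoord i (leafmap g x X (r\<^sub>0 + hscale s r\<^sub>1))) holomorphic_on ball t \<delta>"
    by (rule holomorphic_transform) (simp add: *)
  then show "(\<lambda>t. hcoord i (leafmap g x X (r\<^sub>0 + hscale t r\<^sub>1))) field_differentiable at t within UNIV"
    using \<delta>(1) holomorphic_on_imp_differentiable_at[OF _ open_ball, of _ t \<delta> t] by simp
qed

end

locale definite_map = definite_quadric eps for eps :: "'n::finite \<Rightarrow> real" +
  fixes f F :: "'n cproj \<Rightarrow> 'n cproj" and U :: "'n cproj set"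
  assumes good: "good f"
    and sing_U: "sing \<subseteq> U"
    and F_hol: "holomorphic_proj F U"
    and F_eq: "\<And>p. p \<in> U \<Longrightarrow> p \<in> M \<union> sing \<Longrightarrow> F p = f p"
    and f_sing: "\<And>p. p \<in> sing \<Longrightarrow> f p \<in> sing"
    and eps_zero: "\<exists>j. eps j = 0"
begin

lemmas image_rep = good_image_rep[OF good] and image_H = good_image_H[OF good]

lemma lift_near_sing:
  assumes r: "r \<in> rad" "r \<noteq> 0"
  obtains \<delta> j Y where "\<delta> > 0" "\<And>v. v \<in> ball r \<delta> \<Longrightarrow> hcoord j (Y v) = 1"
    "\<And>v. v \<in> ball r \<delta> \<Longrightarrow> \<exists>A. clin A \<and> (Y has_derivative A) (at v)"
    "\<And>v. v \<in> ball r \<delta> \<Longrightarrow> v \<in> rad \<Longrightarrow> Y v \<in> rad"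
    "\<And>v. v \<in> ball r \<delta> \<Longrightarrow> v \<in> ncone \<Longrightarrow> f (proj v) = proj (Y v)"
proof -
  have rs: "proj r \<in> sing" using r by (simp add: sing_def)
  obtain j where j: "F (proj r) \<in> chart_dom j" by (rule chart_dom_cover)
  from rs have rU: "proj r \<in> U" using sing_U by blast
  obtain \<delta> Y where \<delta>: "\<delta> > 0"
    and Y: "\<And>v. v \<in> ball r \<delta> \<Longrightarrow> v \<noteq> 0 \<and> proj v \<in> U \<and> F (proj v) = proj (Y v) \<and> hcoord j (Y v) = 1"
    and dY: "\<And>v. v \<in> ball r \<delta> \<Longrightarrow> \<exists>A. clin A \<and> (Y has_derivative A) (at v)"
    using holomorphic_proj_lift[OF F_hol r(2) rU j] by blast
  show thesis
  proof (rule that[OF \<delta>])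
    fix v assume v: "v \<in> ball r \<delta>"
    show "hcoord j (Y v) = 1" using Y[OF v] by blast
    then have Ynz: "Y v \<noteq> 0" by auto
    show "\<exists>A. clin A \<and> (Y has_derivative A) (at v)" using dY[OF v] .
    show "f (proj v) = proj (Y v)" if "v \<in> ncone"
      using Y[OF v] F_eq[of "proj v"] that by (simp add: M_def)
    show "Y v \<in> rad" if "v \<in> rad"
    proof -
      have vs: "proj v \<in> sing" using that Y[OF v] by (simp add: sing_def)
      then have "F (proj v) \<in> sing" using f_sing[OF vs] F_eq[of "proj v"] Y[OF v] by simp
      then have "proj (Y v) \<in> sing" using Y[OF v] by simp
      then obtain \<rho> where \<rho>: "\<rho> \<in> rad" "\<rho> \<noteq> 0" "proj (Y v) = proj \<rho>" by (rule sing_cases)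
      obtain c where "Y v = hscale c \<rho>" using proj_eqD[OF \<rho>(2) Ynz] \<rho>(3) by metis
      then show ?thesis using rad_hscale[OF \<rho>(1)] by simp
    qed
  qed
qed

lemma lift_along_line:
  fixes Y :: "'n homog \<Rightarrow> 'n homog"
  assumes "\<And>s. s \<in> D \<Longrightarrow> \<exists>A. clin A \<and> (Y has_derivative A) (at (u + hscale s v))"
  shows "cderiv_on D (\<lambda>s. Y (u + hscale s v))"
  unfolding cderiv_on_def
proof
  fix s assume "s \<in> D"
  then obtain A where A: "clin A" "(Y has_derivative A) (at (u + hscale s v))" using assms by blast
  have "((\<lambda>s. Y (u + hscale s v)) has_derivative (\<lambda>h. A (hscale h v))) (at s)"
    by (rule has_derivative_compose[OF has_derivative_line A(2)])
  then show "\<exists>y'. ((\<lambda>s. Y (u + hscale s v)) has_derivative (\<lambda>h. hscale h y')) (at s)"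
    unfolding clin_hscale[OF A(1)] by blast
qed

text \<open>Near infinity of a leaf, the base coordinates of the extension vanish on the singular set; the
  Schwarz lemma turns this into a lower bound for the growth of the leaf map.\<close>

lemma leafmap_growth_local:
  assumes x: "x \<in> ncone" "X \<in> ncone" "f (proj x) = proj X" and r: "r \<in> rad" "r \<noteq> 0"
  obtains \<delta> C where "\<delta> > 0" "\<And>\<rho> s. \<rho> \<in> rad \<Longrightarrow> norm (\<rho> - r) < \<delta> \<Longrightarrow> 0 < s \<Longrightarrow> s < \<delta> \<Longrightarrow>
    1 \<le> C * s * (1 + norm (leafmap f x X (hscale (inverse (of_real s)) \<rho>)))"
proof -
  obtain \<delta>\<^sub>0 j Y where \<delta>\<^sub>0: "\<delta>\<^sub>0 > 0" and Yj: "\<And>v. v \<in> ball r \<delta>\<^sub>0 \<Longrightarrow> hcoord j (Y v) = 1"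
    and dY: "\<And>v. v \<in> ball r \<delta>\<^sub>0 \<Longrightarrow> \<exists>A. clin A \<and> (Y has_derivative A) (at v)"
    and Yrad: "\<And>v. v \<in> ball r \<delta>\<^sub>0 \<Longrightarrow> v \<in> rad \<Longrightarrow> Y v \<in> rad"
    and Yf: "\<And>v. v \<in> ball r \<delta>\<^sub>0 \<Longrightarrow> v \<in> ncone \<Longrightarrow> f (proj v) = proj (Y v)"
    by (rule lift_near_sing[OF r]) (rule that; assumption)
  obtain k where k: "hcoord k X \<noteq> 0" "\<And>\<rho>. \<rho> \<in> rad \<Longrightarrow> hcoord k \<rho> = 0"
    using base_index[of X] x(2) by (auto simp: ncone_def)
  have "isCont Y r"
  proof -
    have "r \<in> ball r \<delta>\<^sub>0" using \<delta>\<^sub>0 by simp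
    from dY[OF this] show ?thesis using has_derivative_continuous by blast
  qed
  then obtain \<delta>\<^sub>1 where \<delta>\<^sub>1: "\<delta>\<^sub>1 > 0" "\<And>v. dist v r < \<delta>\<^sub>1 \<Longrightarrow> dist (Y v) (Y r) < 1"
    unfolding continuous_at_eps_delta by (metis zero_less_one)
  define B where "B = norm (Y r) + 1"
  define \<delta>\<^sub>2 where "\<delta>\<^sub>2 = min \<delta>\<^sub>0 \<delta>\<^sub>1"
  have Ybound: "norm (Y v) < B" if "v \<in> ball r \<delta>\<^sub>2" for v
  proof -
    have "norm (Y v - Y r) < 1" using \<delta>\<^sub>1(2)[of v] that by (simp add: \<delta>\<^sub>2_def dist_norm norm_minus_commute)
    then show ?thesis using norm_triangle_ineq2[of "Y v" "Y r"] by (simp add: B_def)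
  qed
  \<comment> \<open>With \<open>cmod s < R\<close> the term \<open>hscale s x\<close> uses up at
    most half of \<open>\<delta>\<^sub>2\<close>.\<close>
  define R where "R = \<delta>\<^sub>2 / (2 * (norm x + 1))"
  have nx: "norm x + 1 > 0" using norm_ge_zero[of x] by linarith
  have \<delta>\<^sub>2: "\<delta>\<^sub>2 > 0" using \<delta>\<^sub>0 \<delta>\<^sub>1 by (simp add: \<delta>\<^sub>2_def)
  have R: "R > 0" using \<delta>\<^sub>2 nx by (simp add: R_def)
  have mem: "\<rho> + hscale s x \<in> ball r \<delta>\<^sub>2" if "norm (\<rho> - r) < \<delta>\<^sub>2 / 2" "cmod s < R" for \<rho> s
  proof -
    have "cmod s * norm x \<le> R * norm x" using that by (intro mult_right_mono) auto
    also have "\<dots> \<le> R * (norm x + 1)" using R by simp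
    also have "\<dots> = \<delta>\<^sub>2 / 2"
    proof -
      have "\<delta>\<^sub>2 / (2 * a) * a = \<delta>\<^sub>2 / 2" if "a > 0" for a using that by simp
      from this[OF nx] show ?thesis unfolding R_def .
    qed
    finally have "norm (hscale s x) \<le> \<delta>\<^sub>2 / 2" by (simp add: norm_hscale)
    moreover have "norm (\<rho> + hscale s x - r) \<le> norm (\<rho> - r) + norm (hscale s x)"
      using norm_triangle_ineq[of "\<rho> - r" "hscale s x"] by (simp add: algebra_simps)
    ultimately show ?thesis using that(1) by (simp add: dist_norm norm_minus_commute)
  qed
  define C where "C = B / R * (norm X + 1) / cmod (hcoord k X)"
  show thesis
  proof (rule that[of "min (\<delta>\<^sub>2 / 2) R" C])
    show "min (\<delta>\<^sub>2 / 2) R > 0" using \<delta>\<^sub>2 R by simp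
    fix \<rho> and s :: real
    assume \<rho>: "\<rho> \<in> rad" "norm (\<rho> - r) < min (\<delta>\<^sub>2 / 2) R" and s: "0 < s" "s < min (\<delta>\<^sub>2 / 2) R"
    have ball: "\<rho> + hscale t x \<in> ball r \<delta>\<^sub>2" "\<rho> + hscale t x \<in> ball r \<delta>\<^sub>0" if "t \<in> ball 0 R" for t
      using mem[of \<rho> t] \<rho>(2) that by (auto simp: \<delta>\<^sub>2_def)
    define h where "h t = hcoord k (Y (\<rho> + hscale t x))" for t
    have "cderiv_on (ball 0 R) (\<lambda>t. Y (\<rho> + hscale t x))" by (rule lift_along_line[OF dY[OF ball(2)]])
    then have h_hol: "h holomorphic_on ball 0 R" unfolding h_def by (rule cderiv_on_hcoord) simp
    have "Y \<rho> \<in> rad" using Yrad[OF _ \<rho>(1)] ball(2)[of 0] R by simp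
    then have h0: "h 0 = 0" using k(2) by (simp add: h_def)
    have hB: "cmod (h t) < B" if "t \<in> ball 0 R" for t
      using norm_hcoord_le[of k "Y (\<rho> + hscale t x)"] Ybound[OF ball(1)[OF that]] by (simp add: h_def)
    have sR: "of_real s \<in> ball (0::complex) R" using s by simp
    have hs: "cmod (h (of_real s)) \<le> B / R * s"
      using Schwarz_scaled[OF h_hol R h0 hB sR] s by simp
    define r' where "r' = hscale (inverse (of_real s)) \<rho>"
    have r': "r' \<in> rad" using rad_hscale \<rho>(1) by (simp add: r'_def)
    define \<psi> where "\<psi> = leafmap f x X r'"
    note \<psi> = leafmap[OF good x r', folded \<psi>_def]
    have v: "\<rho> + hscale (of_real s) x = hscale (of_real s) (x + r')"
      using s by (simp add: r'_def hscale_add_right hscale_hscale add.commute)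
    have cone: "x + r' \<in> ncone" using x(1) r' by (simp add: ncone_add_rad)
    then have "\<rho> + hscale (of_real s) x \<in> ncone" unfolding v using s by (simp add: ncone_hscale)
    then have "f (proj (\<rho> + hscale (of_real s) x)) = proj (Y (\<rho> + hscale (of_real s) x))"
      using Yf ball(2)[OF sR] by blast
    moreover have "proj (\<rho> + hscale (of_real s) x) = proj (x + r')"
      unfolding v using s ncone_nonzero[OF cone] by (simp add: proj_hscale)
    ultimately have eq: "proj (X + \<psi>) = proj (Y (\<rho> + hscale (of_real s) x))" using \<psi>(2) by simp
    have Yj1: "hcoord j (Y (\<rho> + hscale (of_real s) x)) = 1" using Yj ball(2)[OF sR] by blast
    then have "Y (\<rho> + hscale (of_real s) x) \<noteq> 0" by auto
    moreover have "X + \<psi> \<noteq> 0" using ncone_add_rad[OF \<psi>(1), of X] x(2) ncone_nonzero by blast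
    ultimately obtain c where c: "Y (\<rho> + hscale (of_real s) x) = hscale c (X + \<psi>)"
      using eq proj_eqD by blast
    have cj: "c * hcoord j (X + \<psi>) = 1" using Yj1 c by (simp add: hcoord_hscale)
    \<comment> \<open>The normalisation of coordinate \<open>j\<close> to 1 determines
      \<open>c\<close>, so the product of \<open>h\<close> and coordinate \<open>j\<close> of
      \<open>X + \<psi>\<close> is the nonzero constant \<open>hcoord k X\<close>: where
      \<open>h\<close> is small, \<open>\<psi>\<close> must be large.\<close>
    have "h (of_real s) = c * hcoord k X" unfolding h_def c by (simp add: hcoord_hscale hcoord_add k(2)[OF \<psi>(1)])
    then have "h (of_real s) * hcoord j (X + \<psi>) = hcoord k X" using cj by (simp add: mult_ac)
    then have "cmod (hcoord k X) = cmod (h (of_real s)) * cmod (hcoord j (X + \<psi>))" by (metis norm_mult)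
    also have "\<dots> \<le> (B / R * s) * norm (X + \<psi>)"
      using hs norm_hcoord_le[of j "X + \<psi>"] s R by (intro mult_mono) (auto simp: B_def)
    also have "\<dots> \<le> (B / R * s) * ((norm X + 1) * (1 + norm \<psi>))"
    proof (rule mult_left_mono)
      show "norm (X + \<psi>) \<le> (norm X + 1) * (1 + norm \<psi>)"
      proof -
        have "(norm X + 1) * (1 + norm \<psi>) = 1 + norm X + norm \<psi> + norm X * norm \<psi>"
          by (simp add: algebra_simps)
        then show ?thesis
          using norm_triangle_ineq[of X \<psi>] mult_nonneg_nonneg[OF norm_ge_zero[of X] norm_ge_zero[of \<psi>]]
          by linarith
      qed
      show "0 \<le> B / R * s" using s R by (simp add: B_def)
    qed
    finally have "cmod (hcoord k X) \<le> (B / R * (norm X + 1)) * s * (1 + norm \<psi>)" by (simp add: mult_ac)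
    then have "cmod (hcoord k X) / cmod (hcoord k X) \<le> (B / R * (norm X + 1)) * s * (1 + norm \<psi>) / cmod (hcoord k X)"
      by (rule divide_right_mono) simp
    then have "1 \<le> (B / R * (norm X + 1)) * s * (1 + norm \<psi>) / cmod (hcoord k X)"
      using k(1) by (simp only: divide_self_if) simp
    then show "1 \<le> C * s * (1 + norm (leafmap f x X (hscale (inverse (of_real s)) \<rho>)))"
      unfolding \<psi>_def[symmetric] r'_def[symmetric] by (simp add: C_def)
  qed
qed

text \<open>Normalise a sequence violating the bound. It accumulates on the compact unit sphere of
  the radical, and the local estimate at the limit, with \<open>s\<close> the inverse of the norm,
  contradicts the violation.\<close>

lemma leafmap_growth:
  assumes x: "x \<in> ncone" "X \<in> ncone" "f (proj x) = proj X"
  shows "\<exists>C\<ge>0. \<forall>r\<in>rad. norm r \<le> C * (1 + norm (leafmap f x X r))"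
proof (rule ccontr)
  let ?\<psi> = "leafmap f x X"
  assume "\<not> ?thesis"
  then have "\<exists>r\<in>rad. norm r > real n * (1 + norm (?\<psi> r))" for n by (metis not_le of_nat_0_le_iff)
  then obtain r where r: "\<And>n. r n \<in> rad" "\<And>n. norm (r n) > real n * (1 + norm (?\<psi> (r n)))" by metis
  have rn: "norm (r n) > real n" for n
  proof -
    have "real n \<le> real n * (1 + norm (?\<psi> (r n)))" by (simp add: mult_le_cancel_left1)
    then show ?thesis using r(2)[of n] by simp
  qed
  have r0: "norm (r n) > 0" for n using rn[of n] by (meson of_nat_0_le_iff le_less_trans)
  define \<rho> where "\<rho> n = hscale (inverse (of_real (norm (r n)))) (r n)" for n
  have \<rho>: "\<rho> n \<in> rad" "norm (\<rho> n) = 1" for n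
    using r0[of n] rad_hscale r(1) by (simp_all add: \<rho>_def norm_hscale norm_inverse)
  have "compact (rad \<inter> sphere 0 1)" using closed_rad by (simp add: closed_Int_compact)
  moreover have "\<rho> n \<in> rad \<inter> sphere 0 1" for n using \<rho> by simp
  ultimately obtain r' \<phi> where r': "r' \<in> rad \<inter> sphere 0 1" and \<phi>: "strict_mono \<phi>" "(\<rho> \<circ> \<phi>) \<longlonglongrightarrow> r'"
    unfolding compact_def by metis
  have r'0: "r' \<in> rad" "r' \<noteq> 0" using r' by auto
  obtain \<delta> C where \<delta>: "\<delta> > 0" and C: "\<And>\<rho> s. \<rho> \<in> rad \<Longrightarrow> norm (\<rho> - r') < \<delta> \<Longrightarrow> 0 < s \<Longrightarrow> s < \<delta> \<Longrightarrow>
    1 \<le> C * s * (1 + norm (?\<psi> (hscale (inverse (of_real s)) \<rho>)))"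
    using leafmap_growth_local[OF x r'0] by blast
  have "eventually (\<lambda>n. norm ((\<rho> \<circ> \<phi>) n - r') < \<delta>) sequentially"
    using \<phi>(2) \<delta> by (simp add: tendsto_iff dist_norm)
  moreover have "eventually (\<lambda>n. inverse \<delta> < real n \<and> C \<le> real n \<and> 0 < real n) sequentially"
    by (intro eventually_conj eventually_compose_filterlim[OF eventually_gt_at_top filterlim_real_sequentially]
        eventually_compose_filterlim[OF eventually_ge_at_top filterlim_real_sequentially])
  ultimately have "eventually (\<lambda>n. False) sequentially"
  proof eventually_elim
    case (elim n)
    define m where "m = \<phi> n"
    have mn: "real n \<le> real m" using seq_suble[OF \<phi>(1), of n] by (simp add: m_def)
    define s where "s = inverse (norm (r m))"
    have "norm (r m) > inverse \<delta>" using rn[of m] mn elim by linarith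
    then have s: "0 < s" "s < \<delta>"
      using r0[of m] \<delta> by (simp_all add: s_def inverse_less_iff_less[symmetric, of "inverse \<delta>" "norm (r m)"])
        (metis inverse_inverse_eq inverse_positive_iff_positive less_imp_inverse_less)
    have "hscale (inverse (of_real s)) (\<rho> m) = r m"
      using r0[of m] by (simp add: s_def \<rho>_def hscale_hscale)
    then have "1 \<le> C * s * (1 + norm (?\<psi> (r m)))"
      using C[OF \<rho>(1)[of m] _ s] elim by (simp add: m_def)
    then have "norm (r m) \<le> C * (1 + norm (?\<psi> (r m)))"
      using r0[of m] by (simp add: s_def field_simps)
    also have "\<dots> \<le> real m * (1 + norm (?\<psi> (r m)))" using elim mn by (intro mult_right_mono) auto
    finally show False using r(2)[of m] by simp
  qed
  then show False by simp
qed

text \<open>The growth estimate bounds \<open>\<psi>\<close> from below, that is, its inverse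
  \<open>\<theta>\<close> from above. So \<open>\<theta>\<close> is affine on complex lines by
  Liouville, and \<open>\<psi>\<close> inherits this as its inverse. With
  \<open>\<psi> 0 = 0\<close> it is homogeneous, and the value at a midpoint gives
  additivity.\<close>

lemma leafmap_linear:
  assumes x: "x \<in> ncone" "X \<in> ncone" "f (proj x) = proj X" and r: "r \<in> rad" "r' \<in> rad"
  shows "leafmap f x X (r + r') = leafmap f x X r + leafmap f x X r'"
    and "leafmap f x X (hscale c r) = hscale c (leafmap f x X r)"
    and "leafmap f x X r = 0 \<Longrightarrow> r = 0"
proof -
  let ?h = "inv_into M f"
  define \<psi> where "\<psi> = leafmap f x X"
  define \<theta> where "\<theta> = leafmap ?h X x"
  have xM: "proj x \<in> M" using x by (simp add: M_def)
  have hX: "?h (proj X) = proj x" using goodD(6)[OF good xM] x(3) by simp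
  note \<psi> = leafmap[OF good x, folded \<psi>_def]
  note \<theta> = leafmap[OF good_inv[OF good] x(2,1) hX, folded \<theta>_def]
  have \<theta>\<psi>: "\<theta> (\<psi> r) = r" if r: "r \<in> rad" for r
  proof -
    have "proj (x + r) \<in> M" using x(1) r by (simp add: M_def ncone_add_rad)
    from goodD(6)[OF good this] have "?h (proj (X + \<psi> r)) = proj (x + r)" using \<psi>(2)[OF r] by simp
    then show ?thesis unfolding \<theta>_def by (rule leafmap_eq[OF x(1) r])
  qed
  have \<psi>\<theta>: "\<psi> (\<theta> r) = r" if r: "r \<in> rad" for r
  proof -
    have "proj (X + r) \<in> M" using x(2) r by (simp add: M_def ncone_add_rad)
    from goodD(5)[OF good this] have "f (proj (x + \<theta> r)) = proj (X + r)" using \<theta>(2)[OF r] by simp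
    then show ?thesis unfolding \<psi>_def by (rule leafmap_eq[OF x(2) r])
  qed
  have \<psi>0: "\<psi> 0 = 0" unfolding \<psi>_def by (rule leafmap_eq[OF x(2)]) (use x in simp_all)
  obtain C where C: "C \<ge> 0" "\<And>r. r \<in> rad \<Longrightarrow> norm r \<le> C * (1 + norm (\<psi> r))"
    using leafmap_growth[OF x] unfolding \<psi>_def by blast
  have \<theta>_growth: "norm (\<theta> r) \<le> C * (1 + norm r)" if "r \<in> rad" for r
    using C(2)[OF \<theta>(1)[OF that]] \<psi>\<theta>[OF that] by simp
  have line_rad: "a + hscale t b \<in> rad" if "a \<in> rad" "b \<in> rad" for a b t
    using that by (intro rad_add rad_hscale)
  have \<theta>_affine: "\<theta> (a + hscale t b) = \<theta> a + hscale t (\<theta> (a + b) - \<theta> a)"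
    if ab: "a \<in> rad" "b \<in> rad" for a b t
  proof (rule hcoord_eqI)
    fix i
    let ?g = "\<lambda>t. hcoord i (\<theta> (a + hscale t b))"
    have "?g t = ?g 0 + t * (?g 1 - ?g 0)"
    proof (rule entire_linear_growth[where A = 1 and B = "C * (1 + norm a + norm b)"])
      show "?g holomorphic_on UNIV"
        unfolding \<theta>_def by (rule leafmap_holomorphic[OF good_inv[OF good] x(2,1) hX ab])
      fix t :: complex assume t: "1 \<le> cmod t"
      have "cmod (?g t) \<le> norm (\<theta> (a + hscale t b))" by (rule norm_hcoord_le)
      also have "\<dots> \<le> C * (1 + norm (a + hscale t b))" using \<theta>_growth[OF line_rad[OF ab]] .
      also have "\<dots> \<le> C * ((1 + norm a + norm b) * cmod t)"
      proof (rule mult_left_mono[OF _ C(1)])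
        have "norm (a + hscale t b) \<le> norm a + cmod t * norm b"
          using norm_triangle_ineq[of a "hscale t b"] by (simp add: norm_hscale)
        moreover have "norm a \<le> cmod t * norm a" using mult_right_mono[OF t norm_ge_zero[of a]] by simp
        ultimately show "1 + norm (a + hscale t b) \<le> (1 + norm a + norm b) * cmod t"
          using t by (simp add: algebra_simps)
      qed
      finally show "cmod (?g t) \<le> C * (1 + norm a + norm b) * cmod t" by (simp add: mult.assoc)
    qed
    then show "hcoord i (\<theta> (a + hscale t b)) = hcoord i (\<theta> a + hscale t (\<theta> (a + b) - \<theta> a))"
      by (simp add: hcoord_add hcoord_hscale hcoord_diff)
  qed
  have \<psi>_affine: "\<psi> (a + hscale t b) = \<psi> a + hscale t (\<psi> (a + b) - \<psi> a)"
    if ab: "a \<in> rad" "b \<in> rad" for a b t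
  proof -
    have ab': "a + b \<in> rad" using ab by (rule rad_add)
    let ?d = "\<psi> (a + b) - \<psi> a"
    have d: "?d \<in> rad" using \<psi>(1) ab ab' by (intro rad_diff)
    have "\<theta> (\<psi> a + hscale t ?d) = \<theta> (\<psi> a) + hscale t (\<theta> (\<psi> a + ?d) - \<theta> (\<psi> a))"
      by (rule \<theta>_affine[OF \<psi>(1)[OF ab(1)] d])
    also have "\<dots> = a + hscale t b" using \<theta>\<psi> ab ab' by simp
    finally have "\<psi> (\<theta> (\<psi> a + hscale t ?d)) = \<psi> (a + hscale t b)" by simp
    then show ?thesis using \<psi>\<theta>[OF line_rad[OF \<psi>(1)[OF ab(1)] d]] by simp
  qed
  have hom: "\<psi> (hscale c r) = hscale c (\<psi> r)" if "r \<in> rad" for c r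
    using \<psi>_affine[OF rad_0 that, of c] \<psi>0 by simp
  show "leafmap f x X (hscale c r) = hscale c (leafmap f x X r)" using hom[OF r(1)] by (simp add: \<psi>_def)
  have "\<psi> (r + hscale (1 / 2) (r' - r)) = \<psi> r + hscale (1 / 2) (\<psi> r' - \<psi> r)"
    using \<psi>_affine[OF r(1) rad_diff[OF r(2,1)], of "1 / 2"] by simp
  moreover have "r + hscale (1 / 2) (r' - r) = hscale (1 / 2) (r + r')"
    by (rule hcoord_eqI) (simp add: hcoord_add hcoord_hscale hcoord_diff field_simps)
  ultimately have "hscale (1 / 2) (\<psi> (r + r')) = hscale (1 / 2) (\<psi> r + \<psi> r')"
    using hom[OF rad_add[OF r]] by (simp add: hcoord_eqI hcoord_add hcoord_hscale hcoord_diff field_simps)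
  then have "hscale 2 (hscale (1 / 2) (\<psi> (r + r'))) = hscale 2 (hscale (1 / 2) (\<psi> r + \<psi> r'))" by simp
  then show "leafmap f x X (r + r') = leafmap f x X r + leafmap f x X r'"
    by (simp add: hscale_hscale \<psi>_def)
  show "leafmap f x X r = 0 \<Longrightarrow> r = 0"
    using \<theta>\<psi>[OF r(1)] \<theta>\<psi>[OF rad_0] \<psi>0 by (simp add: \<psi>_def)
qed

end


section \<open>Homogeneous functions that are additive on null pairs\<close>

context definite_quadric
begin

text \<open>With \<open>c = a pinf\<close>, the function \<open>A z = a (1, z, w) - c w\<close> is well defined. For non-real \<open>l\<close>
  and given \<open>z\<^sub>1\<close>, \<open>z\<^sub>2\<close>, the free real parameter in \<open>(1, z\<^sub>1, w\<^sub>1)\<close> can be chosen such that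
  \<open>H (l (1, z\<^sub>1, w\<^sub>1)) ((1 - l) (1, z\<^sub>2, w\<^sub>2))\<close> is imaginary; thus \<open>A\<close> is affine on complex lines.\<close>

lemma linear_if_additive_on_null_pairs:
  fixes a :: "'n homog \<Rightarrow> complex"
  assumes hom: "\<And>c x. x \<in> ncone \<Longrightarrow> c \<noteq> 0 \<Longrightarrow> a (hscale c x) = c * a x"
    and add: "\<And>u v. u \<in> ncone \<Longrightarrow> v \<in> ncone \<Longrightarrow> u + v \<in> ncone \<Longrightarrow> Re (H u v) = 0 \<Longrightarrow> a (u + v) = a u + a v"
  obtains l where "\<And>u v. l (u + v) = l u + l v" "\<And>c v. l (hscale c v) = c * l v" "\<And>x. x \<in> ncone \<Longrightarrow> a x = l x"
proof -
  define c where "c = a pinf"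
  define A where "A z = a (npt z 0) - \<i> * herm z z * c" for z
  have vert: "a (npt z \<tau>) = A z + (\<i> * herm z z + of_real \<tau>) * c" for z \<tau>
  proof (cases "\<tau> = 0")
    case False
    have eq: "npt z 0 + hscale (of_real \<tau>) pinf = npt z \<tau>" by (rule homog_eqI) simp_all
    have p: "hscale (of_real \<tau>) pinf \<in> ncone" using False pinf_in_ncone by (simp add: ncone_hscale)
    have "a (npt z 0 + hscale (of_real \<tau>) pinf) = a (npt z 0) + a (hscale (of_real \<tau>) pinf)"
      by (rule add[OF npt_ncone p]) (simp_all add: eq npt_ncone H_hscale H_pinf)
    then show ?thesis unfolding eq using hom[OF pinf_in_ncone, of "of_real \<tau>"] False
      by (simp add: A_def c_def algebra_simps)
  qed (simp add: A_def)
  have nonreal: "A (l *s z\<^sub>1 + (1 - l) *s z\<^sub>2) = l * A z\<^sub>1 + (1 - l) * A z\<^sub>2" if l: "Im l \<noteq> 0" for l z\<^sub>1 z\<^sub>2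
  proof -
    define \<kappa> where "\<kappa> = l * cnj (1 - l)"
    have im: "Im \<kappa> = Im l" by (simp add: \<kappa>_def algebra_simps)
    define h0 where "h0 = H (npt z\<^sub>1 0) (npt z\<^sub>2 0)"
    \<comment> \<open>The vertical shift by \<open>\<tau>\<close> changes the real part of
      \<open>H ?u ?v\<close> by \<open>Im l * \<tau> / 2\<close>, so it can be made zero.\<close>
    define \<tau> where "\<tau> = - 2 * Re (\<kappa> * h0) / Im l"
    let ?u = "hscale l (npt z\<^sub>1 \<tau>)" and ?v = "hscale (1 - l) (npt z\<^sub>2 0)"
    have l01: "l \<noteq> 0" "1 - l \<noteq> 0" using l by auto
    have "npt z\<^sub>1 \<tau> = npt z\<^sub>1 0 + hscale (of_real \<tau>) pinf" by (rule homog_eqI) simp_all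
    then have "H (npt z\<^sub>1 \<tau>) (npt z\<^sub>2 0) = h0 + of_real \<tau> / (2 * \<i>)"
      by (simp add: H_add H_hscale H_pinf h0_def)
    then have Huv: "H ?u ?v = \<kappa> * h0 + \<kappa> * (of_real \<tau> / (2 * \<i>))"
      by (simp add: H_hscale \<kappa>_def algebra_simps)
    have "Re (\<kappa> * (of_real \<tau> / (2 * \<i>))) = Im \<kappa> * \<tau> / 2"
      by (simp add: complex_eq_iff Re_divide Im_divide field_simps power2_eq_square)
    then have "Re (H ?u ?v) = Re (\<kappa> * h0) + Im l * \<tau> / 2"
      unfolding Huv plus_complex.simps im by (simp only:)
    moreover have "Im l * \<tau> = - 2 * Re (\<kappa> * h0)" using l by (simp add: \<tau>_def)
    ultimately have re: "Re (H ?u ?v) = 0" by linarith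
    have u: "?u \<in> ncone" and v: "?v \<in> ncone" using npt_ncone l01 by (simp_all add: ncone_hscale)
    have f1: "fst (?u + ?v) = 1" by simp
    have null: "H (?u + ?v) (?u + ?v) = 0" using u v re by (intro H_add_null) (simp_all add: ncone_def)
    have uv: "?u + ?v \<in> ncone" using null f1 by (simp add: ncone_def rad_def)
    have "a (?u + ?v) = l * a (npt z\<^sub>1 \<tau>) + (1 - l) * a (npt z\<^sub>2 0)"
      using add[OF u v uv re] hom[OF npt_ncone l01(1)] hom[OF npt_ncone l01(2)] by simp
    moreover obtain \<sigma> where \<sigma>: "?u + ?v = npt (fst (snd (?u + ?v))) \<sigma>"
      "snd (snd (?u + ?v)) = \<i> * herm (fst (snd (?u + ?v))) (fst (snd (?u + ?v))) + of_real \<sigma>"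
      using eq_npt[OF null f1] .
    have "a (?u + ?v) = A (l *s z\<^sub>1 + (1 - l) *s z\<^sub>2) + snd (snd (?u + ?v)) * c"
      unfolding \<sigma>(2) using vert[of "fst (snd (?u + ?v))" \<sigma>] unfolding \<sigma>(1)[symmetric] by simp
    moreover have "snd (snd (?u + ?v)) = l * (\<i> * herm z\<^sub>1 z\<^sub>1 + of_real \<tau>) + (1 - l) * (\<i> * herm z\<^sub>2 z\<^sub>2)"
      by simp
    ultimately show ?thesis using vert[of z\<^sub>1 \<tau>] vert[of z\<^sub>2 0] by (simp add: algebra_simps)
  qed
  have affine: "A (z + t *s v) = A z + t * (A (z + v) - A z)" for z v t
  proof -
    have line: "A (z + t *s v) = A z + t * (A (z + v) - A z)" if "Im t \<noteq> 0" for t z v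
    proof -
      have "t *s (z + v) + (1 - t) *s z = z + t *s v" by (simp add: vec_eq_iff algebra_simps)
      then show ?thesis using nonreal[OF that, of "z + v" z] by (simp add: algebra_simps)
    qed
    show ?thesis
    proof (cases "Im t = 0 \<and> t \<noteq> 0")
      case True
      \<comment> \<open>A real \<open>t\<close> is the product of the non-real parameters
        \<open>- \<i> * t\<close> and \<open>\<i>\<close>, and the affine law is applied for
        each.\<close>
      have "Im (- \<i> * t) \<noteq> 0" using True by (auto simp: complex_eq_iff)
      note line[OF this, of z "\<i> *s v"]
      moreover have "(- \<i> * t) *s (\<i> *s v) = t *s v" by (simp add: vec_eq_iff algebra_simps)
      moreover have "A (z + \<i> *s v) - A z = \<i> * (A (z + v) - A z)" using line[of \<i> z v] by simp
      ultimately have "A (z + t *s v) = A z + (- \<i> * t) * (\<i> * (A (z + v) - A z))" by (simp only:)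
      then show ?thesis by (simp add: mult.assoc mult.left_commute[of t])
    qed (use line in auto)
  qed
  note lin = affine_if_affine_in_directions[of UNIV A]
  have A_add: "A (y + z) - A 0 = (A y - A 0) + (A z - A 0)" for y z
    by (rule lin(1)) (use affine in \<open>auto intro!: exI[of _ 1], metis add_0\<close>)
  have A_hom: "A (t *s z) - A 0 = t * (A z - A 0)" for t z
    by (rule lin(2)) (use affine in \<open>auto intro!: exI[of _ 1], metis add_0\<close>)
  define l where "l y = fst y * A 0 + (A (fst (snd y)) - A 0) + snd (snd y) * c" for y
  have l_add: "l (u + v) = l u + l v" for u v
    using A_add[of "fst (snd u)" "fst (snd v)"] by (simp add: l_def algebra_simps)
  have l_hom: "l (hscale t v) = t * l v" for t v
    using A_hom[of t "fst (snd v)"] by (simp add: l_def algebra_simps)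
  have al1: "a x = l x" if x: "x \<in> ncone" "fst x = 1" for x
  proof -
    have "H x x = 0" using x by (simp add: ncone_def)
    then obtain \<tau> where \<tau>: "x = npt (fst (snd x)) \<tau>"
      "snd (snd x) = \<i> * herm (fst (snd x)) (fst (snd x)) + of_real \<tau>" using eq_npt x(2) by metis
    have "a x = A (fst (snd x)) + snd (snd x) * c"
      unfolding \<tau>(2) using vert[of "fst (snd x)" \<tau>] unfolding \<tau>(1)[symmetric] .
    then show ?thesis using x(2) by (simp add: l_def)
  qed
  have al: "a x = l x" if x: "x \<in> ncone" for x
  proof (cases "fst x = 0")
    case False
    have "hscale (inverse (fst x)) x \<in> ncone" using x False by (simp add: ncone_hscale)
    then have "a (hscale (inverse (fst x)) x) = l (hscale (inverse (fst x)) x)" using False by (intro al1) simp_all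
    then show ?thesis using hom[OF x, of "inverse (fst x)"] l_hom False by simp
  next
    case True
    define w where "w = snd (snd x)"
    note w = leaf_at_infinity[OF x True, folded w_def]
    define y where "y = hscale (inverse w) x"
    have y: "y \<in> ncone" using x w(1) by (simp add: y_def ncone_hscale)
    have fy: "fst y = 0" "snd (snd y) = 1" using True w(1) by (simp_all add: y_def w_def)
    \<comment> \<open>The normalisation of w to 1 makes this imaginary, so additivity applies to the
      sum with the origin. The sum is finite, where \<open>a = l\<close> is already known.\<close>
    have H: "H (npt 0 0) y = \<i> / 2"
      using fy by (simp add: H_def field_simps)
    have null: "H (npt 0 0 + y) (npt 0 0 + y) = 0"
      using y npt_ncone[of 0 0] by (intro H_add_null) (simp_all add: ncone_def H)
    have s: "npt 0 0 + y \<in> ncone" using null fy by (simp add: ncone_def rad_def)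
    have "a (npt 0 0 + y) = a (npt 0 0) + a y" by (rule add[OF npt_ncone y s]) (simp add: H)
    moreover have "a (npt 0 0 + y) = l (npt 0 0 + y)" by (rule al1[OF s]) (simp add: fy)
    moreover have "a (npt 0 0) = l (npt 0 0)" by (rule al1[OF npt_ncone]) simp
    ultimately have "a y = l y" by (simp add: l_add)
    then show ?thesis using hom[OF x, of "inverse w"] w(1) by (simp add: y_def l_hom)
  qed
  show thesis by (rule that[of l]) (fact l_add l_hom al)+
qed

end

section \<open>The linear map in the semidefinite case\<close>

context definite_map
begin

text \<open>Normalise the representative \<open>X\<close> of the image of \<open>x\<close> by prescribing its leaf map at a fixed
  \<open>s\<^sub>0\<close>.\<close>

lemma linear: "\<exists>T. clin T \<and> surj T \<and> (\<forall>x\<in>ncone. f (proj x) = proj (T x))"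
proof -
  obtain j\<^sub>0 where "eps j\<^sub>0 = 0" using eps_zero by blast
  define s\<^sub>0 :: "'n homog" where "s\<^sub>0 = (0, axis j\<^sub>0 1, 0)"
  have s\<^sub>0: "s\<^sub>0 \<in> rad" "s\<^sub>0 \<noteq> 0"
    using \<open>eps j\<^sub>0 = 0\<close> by (auto simp: s\<^sub>0_def rad_def axis_component zero_prod_def axis_eq_0_iff)
  obtain \<delta> j Y where \<delta>: "\<delta> > 0" and Yj: "\<And>v. v \<in> ball s\<^sub>0 \<delta> \<Longrightarrow> hcoord j (Y v) = 1"
    and dY: "\<And>v. v \<in> ball s\<^sub>0 \<delta> \<Longrightarrow> \<exists>A. clin A \<and> (Y has_derivative A) (at v)"
    and Yrad: "\<And>v. v \<in> ball s\<^sub>0 \<delta> \<Longrightarrow> v \<in> rad \<Longrightarrow> Y v \<in> rad"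
    and Yf: "\<And>v. v \<in> ball s\<^sub>0 \<delta> \<Longrightarrow> v \<in> ncone \<Longrightarrow> f (proj v) = proj (Y v)"
    by (rule lift_near_sing[OF s\<^sub>0]) (rule that; assumption)
  have s0b: "s\<^sub>0 \<in> ball s\<^sub>0 \<delta>" using \<delta> by simp
  define s\<^sub>1 where "s\<^sub>1 = Y s\<^sub>0"
  have s\<^sub>1: "s\<^sub>1 \<in> rad" "hcoord j s\<^sub>1 = 1" using Yrad[OF s0b s\<^sub>0(1)] Yj[OF s0b] by (simp_all add: s\<^sub>1_def)
  then have s\<^sub>1nz: "s\<^sub>1 \<noteq> 0" by auto
  obtain A where A: "clin A" "(Y has_derivative A) (at s\<^sub>0)" using dY[OF s0b] by blast
  have contY: "isCont (\<lambda>s. Y (s\<^sub>0 + hscale s x)) 0" for x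
  proof -
    have "isCont (\<lambda>s. s\<^sub>0 + hscale s x) 0"
      using continuous_on_line[of UNIV s\<^sub>0 x] by (simp add: continuous_on_eq_continuous_at)
    moreover have "isCont Y (s\<^sub>0 + hscale 0 x)" using has_derivative_continuous[OF A(2)] by simp
    ultimately show ?thesis by (rule isCont_o2)
  qed
  have small: "s\<^sub>0 + hscale s x \<in> ball s\<^sub>0 \<delta> \<longleftrightarrow> cmod s * norm x < \<delta>" for s x
    by (simp add: dist_norm norm_hscale)
  have ncone_line: "s\<^sub>0 + hscale s x \<in> ncone" if "x \<in> ncone" "s \<noteq> 0" for s x
    using that s\<^sub>0(1) by (intro rad_add_ncone)
  have line_scale: "proj (s\<^sub>0 + hscale s x) = proj (x + hscale (inverse s) s\<^sub>0)" if "x \<in> ncone" "s \<noteq> 0" for s x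
  proof -
    have "s\<^sub>0 + hscale s x = hscale s (x + hscale (inverse s) s\<^sub>0)"
      using that(2) by (simp add: hscale_add_right hscale_hscale add.commute)
    moreover have "x + hscale (inverse s) s\<^sub>0 \<noteq> 0"
      using that(1) ncone_add_rad[OF rad_hscale[OF s\<^sub>0(1)]] ncone_nonzero by blast
    ultimately show ?thesis using that(2) by (simp add: proj_hscale)
  qed
  have near0: "eventually (\<lambda>s. s \<noteq> 0 \<and> cmod s * norm x < \<delta>) (at (0::complex))" for x :: "'n homog"
  proof -
    have "((\<lambda>s::complex. cmod s * norm x) \<longlongrightarrow> cmod 0 * norm x) (at 0)" by (intro tendsto_intros)
    then have "eventually (\<lambda>s::complex. cmod s * norm x < \<delta>) (at 0)" using \<delta> by (intro order_tendstoD(2)) auto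
    then show ?thesis using eventually_neq_at_within[of "0::complex"] by eventually_elim simp
  qed
  \<comment> \<open>Along \<open>s\<^sub>0 + hscale s x\<close> there are two lifts of the image:
    \<open>Y\<close>, and the one built from \<open>X\<close> and its linear leaf map. At
    \<open>s = 0\<close> they give \<open>s\<^sub>1\<close> and the value of the leaf map at
    \<open>s\<^sub>0\<close>, which are thus proportional for every \<open>x\<close>; rescaling
    \<open>X\<close> makes them equal.\<close>
  have exX: "\<exists>X. X \<in> ncone \<and> f (proj x) = proj X \<and> leafmap f x X s\<^sub>0 = s\<^sub>1" if x: "x \<in> ncone" for x
  proof -
    obtain X where X: "X \<in> ncone" "f (proj x) = proj X" using image_rep[OF x] .
    let ?\<beta> = "leafmap f x X"
    note \<beta> = leafmap[OF good x X]
    have \<beta>0: "?\<beta> s\<^sub>0 \<noteq> 0" using leafmap_linear(3)[OF x X s\<^sub>0(1) s\<^sub>0(1)] s\<^sub>0(2) by blast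
    have "eventually (\<lambda>s. Y (s\<^sub>0 + hscale s x) \<noteq> 0 \<and> ?\<beta> s\<^sub>0 + hscale s X \<noteq> 0
        \<and> proj (Y (s\<^sub>0 + hscale s x)) = proj (?\<beta> s\<^sub>0 + hscale s X)) (at 0)"
      using near0[of x]
    proof eventually_elim
      case (elim s)
      then have b: "s\<^sub>0 + hscale s x \<in> ball s\<^sub>0 \<delta>" using small by blast
      have "hcoord j (Y (s\<^sub>0 + hscale s x)) = 1" using Yj[OF b] .
      then have Ynz: "Y (s\<^sub>0 + hscale s x) \<noteq> 0" by auto
      have r: "hscale (inverse s) s\<^sub>0 \<in> rad" using rad_hscale s\<^sub>0(1) by blast
      have "proj (Y (s\<^sub>0 + hscale s x)) = f (proj (x + hscale (inverse s) s\<^sub>0))"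
        using Yf[OF b ncone_line[OF x]] elim line_scale[OF x] by simp
      also have "\<dots> = proj (X + hscale (inverse s) (?\<beta> s\<^sub>0))"
        using \<beta>(2)[OF r] leafmap_linear(2)[OF x X s\<^sub>0(1) s\<^sub>0(1)] by simp
      also have "\<dots> = proj (hscale s (X + hscale (inverse s) (?\<beta> s\<^sub>0)))"
      proof (rule proj_hscale[symmetric])
        show "X + hscale (inverse s) (?\<beta> s\<^sub>0) \<noteq> 0"
          using X(1) ncone_add_rad[OF rad_hscale[OF \<beta>(1)[OF s\<^sub>0(1)]]] ncone_nonzero by blast
      qed (use elim in simp)
      also have "hscale s (X + hscale (inverse s) (?\<beta> s\<^sub>0)) = ?\<beta> s\<^sub>0 + hscale s X"
        using elim by (simp add: hscale_add_right hscale_hscale add.commute)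
      finally have "proj (Y (s\<^sub>0 + hscale s x)) = proj (?\<beta> s\<^sub>0 + hscale s X)" .
      moreover have "?\<beta> s\<^sub>0 + hscale s X \<noteq> 0"
        using rad_add_ncone[OF \<beta>(1)[OF s\<^sub>0(1)] X(1)] elim ncone_nonzero by blast
      ultimately show ?case using Ynz by simp
    qed
    from proj_eq_limit[OF contY _ _ _ this]
    have "proj s\<^sub>1 = proj (?\<beta> s\<^sub>0)"
      using continuous_on_line[of UNIV "?\<beta> s\<^sub>0" X] s\<^sub>1nz \<beta>0 by (simp add: continuous_on_eq_continuous_at s\<^sub>1_def)
    then obtain \<kappa> where \<kappa>: "\<kappa> \<noteq> 0" "?\<beta> s\<^sub>0 = hscale \<kappa> s\<^sub>1" using proj_eqD s\<^sub>1nz \<beta>0 by blast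
    let ?X = "hscale (inverse \<kappa>) X"
    have X': "?X \<in> ncone" "f (proj x) = proj ?X"
      using X \<kappa>(1) by (simp_all add: ncone_hscale proj_hscale ncone_nonzero)
    have "X + ?\<beta> s\<^sub>0 \<noteq> 0" using X(1) ncone_add_rad[OF \<beta>(1)[OF s\<^sub>0(1)]] ncone_nonzero by blast
    then have "f (proj (x + s\<^sub>0)) = proj (hscale (inverse \<kappa>) (X + ?\<beta> s\<^sub>0))"
      using \<beta>(2)[OF s\<^sub>0(1)] \<kappa>(1) by (simp add: proj_hscale)
    also have "hscale (inverse \<kappa>) (X + ?\<beta> s\<^sub>0) = ?X + s\<^sub>1" using \<kappa> by (simp add: hscale_add_right hscale_hscale)
    finally have "leafmap f x ?X s\<^sub>0 = s\<^sub>1" by (rule leafmap_eq[OF X'(1) s\<^sub>1(1)])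
    then show ?thesis using X' by blast
  qed
  then obtain Xf where Xf: "\<And>x. x \<in> ncone \<Longrightarrow> Xf x \<in> ncone" "\<And>x. x \<in> ncone \<Longrightarrow> f (proj x) = proj (Xf x)"
    and Xs: "\<And>x. x \<in> ncone \<Longrightarrow> leafmap f x (Xf x) s\<^sub>0 = s\<^sub>1" by metis
  define \<beta> where "\<beta> x = leafmap f x (Xf x)" for x
  have \<beta>: "\<beta> x r \<in> rad" "f (proj (x + r)) = proj (Xf x + \<beta> x r)" if "x \<in> ncone" "r \<in> rad" for x r
    unfolding \<beta>_def using leafmap[OF good that(1) Xf(1)[OF that(1)] Xf(2)[OF that(1)] that(2)] .
  have \<beta>_lin: "\<beta> x (r + r') = \<beta> x r + \<beta> x r'" "\<beta> x (hscale c r) = hscale c (\<beta> x r)"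
    if "x \<in> ncone" "r \<in> rad" "r' \<in> rad" for x r r' c
    unfolding \<beta>_def using leafmap_linear(1,2)[OF that(1) Xf(1)[OF that(1)] Xf(2)[OF that(1)] that(2,3)] .
  have \<beta>s: "\<beta> x s\<^sub>0 = s\<^sub>1" if "x \<in> ncone" for x using Xs[OF that] by (simp add: \<beta>_def)
  \<comment> \<open>The images of \<open>proj x\<close> and \<open>proj (x + s\<^sub>0)\<close> fix
    the scale of the representative, so homogeneity of \<open>Xf\<close> and its behaviour under
    radical shifts follow by checking candidates.\<close>
  have Xf_unique: "Xf x = X" if x: "x \<in> ncone" and X: "X \<in> ncone" "f (proj x) = proj X" "f (proj (x + s\<^sub>0)) = proj (X + s\<^sub>1)" for x X
  proof -
    obtain c where c: "c \<noteq> 0" "X = hscale c (Xf x)"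
      using proj_eqD[OF ncone_nonzero[OF Xf(1)[OF x]] ncone_nonzero[OF X(1)]] Xf(2)[OF x] X(2) by metis
    have nz: "X + s\<^sub>1 \<noteq> 0" "Xf x + s\<^sub>1 \<noteq> 0" using ncone_add_rad[OF s\<^sub>1(1)] X(1) Xf(1)[OF x] ncone_nonzero by blast+
    have "proj (Xf x + s\<^sub>1) = proj (X + s\<^sub>1)" using \<beta>(2)[OF x s\<^sub>0(1)] \<beta>s[OF x] X(3) by simp
    then obtain d where d: "X + s\<^sub>1 = hscale d (Xf x + s\<^sub>1)" using proj_eqD[OF nz(2,1)] by blast
    then have "hscale d (Xf x + s\<^sub>1) = hscale c (Xf x) + s\<^sub>1" using c by simp
    from leaf_coordinates[OF Xf(1)[OF x] s\<^sub>1(1) s\<^sub>1(1) this] have dc: "d = c" "s\<^sub>1 = hscale d s\<^sub>1" by blast+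
    have "d * hcoord j s\<^sub>1 = hcoord j s\<^sub>1" using arg_cong[OF dc(2), of "hcoord j"] by (simp add: hcoord_hscale)
    then show ?thesis using dc(1) c(2) s\<^sub>1(2) by simp
  qed
  have Xf_hom: "Xf (hscale c x) = hscale c (Xf x)" if x: "x \<in> ncone" and c: "c \<noteq> 0" for c x
  proof (rule Xf_unique)
    show cx: "hscale c x \<in> ncone" "hscale c (Xf x) \<in> ncone" using x c Xf(1) by (simp_all add: ncone_hscale)
    show "f (proj (hscale c x)) = proj (hscale c (Xf x))"
      using x c Xf by (simp add: proj_hscale ncone_nonzero)
    have r: "hscale (inverse c) s\<^sub>0 \<in> rad" using rad_hscale s\<^sub>0(1) by blast
    have nz: "x + hscale (inverse c) s\<^sub>0 \<noteq> 0" "Xf x + hscale (inverse c) s\<^sub>1 \<noteq> 0"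
      using ncone_add_rad[OF r, of x] ncone_add_rad[OF rad_hscale[OF s\<^sub>1(1)]] x Xf(1)[OF x] ncone_nonzero by blast+
    have eq: "hscale c x + s\<^sub>0 = hscale c (x + hscale (inverse c) s\<^sub>0)"
      "hscale c (Xf x) + s\<^sub>1 = hscale c (Xf x + hscale (inverse c) s\<^sub>1)"
      using c by (simp_all add: hscale_add_right hscale_hscale)
    have "f (proj (x + hscale (inverse c) s\<^sub>0)) = proj (Xf x + hscale (inverse c) s\<^sub>1)"
      using \<beta>(2)[OF x r] \<beta>_lin(2)[OF x s\<^sub>0(1) s\<^sub>0(1)] \<beta>s[OF x] by simp
    then show "f (proj (hscale c x + s\<^sub>0)) = proj (hscale c (Xf x) + s\<^sub>1)"
      unfolding eq using nz c by (simp add: proj_hscale)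
  qed
  have Xf_add_rad: "Xf (x + r) = Xf x + \<beta> x r" if x: "x \<in> ncone" and r: "r \<in> rad" for x r
  proof (rule Xf_unique)
    show "x + r \<in> ncone" "Xf x + \<beta> x r \<in> ncone" using x r Xf(1) \<beta>(1) by (simp_all add: ncone_add_rad)
    show "f (proj (x + r)) = proj (Xf x + \<beta> x r)" using \<beta>(2)[OF x r] .
    show "f (proj (x + r + s\<^sub>0)) = proj (Xf x + \<beta> x r + s\<^sub>1)"
      using \<beta>(2)[OF x rad_add[OF r s\<^sub>0(1)]] \<beta>_lin(1)[OF x r s\<^sub>0(1)] \<beta>s[OF x] by (simp add: add.assoc)
  qed
  define a where "a x = hcoord j (Xf x)" for x
  \<comment> \<open>Both sides lift the same point; the factor between the lifts is read off in
    coordinate \<open>j\<close>, where \<open>Y\<close> and \<open>s\<^sub>1\<close> are 1.\<close>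
  have Y_eq: "hscale (1 + s * a x) (Y (s\<^sub>0 + hscale s x)) = s\<^sub>1 + hscale s (Xf x)"
    if x: "x \<in> ncone" and s: "cmod s * norm x < \<delta>" for s x
  proof (cases "s = 0")
    case False
    have b: "s\<^sub>0 + hscale s x \<in> ball s\<^sub>0 \<delta>" using s small by blast
    have Y1: "hcoord j (Y (s\<^sub>0 + hscale s x)) = 1" using Yj[OF b] .
    then have Ynz: "Y (s\<^sub>0 + hscale s x) \<noteq> 0" by auto
    have sx: "hscale s x \<in> ncone" using x False by (simp add: ncone_hscale)
    have "proj (Y (s\<^sub>0 + hscale s x)) = f (proj (hscale s x + s\<^sub>0))"
      using Yf[OF b ncone_line[OF x False]] by (simp add: add.commute)
    also have "\<dots> = proj (hscale s (Xf x) + s\<^sub>1)"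
      using \<beta>(2)[OF sx s\<^sub>0(1)] \<beta>s[OF sx] Xf_hom[OF x False] by simp
    finally have eq: "proj (Y (s\<^sub>0 + hscale s x)) = proj (s\<^sub>1 + hscale s (Xf x))" by (simp add: add.commute)
    have "s\<^sub>1 + hscale s (Xf x) \<noteq> 0" using rad_add_ncone[OF s\<^sub>1(1) Xf(1)[OF x] False] ncone_nonzero by blast
    then obtain c where c: "s\<^sub>1 + hscale s (Xf x) = hscale c (Y (s\<^sub>0 + hscale s x))"
      using proj_eqD[OF Ynz _ eq] by blast
    from arg_cong[OF c, of "hcoord j"] have "c = 1 + s * a x"
      using Y1 s\<^sub>1(2) by (simp add: hcoord_add hcoord_hscale a_def)
    then show ?thesis using c by simp
  qed (simp add: s\<^sub>1_def)
  \<comment> \<open>Differentiate \<open>Y_eq\<close> at \<open>s = 0\<close>; the second term comes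
    from the factor \<open>1 + s * a x\<close>, since \<open>Y\<close> has the value
    \<open>s\<^sub>1\<close> there.\<close>
  have XA: "Xf x = A x + hscale (a x) s\<^sub>1" if x: "x \<in> ncone" for x
  proof -
    let ?g = "\<lambda>s. hscale (1 + s * a x) (Y (s\<^sub>0 + hscale s x))"
    have "((\<lambda>s. Y (s\<^sub>0 + hscale s x)) has_derivative (\<lambda>h. A (hscale h x))) (at 0)"
      by (rule has_derivative_compose[OF has_derivative_line]) (simp add: A(2))
    moreover have "((\<lambda>s. 1 + s * a x) has_derivative (\<lambda>h. h * a x)) (at 0)"
      by (auto intro!: derivative_eq_intros)
    ultimately have "(?g has_derivative (\<lambda>h. hscale (1 + 0 * a x) (A (hscale h x)) + hscale (h * a x) (Y (s\<^sub>0 + hscale 0 x)))) (at 0)"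
      by (intro hscale.FDERIV)
    then have d1: "(?g has_derivative (\<lambda>h. A (hscale h x) + hscale (h * a x) s\<^sub>1)) (at 0)" by (simp add: s\<^sub>1_def)
    have "((\<lambda>s. s\<^sub>1 + hscale s (Xf x)) has_derivative (\<lambda>h. hscale h (Xf x))) (at 0)" by (rule has_derivative_line)
    then have "(?g has_derivative (\<lambda>h. hscale h (Xf x))) (at 0)"
    proof (rule has_derivative_transform_eventually)
      show "eventually (\<lambda>s. s\<^sub>1 + hscale s (Xf x) = ?g s) (at 0)"
        using near0[of x] by eventually_elim (simp add: Y_eq[OF x])
    qed (simp_all add: s\<^sub>1_def)
    then have "(\<lambda>h. A (hscale h x) + hscale (h * a x) s\<^sub>1) = (\<lambda>h. hscale h (Xf x))"
      using d1 by (intro has_derivative_unique)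
    from fun_cong[OF this, of 1] show ?thesis by simp
  qed
  \<comment> \<open>Pairing with \<open>z\<close> kills the radical vector \<open>s\<^sub>1\<close>.
    What remains ties \<open>a\<close> to the holomorphic function \<open>H (Y _) z\<close>, in the
    shape that \<open>entire_extension\<close> asks for.\<close>
  have key: "(1 + s * a x) * H (Y (s\<^sub>0 + hscale s x)) z = s * H (A x) z"
    if x: "x \<in> ncone" "cmod s * norm x < \<delta>" for s x z
  proof -
    have "(1 + s * a x) * H (Y (s\<^sub>0 + hscale s x)) z = H (s\<^sub>1 + hscale s (Xf x)) z"
      using Y_eq[OF x] by (simp add: H_hscale(1)[symmetric])
    also have "\<dots> = s * H (A x) z"
      by (simp add: XA[OF x(1)] H_add H_hscale rad_H(1)[OF s\<^sub>1(1)])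
    finally show ?thesis .
  qed
  have HA: "H (A x) z = H (Xf x) z" if "x \<in> ncone" for x z
    by (simp add: XA[OF that] H_add H_hscale rad_H(1)[OF s\<^sub>1(1)])
  \<comment> \<open>Since \<open>Re (H u v) = 0\<close>, the vector \<open>u + b v\<close> is null
    for real \<open>b\<close>, but in general not for complex \<open>b\<close>. The extension of
    \<open>a\<close> to complex \<open>b\<close> comes from \<open>Y\<close>, which is defined off
    the quadric as well.\<close>
  have entire: "\<exists>E'. E' holomorphic_on UNIV \<and> (\<forall>b::real. E' (of_real b) = a (u + hscale (of_real b) v))"
    if u: "u \<in> ncone" and v: "v \<in> ncone" and Huv: "H u v \<noteq> 0" "Re (H u v) = 0" for u v
  proof -
    define k where "k = H (Xf u) (Xf v)"
    have k: "k \<noteq> 0" using image_H[OF u v Xf(1)[OF u] Xf(1)[OF v] Xf(2)[OF u] Xf(2)[OF v]] Huv(1) by (simp add: k_def)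
    have uv: "u + hscale (of_real b) v \<in> ncone" for b :: real
    proof -
      have "H (u + hscale (of_real b) v) (u + hscale (of_real b) v) = 0"
        using u v Huv(2) by (intro H_add_null) (simp_all add: ncone_def H_hscale)
      moreover have "u + hscale (of_real b) v \<notin> rad"
      proof
        assume "u + hscale (of_real b) v \<in> rad"
        then have "H (u + hscale (of_real b) v) v = 0" by (rule rad_H)
        then show False using Huv(1) v by (simp add: H_add H_hscale ncone_def)
      qed
      ultimately show ?thesis by (simp add: ncone_def)
    qed
    define G where "G s b = H (Y (s\<^sub>0 + hscale (of_real s) (u + hscale b v))) (Xf v) / k" for s :: real and b
    \<comment> \<open>\<open>Xf v\<close> is null, so the pairing does not depend on
      \<open>b\<close>; dividing by this \<open>k\<close> gives the limit 1 required of
      \<open>G\<close>.\<close>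
    have HAb: "H (A (u + hscale b v)) (Xf v) = k" for b
      using Xf(1)[OF v] by (simp add: clin_add[OF A(1)] clin_hscale[OF A(1)] H_add H_hscale HA[OF u] HA[OF v] k_def ncone_def)
    show ?thesis
    proof (rule entire_extension[of G "\<lambda>b. a (u + hscale (of_real b) v)"])
      fix R :: real assume R: "R > 0"
      \<comment> \<open>Exceeds the norm of \<open>u + hscale b v\<close> for
        \<open>cmod b < R\<close>, so \<open>s \<le> \<delta> / N\<close> keeps the argument of
        \<open>Y\<close> in its ball.\<close>
      define N where "N = norm u + R * norm v + 1"
      have N: "N > 0" using R by (simp add: N_def add_nonneg_pos)
      have bound: "s * norm (u + hscale b v) < \<delta>" if s: "0 < s" "s \<le> \<delta> / N" and b: "b \<in> ball 0 R" for s b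
      proof -
        have "norm (u + hscale b v) \<le> norm u + cmod b * norm v"
          using norm_triangle_ineq[of u "hscale b v"] by (simp add: norm_hscale)
        also have "\<dots> \<le> norm u + R * norm v" using b by (intro add_left_mono mult_right_mono) auto
        finally have "norm (u + hscale b v) < N" by (simp add: N_def)
        then have "s * norm (u + hscale b v) < s * N" using s(1) by simp
        also have "\<dots> \<le> \<delta>" using s(2) N by (simp add: field_simps)
        finally show ?thesis .
      qed
      show "\<exists>\<sigma>>0. \<forall>s. 0 < s \<longrightarrow> s \<le> \<sigma> \<longrightarrow> G s holomorphic_on ball 0 R \<and>
          (\<forall>b. \<bar>b\<bar> < R \<longrightarrow> (1 + of_real s * a (u + hscale (of_real b) v)) * G s (of_real b) = of_real s)"
      proof (intro exI[of _ "\<delta> / N"] conjI allI impI)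
        show "\<delta> / N > 0" using \<delta> N by simp
        fix s :: real assume s: "0 < s" "s \<le> \<delta> / N"
        have line: "s\<^sub>0 + hscale (of_real s) (u + hscale b v) = (s\<^sub>0 + hscale (of_real s) u) + hscale b (hscale (of_real s) v)" for b
          by (simp add: hscale_add_right hscale_hscale mult.commute add.assoc)
        have "cderiv_on (ball 0 R) (\<lambda>b. Y ((s\<^sub>0 + hscale (of_real s) u) + hscale b (hscale (of_real s) v)))"
        proof (rule lift_along_line)
          fix b assume "b \<in> ball (0::complex) R"
          then have "s\<^sub>0 + hscale (of_real s) (u + hscale b v) \<in> ball s\<^sub>0 \<delta>"
            using bound[OF s] s(1) unfolding small by simp
          then show "\<exists>A. clin A \<and> (Y has_derivative A) (at (s\<^sub>0 + hscale (of_real s) u + hscale b (hscale (of_real s) v)))"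
            unfolding line by (rule dY)
        qed
        then show "G s holomorphic_on ball 0 R"
          unfolding G_def line using k by (intro holomorphic_intros H_holomorphic) auto
        fix b :: real assume "\<bar>b\<bar> < R"
        then have "cmod (of_real s) * norm (u + hscale (of_real b) v) < \<delta>"
          using bound[OF s, of "of_real b"] s(1) by simp
        from key[OF uv this, of "Xf v"]
        show "(1 + of_real s * a (u + hscale (of_real b) v)) * G s (of_real b) = of_real s"
          using k HAb[of "of_real b"] by (simp add: G_def field_simps)
      qed
    next
      fix b
      let ?x = "u + hscale b v"
      have "((\<lambda>s. Y (s\<^sub>0 + hscale s ?x)) has_derivative (\<lambda>h. A (hscale h ?x))) (at 0)"
        by (rule has_derivative_compose[OF has_derivative_line]) (simp add: A(2))
      moreover have "bounded_linear (\<lambda>y. H y (Xf v))"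
      proof -
        have "linear (\<lambda>y. H y (Xf v))"
          by (rule linearI) (simp_all add: H_add H_hscale scaleR_conv_of_real flip: hscale_of_real)
        then show ?thesis by (simp add: linear_conv_bounded_linear)
      qed
      ultimately have "((\<lambda>s. H (Y (s\<^sub>0 + hscale s ?x)) (Xf v)) has_derivative (\<lambda>h. H (A (hscale h ?x)) (Xf v))) (at 0)"
        by (rule bounded_linear.has_derivative[rotated])
      then have "((\<lambda>s. H (Y (s\<^sub>0 + hscale s ?x)) (Xf v)) has_field_derivative k) (at 0)"
        unfolding has_field_derivative_def clin_hscale[OF A(1)] H_hscale HAb mult_commute_abs .
      moreover have "H (Y (s\<^sub>0 + hscale 0 ?x)) (Xf v) = 0" using rad_H(1)[OF s\<^sub>1(1)] by (simp add: s\<^sub>1_def)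
      ultimately have "((\<lambda>s. H (Y (s\<^sub>0 + hscale s ?x)) (Xf v) / s) \<longlongrightarrow> k) (at 0)"
        by (simp add: has_field_derivative_iff)
      then have "((\<lambda>s. H (Y (s\<^sub>0 + hscale s ?x)) (Xf v) / s / k) \<longlongrightarrow> k / k) (at 0)"
        by (intro tendsto_intros k)
      moreover have "filterlim (of_real :: real \<Rightarrow> complex) (at 0) (at_right 0)"
        unfolding filterlim_at
      proof
        show "eventually (\<lambda>s. of_real s \<in> UNIV \<and> of_real s \<noteq> (0::complex)) (at_right 0)"
          unfolding eventually_at_right_field by (auto intro: exI[of _ 1])
        show "((of_real :: real \<Rightarrow> complex) \<longlongrightarrow> 0) (at_right 0)"
          using tendsto_of_real[OF tendsto_ident_at[of "0::real" "{0<..}"], where 'a = complex] by simp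
      qed
      ultimately have "((\<lambda>s. H (Y (s\<^sub>0 + hscale (of_real s) ?x)) (Xf v) / of_real s / k) \<longlongrightarrow> k / k) (at_right 0)"
        by (rule filterlim_compose)
      then show "((\<lambda>s. G s b / of_real s) \<longlongrightarrow> 1) (at_right 0)"
        using k by (simp add: G_def mult.commute)
    next
      fix E' assume "E' holomorphic_on UNIV" "\<And>b. E' (of_real b) = a (u + hscale (of_real b) v)"
      then show ?thesis by blast
    qed
  qed
  have a_hom: "a (hscale c x) = c * a x" if "x \<in> ncone" "c \<noteq> 0" for c x
    using Xf_hom[OF that] by (simp add: a_def hcoord_hscale)
  have a_add: "a (u + v) = a u + a v"
    if u: "u \<in> ncone" and v: "v \<in> ncone" and uv: "u + v \<in> ncone" and H: "Re (H u v) = 0" for u v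
  proof (cases "H u v = 0")
    \<comment> \<open>Orthogonal null vectors lie on one leaf, where \<open>Xf\<close> multiplies
      \<open>Xf u\<close> by a scalar and adds the common term \<open>\<beta> u r\<close>.\<close>
    case True
    obtain c where c: "c \<noteq> 0" "v - hscale c u \<in> rad" using perp_same_leaf[OF u v True] by blast
    define r where "r = v - hscale c u"
    have r: "r \<in> rad" "v = hscale c u + r" using c by (simp_all add: r_def)
    have c1: "1 + c \<noteq> 0"
    proof
      assume "1 + c = 0"
      then have "c = - 1" by (simp add: add_eq_0_iff)
      then have "u + v = r" by (simp add: r(2) hscale.minus_left)
      then show False using r(1) uv by (simp add: ncone_def)
    qed
    have leaf: "Xf (hscale d u + r) = hscale d (Xf u) + \<beta> u r" if d: "d \<noteq> 0" for d
    proof -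
      have r': "hscale (inverse d) r \<in> rad" using rad_hscale r(1) by blast
      have "hscale d u + r = hscale d (u + hscale (inverse d) r)" using d by (simp add: hscale_add_right hscale_hscale)
      moreover have "u + hscale (inverse d) r \<in> ncone" using u r' by (simp add: ncone_add_rad)
      ultimately have "Xf (hscale d u + r) = hscale d (Xf u + \<beta> u (hscale (inverse d) r))"
        using Xf_hom d Xf_add_rad[OF u r'] by simp
      then show ?thesis using \<beta>_lin(2)[OF u r(1) r(1)] d by (simp add: hscale_add_right hscale_hscale)
    qed
    have "u + v = hscale (1 + c) u + r" by (simp add: r(2) hscale_add_left add.assoc)
    then have "Xf (u + v) = hscale (1 + c) (Xf u) + \<beta> u r" using leaf[OF c1] by simp
    moreover have "Xf v = hscale c (Xf u) + \<beta> u r" using leaf[OF c(1)] r(2) by simp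
    ultimately have "Xf (u + v) = Xf u + Xf v" by (simp add: hscale_add_left)
    then show ?thesis by (simp add: a_def hcoord_add)
  next
    case False
    have H': "H v u \<noteq> 0" "Re (H v u) = 0" using False H H_cnj[of v u] by simp_all
    obtain E1 where E1: "E1 holomorphic_on UNIV" "\<And>b::real. E1 (of_real b) = a (u + hscale (of_real b) v)"
      using entire[OF u v False H] by blast
    obtain E2 where E2: "E2 holomorphic_on UNIV" "\<And>b::real. E2 (of_real b) = a (v + hscale (of_real b) u)"
      using entire[OF v u H'] by blast
    \<comment> \<open>For \<open>b > 0\<close>, \<open>u + b v\<close> is \<open>b\<close> times
      \<open>v + u / b\<close>, so homogeneity of \<open>a\<close> relates the two entire extensions
      at inverse points.\<close>
    have "E1 1 = E1 0 + E2 0"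
    proof (rule entire_homogeneous_affine[OF E1(1) E2(1)])
      fix b :: real assume b: "b > 0"
      have uvb: "v + hscale (inverse (of_real b)) u \<in> ncone"
      proof -
        have "H (v + hscale (inverse (of_real b)) u) (v + hscale (inverse (of_real b)) u) = 0"
          using u v H'(2) by (intro H_add_null) (simp_all add: ncone_def H_hscale flip: of_real_inverse)
        moreover have "v + hscale (inverse (of_real b)) u \<notin> rad"
        proof
          assume "v + hscale (inverse (of_real b)) u \<in> rad"
          then have "H (v + hscale (inverse (of_real b)) u) u = 0" by (rule rad_H)
          then show False using H'(1) u by (simp add: H_add H_hscale ncone_def)
        qed
        ultimately show ?thesis by (simp add: ncone_def)
      qed
      have "u + hscale (of_real b) v = hscale (of_real b) (v + hscale (inverse (of_real b)) u)"
        using b by (simp add: hscale_add_right hscale_hscale add.commute)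
      then have "a (u + hscale (of_real b) v) = of_real b * a (v + hscale (inverse (of_real b)) u)"
        using a_hom[OF uvb, of "of_real b"] b by simp
      then show "E1 (of_real b) = of_real b * E2 (inverse (of_real b))"
        using E1(2)[of b] E2(2)[of "inverse b"] by simp
    qed
    then show ?thesis using E1(2)[of 1] E1(2)[of 0] E2(2)[of 0] by simp
  qed
  obtain l where l: "\<And>u v. l (u + v) = l u + l v" "\<And>c v. l (hscale c v) = c * l v" "\<And>x. x \<in> ncone \<Longrightarrow> a x = l x"
    using linear_if_additive_on_null_pairs[of a, OF a_hom a_add] by blast
  \<comment> \<open>With \<open>a\<close> replaced by its linear extension \<open>l\<close>, the
    formula \<open>XA\<close> is linear and still gives \<open>Xf\<close> on the cone.\<close>
  define T where "T x = A x + hscale (l x) s\<^sub>1" for x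
  have T: "clin T"
    unfolding clin_def T_def
    by (simp add: l clin_add[OF A(1)] clin_hscale[OF A(1)] hscale_add_left hscale_add_right hscale_hscale)
  have TX: "T x = Xf x" if "x \<in> ncone" for x using XA[OF that] l(3)[OF that] by (simp add: T_def)
  have "surj T"
  proof -
    have cone_range: "y \<in> range T" if y: "y \<in> ncone" for y
    proof -
      have yM: "proj y \<in> M" using y by (simp add: M_def)
      have "inv_into M f (proj y) \<in> M" using goodD(4)[OF good yM] .
      then obtain x where x: "x \<in> ncone" "inv_into M f (proj y) = proj x" by (rule M_cases)
      then have "proj (T x) = proj y" using goodD(5)[OF good yM] Xf(2)[OF x(1)] TX[OF x(1)] by simp
      moreover have "T x \<noteq> 0" using TX[OF x(1)] Xf(1)[OF x(1)] ncone_nonzero by simp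
      ultimately obtain c where "y = hscale c (T x)" using proj_eqD ncone_nonzero[OF y] by blast
      then show ?thesis by (simp add: clin_hscale[OF T, symmetric])
    qed
    have add: "x + y \<in> range T" if "x \<in> range T" "y \<in> range T" for x y
      using that by (auto simp: clin_add[OF T, symmetric])
    have scale: "hscale c x \<in> range T" if "x \<in> range T" for c x
      using that by (auto simp: clin_hscale[OF T, symmetric])
    have q: "npt 0 0 \<in> range T" and p: "pinf \<in> range T"
      using cone_range npt_ncone pinf_in_ncone by blast+
    have z: "(0, z, 0) \<in> range T" for z
    proof -
      have "npt z 0 + (hscale (- 1) (npt 0 0) + hscale (- \<i> * herm z z) pinf) \<in> range T"
        by (intro add scale q p cone_range npt_ncone)
      moreover have "npt z 0 + (hscale (- 1) (npt 0 0) + hscale (- \<i> * herm z z) pinf) = (0, z, 0)"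
        by (rule homog_eqI) simp_all
      ultimately show ?thesis by simp
    qed
    have "v \<in> range T" for v
      using add[OF add[OF scale[OF q, of "fst v"] z[of "fst (snd v)"]] scale[OF p, of "snd (snd v)"]]
        hcoord_expand[of v] by (simp add: pinf_def npt_def)
    then show ?thesis by blast
  qed
  moreover have "f (proj x) = proj (T x)" if "x \<in> ncone" for x using Xf(2)[OF that] TX[OF that] by simp
  ultimately show ?thesis using T by blast
qed

end

section \<open>Extension of CR-automorphisms\<close>

definition form_sign :: "(nat \<Rightarrow> 'n::finite) \<Rightarrow> nat \<Rightarrow> nat \<Rightarrow> 'n \<Rightarrow> real" where
  "form_sign idx m k j = (if j \<in> idx ` {1..m} then 1 else if j \<in> idx ` {m+1..k} then -1 else 0)"

lemma form_sign_eq_0_iff: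
  assumes "m \<le> k"
  shows "form_sign idx m k j = 0 \<longleftrightarrow> j \<notin> idx ` {1..k}"
proof -
  have "{1..k} = {1..m} \<union> {m+1..k}" using assms by auto
  then show ?thesis by (auto simp: form_sign_def)
qed

lemma hform_eq_sum:
  assumes idx: "bij_betw idx {1..n} (UNIV :: 'n::finite set)" and mk: "m \<le> k" "k < n"
  shows "hform idx m k z = (\<Sum>j\<in>UNIV. form_sign idx m k j * (cmod (z $ j))\<^sup>2)"
proof -
  have inj: "inj_on idx {1..n}" using idx by (rule bij_betw_imp_inj_on)
  let ?g = "\<lambda>j. form_sign idx m k j * (cmod (z $ j))\<^sup>2"
  have sub: "{1..m} \<subseteq> {1..n}" "{m+1..k} \<subseteq> {1..n}" using mk by auto
  have disj: "idx ` {1..m} \<inter> idx ` {m+1..k} = {}"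
    unfolding inj_on_image_Int[OF inj sub, symmetric] by auto
  have "(\<Sum>j\<in>UNIV. ?g j) = (\<Sum>j\<in>idx ` {1..m} \<union> idx ` {m+1..k}. ?g j)"
    by (rule sum.mono_neutral_right) (auto simp: form_sign_def)
  also have "\<dots> = (\<Sum>j\<in>idx ` {1..m}. ?g j) + (\<Sum>j\<in>idx ` {m+1..k}. ?g j)"
    using disj by (intro sum.union_disjoint) auto
  also have "(\<Sum>j\<in>idx ` {1..m}. ?g j) = (\<Sum>j=1..m. (cmod (z $ idx j))\<^sup>2)"
    by (subst sum.reindex[OF inj_on_subset[OF inj sub(1)]]) (auto simp: form_sign_def intro!: sum.cong)
  also have "(\<Sum>j\<in>idx ` {m+1..k}. ?g j) = (\<Sum>j=m+1..k. - ((cmod (z $ idx j))\<^sup>2))"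
  proof (subst sum.reindex[OF inj_on_subset[OF inj sub(2)]], rule sum.cong)
    fix j assume "j \<in> {m+1..k}"
    then have "idx j \<in> idx ` {m+1..k}" by blast
    moreover from this have "idx j \<notin> idx ` {1..m}" using disj by blast
    ultimately show "(?g \<circ> idx) j = - ((cmod (z $ idx j))\<^sup>2)" by (simp add: form_sign_def)
  qed simp
  finally show ?thesis by (simp add: hform_def sum_negf)
qed

section \<open>The given quadric as an instance, and the two cases of its signature\<close>

locale quadric_signs =
  fixes m k n :: nat and idx :: "nat \<Rightarrow> 'n::finite"
  assumes idx: "bij_betw idx {1..n} UNIV" and mk: "m \<le> k" "k < n"
begin

lemma idx_image_iff: "a \<in> {1..n} \<Longrightarrow> B \<subseteq> {1..n} \<Longrightarrow> idx a \<in> idx ` B \<longleftrightarrow> a \<in> B"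
  by (rule inj_on_image_mem_iff[OF bij_betw_imp_inj_on[OF idx]])

abbreviation "sgns \<equiv> form_sign idx m k"

sublocale hermitian_quadric sgns
  by standard (simp add: form_sign_def)

lemma H_self_eq_0_iff:
  "H v v = 0 \<longleftrightarrow> (snd (snd v) * cnj (fst v) - fst v * cnj (snd (snd v))) / (2 * \<i>)
      = of_real (hform idx m k (fst (snd v)))"
proof -
  have "herm z z = of_real (hform idx m k z)" for z
    unfolding herm_def hform_eq_sum[OF idx mk] by (simp add: mult.assoc complex_norm_square[symmetric])
  then show ?thesis by (simp add: H_def)
qed

lemma singular_set_eq: "singular_set idx k = sing"
proof -
  have rad: "(0, z, 0) \<in> rad \<longleftrightarrow> (\<forall>j\<in>{1..k}. z $ idx j = 0)" for z
    using form_sign_eq_0_iff[OF mk(1)] by (auto simp: rad_def)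
  have split: "v = (0, fst (snd v), 0)" if "v \<in> rad" for v
    using that by (simp add: rad_def prod_eq_iff)
  have "v \<in> rad - {0} \<longleftrightarrow> (\<exists>z. v = (0, z, 0) \<and> z \<noteq> 0 \<and> (0, z, 0) \<in> rad)" for v
  proof
    assume "v \<in> rad - {0}"
    then show "\<exists>z. v = (0, z, 0) \<and> z \<noteq> 0 \<and> (0, z, 0) \<in> rad"
      using split[of v] by (intro exI[of _ "fst (snd v)"]) (auto simp: zero_prod_def)
  qed (auto simp: zero_prod_def)
  then have "rad - {0} = {(0, z, 0) | z. z \<noteq> 0 \<and> (\<forall>j\<in>{1..k}. z $ idx j = 0)}"
    unfolding rad by blast
  moreover have "singular_set idx k = proj ` {(0, z, 0) | z. z \<noteq> 0 \<and> (\<forall>j\<in>{1..k}. z $ idx j = 0)}"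
    unfolding singular_set_def by (simp only: setcompr_eq_image image_image)
  ultimately show ?thesis by (simp only: sing_def)
qed

lemma closed_quadric_eq_M_sing: "closed_quadric idx m k = M \<union> sing"
proof -
  have "closed_quadric idx m k = proj ` {v. v \<noteq> 0 \<and> H v v = 0}"
    unfolding closed_quadric_eq H_self_eq_0_iff by force
  also have "{v. v \<noteq> 0 \<and> H v v = 0} = ncone \<union> (rad - {0})"
    using ncone_nonzero rad_H by (auto simp: ncone_def)
  finally show ?thesis by (simp only: image_Un M_def sing_def)
qed

lemma regular_quadric_eq: "regular_quadric idx m k = M"
  unfolding regular_quadric_def closed_quadric_eq_M_sing singular_set_eq using M_sing_disjoint by blast

lemma CR_automorphismD:
  assumes "CR_automorphism_closed_quadric idx m k f"
  shows "bij_betw f (M \<union> sing) (M \<union> sing)" "f ` M = M" "C1_CR_automorphism M f"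
    "k = m \<Longrightarrow> \<exists>U F. open U \<and> sing \<subseteq> U \<and> holomorphic_proj F U \<and> (\<forall>p\<in>U \<inter> (M \<union> sing). F p = f p)"
  using assms
  unfolding CR_automorphism_closed_quadric_def regular_quadric_eq closed_quadric_eq_M_sing singular_set_eq
  by simp_all

lemma maps_sing_to_sing:
  assumes bij: "bij_betw f (M \<union> sing) (M \<union> sing)" and fM: "f ` M = M" and p: "p \<in> sing"
  shows "f p \<in> sing"
proof -
  have "f p \<notin> M"
  proof
    assume "f p \<in> M"
    then have "f p \<in> f ` M" using fM by simp
    then obtain q where q: "q \<in> M" "f p = f q" by blast
    then have "p = q" using inj_onD[OF bij_betw_imp_inj_on[OF bij]] p by blast
    then show False using p q(1) M_sing_disjoint by blast
  qed
  then show ?thesis using bij_betw_apply[OF bij, of p] p by blast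
qed

lemma linear_if_CR_automorphism:
  assumes k2m: "k \<le> 2 * m" and f: "CR_automorphism_closed_quadric idx m k f"
  shows "\<exists>T. clin T \<and> surj T \<and> (\<forall>x\<in>ncone. f (proj x) = proj (T x))"
proof -
  note fD = CR_automorphismD[OF f]
  have good: "good f" by (rule good_CR[OF fD(3)])
  show ?thesis
  proof (cases "k = m")
    case True
    then obtain U F where F: "sing \<subseteq> U" "holomorphic_proj F U" "\<forall>p\<in>U \<inter> (M \<union> sing). F p = f p"
      using fD(4) by blast
    interpret definite_map sgns f F U
    proof
      show "sgns j \<ge> 0" for j using True by (simp add: form_sign_def)
      show "f p \<in> sing" if p: "p \<in> sing" for p
        using maps_sing_to_sing[OF fD(1,2) p] .
      \<comment> \<open>As \<open>k < n\<close>, the last coordinate has sign 0, so the radical is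
        nontrivial.\<close>
      have "idx n \<notin> idx ` {1..k}"
        using mk by (subst idx_image_iff) auto
      then show "\<exists>j. sgns j = 0" using form_sign_eq_0_iff[OF mk(1)] by blast
    qed (use good F in blast)+
    show ?thesis by (rule linear)
  next
    case False
    \<comment> \<open>\<open>m = 0\<close> would force \<open>k = 0\<close> by
      \<open>k \<le> 2 * m\<close>; so \<open>k \<noteq> m\<close> means that both signs
      occur.\<close>
    then have m: "1 \<le> m" "m < k" using mk k2m by auto
    interpret indefinite_quadric sgns
    proof
      have "idx 1 \<in> idx ` {1..m}" using m by auto
      then show "\<exists>j. sgns j = 1" unfolding form_sign_def by (intro exI[of _ "idx 1"]) simp
      have "idx k \<notin> idx ` {1..m}" using mk m by (subst idx_image_iff) auto
      moreover have "idx k \<in> idx ` {m+1..k}" using m by auto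
      ultimately show "\<exists>j. sgns j = -1" unfolding form_sign_def by (intro exI[of _ "idx k"]) simp
    qed
    show ?thesis using good by (rule linear_if_good)
  qed
qed

end

theorem theorem1p3:
  fixes m k n :: nat
    and idx :: "nat \<Rightarrow> 'n::finite"
    and f :: "'n cproj \<Rightarrow> 'n cproj"
  assumes "n = CARD('n)" and "bij_betw idx {1..n} UNIV"
    and "m \<le> k" and "k \<le> 2 * m" and "k < n"
    and "CR_automorphism_closed_quadric idx m k f"
  shows "\<exists>F. holomorphic_automorphism F \<and>
           (\<forall>p\<in>regular_quadric idx m k. F p = f p) \<and>
           (k = m \<or> n = k + 1 \<or> continuous_on (closed_quadric idx m k) f \<longrightarrow>
              (\<forall>p\<in>closed_quadric idx m k. F p = f p))"
proof -
  interpret quadric_signs m k n idx by standard (use assms in auto)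
  obtain T where T: "clin T" "surj T" and fT: "\<forall>x\<in>ncone. f (proj x) = proj (T x)"
    using linear_if_CR_automorphism[OF assms(4,6)] by blast
  note ext = linear_extension[OF T fT]
  note fD = CR_automorphismD[OF assms(6)]
  have "pmap T p = f p" if p: "p \<in> sing" and "k = m \<or> n = k + 1 \<or> continuous_on (M \<union> sing) f" for p
    using that(2)
  proof (elim disjE)
    assume "k = m"
    then obtain U F where "open U" "sing \<subseteq> U" "holomorphic_proj F U" "\<forall>p\<in>U \<inter> (M \<union> sing). F p = f p"
      using fD(4) by blast
    then show ?thesis using ext(3)[of U F p] p by blast
  next
    assume n: "n = k + 1"
    \<comment> \<open>Only the last index has sign 0, so the singular set is a single point, and it
      suffices that the linear map preserves it.\<close>
    have "{1..n} = insert n {1..k}" using n by auto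
    then have "UNIV = insert (idx n) (idx ` {1..k})" using bij_betw_imp_surj_on[OF assms(2)] by auto
    moreover have "idx n \<notin> idx ` {1..k}" using assms(5) by (subst idx_image_iff) auto
    ultimately have "\<exists>!j. sgns j = 0" unfolding form_sign_eq_0_iff[OF assms(3)] by (intro ex1I[of _ "idx n"]) auto
    then show ?thesis using ext(5)[OF fD(2) maps_sing_to_sing[OF fD(1,2) p] _ p] by blast
  next
    assume "continuous_on (M \<union> sing) f"
    then show ?thesis using ext(4)[OF _ p] by blast
  qed
  then show ?thesis
    unfolding regular_quadric_eq closed_quadric_eq_M_sing
    using ext(1) ext(2) by (intro exI[of _ "pmap T"]) blast
qed

end
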